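(* Let $\{G_i\}_{i\in\mathbb{N}}$ (with $\mathbb{N}=\{1,2,3,\dots\}$) be a fixed collection of non-trivial finitely generated groups. Let $p=p(n)$ be a function of $n$ with $0<p<1$. For a random graph $\Gamma\in G(n,p)$ on the vertex set $\{1,\dots,n\}$, let $\mathcal{G}_\Gamma=\mathcal{G}(\Gamma,\{G_i\})$ be the associated graph product, in which the vertex $i$ carries the group $G_i$. Then: (1) If $(1-p)n^2\to 0$ as $n\to\infty$, then $\mathcal{G}_\Gamma$ is isomorphic to the direct product $G_1\times\dots\times G_n$, asymptotically almost surely. (2) If $pn\to 0$ as $n\to\infty$, then $\mathcal{G}_\Gamma$ is weakly hyperbolic relative to the family of subgroups $\{G_i\}_{i\le n}$, asymptotically almost surely. (3) If $pn\to\infty$ and $(1-p)n^2\to\infty$ as $n\to\infty$, then $\mathcal{G}_\Gamma$ is not weakly hyperbolic relative to the family of subgroups $\{G_i\}_{i\le n}$, asymptotically almost surely.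
   Context: Graph product: for a finite simplicial graph $\Gamma$ with vertex set $V$ and non-trivial finitely generated groups $\{G_v\}_{v\in V}$, the graph product $\mathcal{G}(\Gamma,\{G_v\})$ is the quotient of the free product of the groups $G_v$ ($v\in V$) by the relations that every element of $G_v$ commutes with every element of $G_w$ whenever $v,w$ are connected by an edge of $\Gamma$. Each $G_v$ is regarded as a subgroup of the graph product. Weak relative hyperbolicity: a finitely generated group $G$ is weakly hyperbolic relative to a family $\mathcal{H}$ of subgroups if the graph obtained from the Cayley graph of $G$ (with respect to a finite generating set) by coning off all cosets $gH$, $g\in G$, $H\in\mathcal{H}$ (i.e. adding, for each such coset, a new vertex joined by an edge to every element of the coset) is Gromov hyperbolic. Random graph model (Erdős–Rényi): $G(n,p)$ is the probability space of all graphs on the vertex set $\{1,\dots,n\}$, each edge of the complete graph being included independently with probability $p=p(n)$; thus $\mathrm{Prob}(\Gamma)=p^{E_\Gamma}(1-p)^{\binom n2-E_\Gamma}$, where $E_\Gamma$ is the number of edges of $\Gamma$. A statement about $\Gamma\in G(n,p)$ holds asymptotically almost surely if the probability that it holds tends to $1$ as $n\to\infty$. *)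

theory Defs
  imports
    "HOL-Algebra.Algebra"
    "HOL-Probability.Probability"
begin

section \<open>Free products and graph products\<close>

text \<open>
  The free product of the groups \<open>G i\<close>, \<open>i \<in> I\<close>: words in the letters \<open>(i, g)\<close> with
  \<open>g \<in> carrier (G i)\<close>, up to the congruence generated by multiplying adjacent letters of the
  same group and deleting trivial letters.
\<close>

definition fp_words :: "'i set \<Rightarrow> ('i \<Rightarrow> ('a, 'm) monoid_scheme) \<Rightarrow> ('i \<times> 'a) list set" where
  "fp_words I G = lists (SIGMA i:I. carrier (G i))"

inductive_set fp_rel ::
    "'i set \<Rightarrow> ('i \<Rightarrow> ('a, 'm) monoid_scheme) \<Rightarrow> (('i \<times> 'a) list \<times> ('i \<times> 'a) list) set"
  for I :: "'i set" and G :: "'i \<Rightarrow> ('a, 'm) monoid_scheme" where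
  refl: "u \<in> fp_words I G \<Longrightarrow> (u, u) \<in> fp_rel I G"
| sym: "(u, v) \<in> fp_rel I G \<Longrightarrow> (v, u) \<in> fp_rel I G"
| trans: "(u, v) \<in> fp_rel I G \<Longrightarrow> (v, w) \<in> fp_rel I G \<Longrightarrow> (u, w) \<in> fp_rel I G"
| mult: "\<lbrakk>u \<in> fp_words I G; v \<in> fp_words I G; i \<in> I; g \<in> carrier (G i); h \<in> carrier (G i)\<rbrakk>
    \<Longrightarrow> (u @ [(i, g), (i, h)] @ v, u @ [(i, g \<otimes>\<^bsub>G i\<^esub> h)] @ v) \<in> fp_rel I G"
| one: "\<lbrakk>u \<in> fp_words I G; v \<in> fp_words I G; i \<in> I\<rbrakk>
    \<Longrightarrow> (u @ [(i, \<one>\<^bsub>G i\<^esub>)] @ v, u @ v) \<in> fp_rel I G"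

definition free_product ::
    "'i set \<Rightarrow> ('i \<Rightarrow> ('a, 'm) monoid_scheme) \<Rightarrow> ('i \<times> 'a) list set monoid" where
  "free_product I G =
     \<lparr>carrier = fp_words I G // fp_rel I G,
      monoid.mult = (\<lambda>A B. \<Union>a\<in>A. \<Union>b\<in>B. fp_rel I G `` {a @ b}),
      one = fp_rel I G `` {[]}\<rparr>"

definition fp_incl ::
    "'i set \<Rightarrow> ('i \<Rightarrow> ('a, 'm) monoid_scheme) \<Rightarrow> 'i \<Rightarrow> 'a \<Rightarrow> ('i \<times> 'a) list set" where
  "fp_incl I G i g = fp_rel I G `` {[(i, g)]}"

definition normal_closure :: "('a, 'm) monoid_scheme \<Rightarrow> 'a set \<Rightarrow> 'a set" where
  "normal_closure F A = \<Inter>{N. N \<lhd> F \<and> A \<subseteq> N}"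

text \<open>A simple graph with vertex set \<open>V\<close> is given by its set \<open>E \<subseteq> all_edges V\<close> of edges.\<close>

definition all_edges :: "'v set \<Rightarrow> 'v set set" where
  "all_edges V = {e. e \<subseteq> V \<and> card e = 2}"

definition gp_relators ::
    "'v set \<Rightarrow> 'v set set \<Rightarrow> ('v \<Rightarrow> ('a, 'm) monoid_scheme) \<Rightarrow> ('v \<times> 'a) list set set" where
  "gp_relators V E G =
     {fp_incl V G v g \<otimes>\<^bsub>F\<^esub> fp_incl V G w h
        \<otimes>\<^bsub>F\<^esub> inv\<^bsub>F\<^esub> (fp_incl V G v g) \<otimes>\<^bsub>F\<^esub> inv\<^bsub>F\<^esub> (fp_incl V G w h)
      | F v w g h. F = free_product V G \<and> v \<in> V \<and> w \<in> V \<and> {v, w} \<in> E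
          \<and> g \<in> carrier (G v) \<and> h \<in> carrier (G w)}"

definition graph_product ::
    "'v set \<Rightarrow> 'v set set \<Rightarrow> ('v \<Rightarrow> ('a, 'm) monoid_scheme)
       \<Rightarrow> ('v \<times> 'a) list set set monoid" where
  "graph_product V E G =
     free_product V G Mod normal_closure (free_product V G) (gp_relators V E G)"

definition gp_incl ::
    "'v set \<Rightarrow> 'v set set \<Rightarrow> ('v \<Rightarrow> ('a, 'm) monoid_scheme) \<Rightarrow> 'v \<Rightarrow> 'a
       \<Rightarrow> ('v \<times> 'a) list set set" where
  "gp_incl V E G v g =
     normal_closure (free_product V G) (gp_relators V E G) #>\<^bsub>free_product V G\<^esub> fp_incl V G v g"

text \<open>The group \<open>G v\<close> regarded as a subgroup of the graph product.\<close>

definition vertex_subgroup ::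
    "'v set \<Rightarrow> 'v set set \<Rightarrow> ('v \<Rightarrow> ('a, 'm) monoid_scheme) \<Rightarrow> 'v
       \<Rightarrow> ('v \<times> 'a) list set set set" where
  "vertex_subgroup V E G v = gp_incl V E G v ` carrier (G v)"


subsection \<open>Basic facts\<close>

lemma fp_words_append [simp]:
  "u @ v \<in> fp_words I G \<longleftrightarrow> u \<in> fp_words I G \<and> v \<in> fp_words I G"
  by (auto simp: fp_words_def)

lemma fp_words_Nil [simp]: "[] \<in> fp_words I G"
  by (simp add: fp_words_def)

lemma fp_words_Cons [simp]:
  "(i, g) # u \<in> fp_words I G \<longleftrightarrow> i \<in> I \<and> g \<in> carrier (G i) \<and> u \<in> fp_words I G"
  by (auto simp: fp_words_def)

context
  fixes I :: "'i set" and G :: "'i \<Rightarrow> ('a, 'm) monoid_scheme"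
  assumes grp: "\<And>i. i \<in> I \<Longrightarrow> group (G i)"
begin

lemma fp_rel_in_words: "(u, v) \<in> fp_rel I G \<Longrightarrow> u \<in> fp_words I G \<and> v \<in> fp_words I G"
proof (induction rule: fp_rel.induct)
  case (mult u v i g h)
  then interpret group "G i" by (simp add: grp)
  show ?case using mult by simp
next
  case (one u v i)
  then interpret group "G i" by (simp add: grp)
  show ?case using one by simp
qed auto

lemma equiv_fp_rel: "equiv (fp_words I G) (fp_rel I G)"
proof (rule equivI)
  show "refl_on (fp_words I G) (fp_rel I G)"
    by (rule refl_onI) (auto intro: fp_rel.refl)
  show "fp_rel I G \<subseteq> fp_words I G \<times> fp_words I G"
    using fp_rel_in_words by auto
  show "Relation.sym (fp_rel I G)"
    by (rule symI) (rule fp_rel.sym)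
  show "Relation.trans (fp_rel I G)"
    by (rule transI) (rule fp_rel.trans)
qed

lemma fp_rel_context:
  assumes "(u, v) \<in> fp_rel I G" "x \<in> fp_words I G" "y \<in> fp_words I G"
  shows "(x @ u @ y, x @ v @ y) \<in> fp_rel I G"
  using assms(1)
proof (induction rule: fp_rel.induct)
  case (refl u)
  then show ?case using assms by (simp add: fp_rel.refl)
next
  case (sym u v)
  then show ?case by (blast intro: fp_rel.sym)
next
  case (trans u v w)
  then show ?case by (blast intro: fp_rel.trans)
next
  case (mult u v i g h)
  then show ?case using fp_rel.mult[of "x @ u" I G "v @ y" i g h] assms by simp
next
  case (one u v i)
  then show ?case using fp_rel.one[of "x @ u" I G "v @ y" i] assms by simp
qed

lemma fp_rel_append:
  assumes "(u, v) \<in> fp_rel I G" "(u', v') \<in> fp_rel I G"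
  shows "(u @ u', v @ v') \<in> fp_rel I G"
proof -
  have "(u @ u', v @ u') \<in> fp_rel I G" "(v @ u', v @ v') \<in> fp_rel I G"
    using fp_rel_context[OF assms(1), of "[]" u'] fp_rel_context[OF assms(2), of v "[]"]
      fp_rel_in_words[OF assms(1)] fp_rel_in_words[OF assms(2)] by simp_all
  then show ?thesis by (rule fp_rel.trans)
qed

lemma fp_class_mult:
  assumes "u \<in> fp_words I G" "v \<in> fp_words I G"
  shows "fp_rel I G `` {u} \<otimes>\<^bsub>free_product I G\<^esub> fp_rel I G `` {v} = fp_rel I G `` {u @ v}"
proof -
  let ?u = "fp_rel I G `` {u}" and ?v = "fp_rel I G `` {v}" and ?uv = "fp_rel I G `` {u @ v}"
  have "fp_rel I G `` {a @ b} = ?uv" if "a \<in> ?u" "b \<in> ?v" for a b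
  proof -
    have "(u, a) \<in> fp_rel I G" "(v, b) \<in> fp_rel I G"
      using that by simp_all
    then show ?thesis
      by (rule equiv_class_eq[OF equiv_fp_rel, symmetric, OF fp_rel_append])
  qed
  then have "(\<Union>a\<in>?u. \<Union>b\<in>?v. fp_rel I G `` {a @ b}) = (\<Union>a\<in>?u. \<Union>b\<in>?v. ?uv)"
    by (intro SUP_cong[OF HOL.refl]) blast
  moreover have "u \<in> ?u" "v \<in> ?v"
    using assms fp_rel.refl by fastforce+
  then have "(\<Union>a\<in>?u. \<Union>b\<in>?v. ?uv) = ?uv"
    by blast
  ultimately show ?thesis
    by (simp only: free_product_def monoid.simps partial_object.simps)
qed

lemma fp_class_carrier: "u \<in> fp_words I G \<Longrightarrow> fp_rel I G `` {u} \<in> carrier (free_product I G)"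
  by (simp add: free_product_def quotientI)

lemma fp_class_cases:
  assumes "A \<in> carrier (free_product I G)"
  obtains u where "u \<in> fp_words I G" "A = fp_rel I G `` {u}"
  using assms by (auto simp: free_product_def elim: quotientE)

lemma fp_one: "\<one>\<^bsub>free_product I G\<^esub> = fp_rel I G `` {[]}"
  by (simp add: free_product_def)

lemma fp_left_inverse:
  assumes "u \<in> fp_words I G"
  shows "\<exists>v \<in> fp_words I G. (v @ u, []) \<in> fp_rel I G"
  using assms
proof (induction u)
  case Nil
  then show ?case using fp_rel.refl by fastforce
next
  case (Cons x u)
  obtain i g where x: "x = (i, g)" by force
  with Cons.prems have i: "i \<in> I" "g \<in> carrier (G i)" and u: "u \<in> fp_words I G" by auto
  interpret group "G i" using i(1) by (rule grp)
  from Cons.IH[OF u] obtain v where v: "v \<in> fp_words I G" "(v @ u, []) \<in> fp_rel I G" by blast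
  have "(v @ [(i, inv\<^bsub>G i\<^esub> g), (i, g)] @ u, v @ [(i, \<one>\<^bsub>G i\<^esub>)] @ u) \<in> fp_rel I G"
    using fp_rel.mult[of v I G u i "inv\<^bsub>G i\<^esub> g" g] v u i by simp
  moreover have "(v @ [(i, \<one>\<^bsub>G i\<^esub>)] @ u, v @ u) \<in> fp_rel I G"
    using v u i by (intro fp_rel.one)
  ultimately have "((v @ [(i, inv\<^bsub>G i\<^esub> g)]) @ x # u, []) \<in> fp_rel I G"
    using v(2) x by (auto intro: fp_rel.trans)
  moreover have "v @ [(i, inv\<^bsub>G i\<^esub> g)] \<in> fp_words I G"
    using v i by simp
  ultimately show ?case by blast
qed

lemma group_free_product: "group (free_product I G)"
proof (rule groupI)
  fix A B assume "A \<in> carrier (free_product I G)" "B \<in> carrier (free_product I G)"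
  then show "A \<otimes>\<^bsub>free_product I G\<^esub> B \<in> carrier (free_product I G)"
    by (auto elim!: fp_class_cases simp: fp_class_mult fp_class_carrier)
next
  show "\<one>\<^bsub>free_product I G\<^esub> \<in> carrier (free_product I G)"
    by (simp add: fp_one fp_class_carrier)
next
  fix A B C
  assume "A \<in> carrier (free_product I G)" "B \<in> carrier (free_product I G)"
    "C \<in> carrier (free_product I G)"
  then show "A \<otimes>\<^bsub>free_product I G\<^esub> B \<otimes>\<^bsub>free_product I G\<^esub> C
      = A \<otimes>\<^bsub>free_product I G\<^esub> (B \<otimes>\<^bsub>free_product I G\<^esub> C)"
    by (auto elim!: fp_class_cases simp: fp_class_mult)
next
  fix A assume "A \<in> carrier (free_product I G)"
  then show "\<one>\<^bsub>free_product I G\<^esub> \<otimes>\<^bsub>free_product I G\<^esub> A = A"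
    by (auto elim!: fp_class_cases simp: fp_class_mult fp_one)
next
  fix A assume "A \<in> carrier (free_product I G)"
  then obtain u where u: "u \<in> fp_words I G" "A = fp_rel I G `` {u}" by (rule fp_class_cases)
  then obtain v where "v \<in> fp_words I G" "(v @ u, []) \<in> fp_rel I G"
    using fp_left_inverse by blast
  then show "\<exists>B\<in>carrier (free_product I G). B \<otimes>\<^bsub>free_product I G\<^esub> A = \<one>\<^bsub>free_product I G\<^esub>"
    using u equiv_class_eq[OF equiv_fp_rel] fp_class_carrier
    by (intro bexI[of _ "fp_rel I G `` {v}"]) (auto simp: fp_class_mult fp_one)
qed

lemma fp_incl_hom:
  assumes "i \<in> I"
  shows "fp_incl I G i \<in> hom (G i) (free_product I G)"
proof (rule homI)
  fix g h assume gh: "g \<in> carrier (G i)" "h \<in> carrier (G i)"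
  show "fp_incl I G i (g \<otimes>\<^bsub>G i\<^esub> h) = fp_incl I G i g \<otimes>\<^bsub>free_product I G\<^esub> fp_incl I G i h"
    using equiv_class_eq[OF equiv_fp_rel] fp_rel.mult[of "[]" I G "[]" i g h] gh assms
    by (simp add: fp_incl_def fp_class_mult)
qed (use assms in \<open>simp add: fp_incl_def fp_class_carrier\<close>)

end

lemma normal_normal_closure:
  assumes "group F" "A \<subseteq> carrier F"
  shows "normal_closure F A \<lhd> F"
proof -
  interpret group F by fact
  have "carrier F \<lhd> F"
    by (intro normal_invI subgroup_self) auto
  then have ne: "{N. N \<lhd> F \<and> A \<subseteq> N} \<noteq> {}"
    using assms(2) by auto
  show ?thesis
    unfolding normal_closure_def
  proof (rule normal_invI)
    show "subgroup (\<Inter>{N. N \<lhd> F \<and> A \<subseteq> N}) F"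
      using ne by (intro subgroups_Inter) (auto intro: normal_imp_subgroup)
  qed (auto dest: normal.inv_op_closed2)
qed

context
  fixes V :: "'v set" and E :: "'v set set" and G :: "'v \<Rightarrow> ('a, 'm) monoid_scheme"
  assumes grp: "\<And>v. v \<in> V \<Longrightarrow> group (G v)"
begin

lemma gp_relators_carrier: "gp_relators V E G \<subseteq> carrier (free_product V G)"
proof -
  interpret F: group "free_product V G" by (rule group_free_product[OF grp])
  have "fp_incl V G v g \<in> carrier (free_product V G)" if "v \<in> V" "g \<in> carrier (G v)" for v g
    by (rule hom_in_carrier[OF fp_incl_hom]) (use grp that in auto)
  then show ?thesis
    by (auto simp: gp_relators_def)
qed

lemma gp_kernel_normal:
  "normal_closure (free_product V G) (gp_relators V E G) \<lhd> free_product V G"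
  by (intro normal_normal_closure group_free_product grp gp_relators_carrier)

lemma group_graph_product: "group (graph_product V E G)"
  unfolding graph_product_def by (rule normal.factorgroup_is_group[OF gp_kernel_normal])

lemma gp_incl_hom:
  assumes "v \<in> V"
  shows "gp_incl V E G v \<in> hom (G v) (graph_product V E G)"
  using hom_compose[OF fp_incl_hom[OF grp assms] normal.r_coset_hom_Mod[OF gp_kernel_normal]]
  by (simp add: graph_product_def gp_incl_def [abs_def] comp_def)

lemma vertex_subgroup_subgroup:
  assumes "v \<in> V"
  shows "subgroup (vertex_subgroup V E G v) (graph_product V E G)"
proof -
  interpret group_hom "G v" "graph_product V E G" "gp_incl V E G v"
    by (intro group_hom.intro group_hom_axioms.intro grp group_graph_product gp_incl_hom assms)
  show ?thesis unfolding vertex_subgroup_def by (rule img_is_subgroup)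
qed

end


section \<open>Weak relative hyperbolicity\<close>

text \<open>
  A graph is given by a vertex set and a symmetric adjacency relation; its vertex set carries
  the combinatorial path metric.
\<close>

definition graph_dist :: "('v \<times> 'v) set \<Rightarrow> 'v \<Rightarrow> 'v \<Rightarrow> nat" where
  "graph_dist R x y = (LEAST k. (x, y) \<in> R ^^ k)"

definition gromov_product :: "('v \<Rightarrow> 'v \<Rightarrow> real) \<Rightarrow> 'v \<Rightarrow> 'v \<Rightarrow> 'v \<Rightarrow> real" where
  "gromov_product d w x y = (d x w + d y w - d x y) / 2"

definition gromov_hyperbolic :: "'v set \<Rightarrow> ('v \<Rightarrow> 'v \<Rightarrow> real) \<Rightarrow> bool" where
  "gromov_hyperbolic V d \<longleftrightarrow>
     (\<exists>c. \<forall>w\<in>V. \<forall>x\<in>V. \<forall>y\<in>V. \<forall>z\<in>V.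
        gromov_product d w x z \<ge> min (gromov_product d w x y) (gromov_product d w y z) - c)"

text \<open>Connectedness is required since \<open>graph_dist\<close> is meaningless between different components.\<close>

definition hyperbolic_graph :: "'v set \<Rightarrow> ('v \<times> 'v) set \<Rightarrow> bool" where
  "hyperbolic_graph V R \<longleftrightarrow>
     (\<forall>x\<in>V. \<forall>y\<in>V. (x, y) \<in> R\<^sup>*) \<and> gromov_hyperbolic V (\<lambda>x y. real (graph_dist R x y))"

definition cayley_adj :: "('a, 'm) monoid_scheme \<Rightarrow> 'a set \<Rightarrow> ('a \<times> 'a) set" where
  "cayley_adj K S = (let R = {(g, g \<otimes>\<^bsub>K\<^esub> s) | g s. g \<in> carrier K \<and> s \<in> S} in R \<union> R\<inverse>)"

definition left_cosets :: "('a, 'm) monoid_scheme \<Rightarrow> 'a set set \<Rightarrow> 'a set set" where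
  "left_cosets K \<H> = {g <#\<^bsub>K\<^esub> H | g H. g \<in> carrier K \<and> H \<in> \<H>}"

text \<open>The coned-off graph: \<open>Inl g\<close> is the group element \<open>g\<close>, \<open>Inr C\<close> the cone point over the coset \<open>C\<close>.\<close>

definition coned_off_verts :: "('a, 'm) monoid_scheme \<Rightarrow> 'a set set \<Rightarrow> ('a + 'a set) set" where
  "coned_off_verts K \<H> = Inl ` carrier K \<union> Inr ` left_cosets K \<H>"

definition coned_off_adj ::
    "('a, 'm) monoid_scheme \<Rightarrow> 'a set \<Rightarrow> 'a set set \<Rightarrow> (('a + 'a set) \<times> ('a + 'a set)) set" where
  "coned_off_adj K S \<H> =
     (let C = {(Inl x, Inr c) | x c. c \<in> left_cosets K \<H> \<and> x \<in> c}
      in {(Inl g, Inl h) | g h. (g, h) \<in> cayley_adj K S} \<union> C \<union> C\<inverse>)"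

definition finite_generating_set :: "('a, 'm) monoid_scheme \<Rightarrow> 'a set \<Rightarrow> bool" where
  "finite_generating_set K S \<longleftrightarrow> finite S \<and> S \<subseteq> carrier K \<and> generate K S = carrier K"

definition finitely_generated_group :: "('a, 'm) monoid_scheme \<Rightarrow> bool" where
  "finitely_generated_group K \<longleftrightarrow> group K \<and> (\<exists>S. finite_generating_set K S)"

text \<open>
  Hyperbolicity of the coned-off graph does not depend on the finite generating set, so that
  the quantification over \<open>S\<close> could equivalently be universal for a finitely generated group.
\<close>

definition weakly_hyperbolic :: "('a, 'm) monoid_scheme \<Rightarrow> 'a set set \<Rightarrow> bool" where
  "weakly_hyperbolic K \<H> \<longleftrightarrow>
     (\<exists>S. finite_generating_set K S \<and>
        hyperbolic_graph (coned_off_verts K \<H>) (coned_off_adj K S \<H>))"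


section \<open>Random graphs\<close>

definition random_graph :: "nat \<Rightarrow> real \<Rightarrow> nat set set pmf" where
  "random_graph n p =
     map_pmf (\<lambda>f. {e \<in> all_edges {1..n}. f e})
       (Pi_pmf (all_edges {1..n}) False (\<lambda>_. bernoulli_pmf p))"

lemma finite_all_edges: "finite V \<Longrightarrow> finite (all_edges V)"
  by (rule finite_subset[of _ "Pow V"]) (auto simp: all_edges_def)

lemma pmf_random_graph:
  assumes E: "E \<subseteq> all_edges {1..n}" and p: "0 \<le> p" "p \<le> 1"
  shows "pmf (random_graph n p) E = p ^ card E * (1 - p) ^ ((n choose 2) - card E)"
proof -
  let ?A = "all_edges {1..n}"
  let ?P = "Pi_pmf ?A False (\<lambda>_. bernoulli_pmf p)"
  let ?F = "\<lambda>f. {e \<in> ?A. f e}"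
  let ?f = "\<lambda>e. e \<in> E"
  have fin: "finite ?A" by (simp add: finite_all_edges)
  have EA: "E \<inter> ?A = E" "?A \<inter> E = E" using E by auto
  have "pmf (random_graph n p) E = measure (measure_pmf ?P) (?F -` {E})"
    by (simp add: random_graph_def pmf_map)
  also have "\<dots> = measure (measure_pmf ?P) {?f}"
  proof (rule measure_pmf.finite_measure_eq_AE)
    have "f \<in> ?F -` {E} \<longleftrightarrow> f \<in> {?f}" if "f \<in> set_pmf ?P" for f
    proof -
      have "\<And>e. e \<notin> ?A \<Longrightarrow> \<not> f e"
        using set_Pi_pmf_subset[OF fin, of False "\<lambda>_. bernoulli_pmf p"] that by auto
      then have "?F f = {e. f e}" by auto
      then show ?thesis by auto
    qed
    then show "AE f in measure_pmf ?P. (f \<in> ?F -` {E}) = (f \<in> {?f})"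
      by (simp add: AE_measure_pmf_iff)
  qed auto
  also have "\<dots> = (\<Prod>e\<in>?A. pmf (bernoulli_pmf p) (e \<in> E))"
    using fin E by (subst measure_pmf_single, subst pmf_Pi') auto
  also have "\<dots> = (\<Prod>e\<in>?A. if e \<in> E then p else 1 - p)"
    using p by (intro prod.cong) auto
  also have "\<dots> = p ^ card E * (1 - p) ^ (card ?A - card E)"
    using fin E finite_subset[OF E fin]
    by (simp only: prod.If_cases prod_constant Collect_mem_eq EA Diff_eq[symmetric] card_Diff_subset)
  also have "card ?A = n choose 2"
    using n_subsets[of "{1..n}" 2] by (simp add: all_edges_def)
  finally show ?thesis .
qed

definition asymptotically_almost_surely ::
    "(nat \<Rightarrow> real) \<Rightarrow> (nat \<Rightarrow> nat set set \<Rightarrow> bool) \<Rightarrow> bool" where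
  "asymptotically_almost_surely p Q \<longleftrightarrow>
     (\<lambda>n. measure_pmf.prob (random_graph n (p n)) {E. Q n E}) \<longlonglongrightarrow> 1"

end

theory Submission
  imports Defs
begin

text \<open>
  Every element of a graph product is represented by a reduced word, unique up to shuffling
  letters over adjacent vertices. With generators taken from the vertex groups, the distance in
  the coned-off graph is a weighted length of the reduced word representing \<open>x\<inverse>y\<close>, so the Gromov
  product of \<open>x\<close> and \<open>y\<close> at the identity is, up to a bounded error, the length of their longest
  common prefix. If \<open>u\<close> and \<open>v\<close> are prefixes of the same reduced word, then after cancelling a
  common prefix every letter of \<open>u\<close> is adjacent to every letter of \<open>v\<close>; without induced squares
  one of the two remainders is supported on a clique and hence short, which is the four-point
  condition. Conversely, an induced square \<open>a, b, c, d\<close> yields the commuting elements \<open>g\<^sub>a g\<^sub>c\<close>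
  and \<open>g\<^sub>b g\<^sub>d\<close>, which span a quasi-isometrically embedded flat, and the stable norm on it
  contradicts the four-point condition.

  It remains to decide when the random graph is complete or has an induced square. The first two
  cases are union bounds (if \<open>pn \<rightarrow> 0\<close> there is no 4-cycle at all), the third one is a second
  moment computation.
\<close>

section \<open>Normal forms in graph products\<close>

text \<open>Uniqueness of reduced words is not obtained by rewriting: words act on reduced words up
  to shuffling, and the defining relations are checked to act trivially (van der Waerden's method).
  The obstacle in comparing \<open>x\<close> and \<open>y\<close> is that after a longest common
  prefix both may continue with different letters over the same vertex, which merge in the product
  of the inverse of \<open>x\<close> with \<open>y\<close>. The vertices concerned span a clique, so
  at most \<open>card V\<close> letters on either side are affected and the error stays bounded.
  Distances are exact only for generators inside the vertex groups; for arbitrary generators there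
  is merely a linear lower bound, which is all that the stable norm on the flat requires. In the
  third random regime \<open>p\<close> may tend to 0, tend to 1 or oscillate, so the second moment
  estimate has to be uniform: both hypotheses enter through the minimum of \<open>p n\<close> and
  \<open>(1 - p) n^2\<close>.\<close>

locale graph_of_groups =
  fixes V :: "'v set" and E :: "'v set set" and G :: "'v \<Rightarrow> ('a, 'm) monoid_scheme"
  assumes grp: "\<And>v. v \<in> V \<Longrightarrow> group (G v)"
    and edges: "E \<subseteq> all_edges V"
begin

definition adj :: "'v \<Rightarrow> 'v \<Rightarrow> bool" where
  "adj u v \<longleftrightarrow> {u, v} \<in> E"

lemma adj_sym: "adj u v \<longleftrightarrow> adj v u"
  by (simp add: adj_def insert_commute)

lemma adj_irrefl [simp]: "\<not> adj v v"
  using edges by (auto simp: adj_def all_edges_def)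

lemma adj_in_V: "adj u v \<Longrightarrow> u \<in> V \<and> v \<in> V"
  using edges by (auto simp: adj_def all_edges_def)

section \<open>Words up to commutation of letters over adjacent vertices (partially commutative
  monoids)\<close>

inductive shuffle :: "('v \<times> 'a) list \<Rightarrow> ('v \<times> 'a) list \<Rightarrow> bool" where
  refl [simp, intro]: "shuffle w w"
| swap: "adj (fst l) (fst k) \<Longrightarrow> shuffle (l # k # w) (k # l # w)"
| Cons: "shuffle w w' \<Longrightarrow> shuffle (l # w) (l # w')"
| trans [trans]: "shuffle u v \<Longrightarrow> shuffle v w \<Longrightarrow> shuffle u w"

lemma shuffle_sym: "shuffle u v \<Longrightarrow> shuffle v u"
proof (induction rule: shuffle.induct)
  case (trans u v w)
  from trans.IH(2,1) show ?case by (rule shuffle.trans)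
qed (auto intro: shuffle.swap shuffle.Cons simp: adj_sym)

lemma shuffle_append:
  assumes "shuffle u v" "shuffle u' v'" shows "shuffle (u @ u') (v @ v')"
proof -
  have "shuffle (u @ u') (v @ u')"
    using assms(1)
  proof (induction rule: shuffle.induct)
    case (trans u v w)
    from trans.IH show ?case by (rule shuffle.trans)
  qed (auto intro: shuffle.swap shuffle.Cons)
  moreover have "shuffle (v @ u') (v @ v')"
    using assms(2) by (induction v) (auto intro: shuffle.Cons)
  ultimately show ?thesis by (rule shuffle.trans)
qed

lemma shuffle_mset: "shuffle u v \<Longrightarrow> mset u = mset v"
  by (induction rule: shuffle.induct) auto

lemma shuffle_set: "shuffle u v \<Longrightarrow> set u = set v"
  by (metis shuffle_mset set_mset_mset)

lemma shuffle_length: "shuffle u v \<Longrightarrow> length u = length v"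
  by (metis shuffle_mset size_mset)

text \<open>The letters that swaps can bring to the front: a later letter qualifies if it is
  adjacent to every letter before it. Recording letters instead of positions makes the set invariant
  under \<open>shuffle\<close>.\<close>

fun head_letters :: "('v \<times> 'a) list \<Rightarrow> ('v \<times> 'a) set" where
  "head_letters [] = {}"
| "head_letters (l # w) = insert l {k \<in> head_letters w. adj (fst l) (fst k)}"

abbreviation heads :: "('v \<times> 'a) list \<Rightarrow> 'v set" where
  "heads w \<equiv> fst ` head_letters w"

lemma heads_Cons: "heads (l # w) = insert (fst l) {v \<in> heads w. adj (fst l) v}"
  by force

lemma head_letters_subset: "head_letters w \<subseteq> set w"
  by (induction w) auto

lemma shuffle_head_letters: "shuffle u v \<Longrightarrow> head_letters u = head_letters v"
  by (induction rule: shuffle.induct) (auto simp: adj_sym)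

lemma head_letters_shuffle: "l \<in> head_letters w \<Longrightarrow> \<exists>w'. shuffle w (l # w')"
proof (induction w)
  case (Cons k w)
  show ?case
  proof (cases "l = k")
    case False
    with Cons obtain w' where "shuffle w (l # w')" and adj: "adj (fst k) (fst l)" by auto
    then have "shuffle (k # w) (k # l # w')" by (intro shuffle.Cons)
    also have "shuffle (k # l # w') (l # k # w')" using adj by (rule shuffle.swap)
    finally show ?thesis by blast
  qed auto
qed auto

lemma head_letters_append:
  "head_letters (u @ w) = head_letters u \<union> {k \<in> head_letters w. \<forall>l\<in>set u. adj (fst l) (fst k)}"
  by (induction u) auto

lemma heads_append:
  "heads (u @ w) = heads u \<union> {v \<in> heads w. \<forall>x\<in>fst ` set u. adj x v}"
  by (auto simp: head_letters_append image_iff)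

definition nontrivial_letter :: "'v \<times> 'a \<Rightarrow> bool" where
  "nontrivial_letter l \<longleftrightarrow>
     fst l \<in> V \<and> snd l \<in> carrier (G (fst l)) \<and> snd l \<noteq> \<one>\<^bsub>G (fst l)\<^esub>"

text \<open>The condition on \<open>heads w\<close> says that no letter over the vertex of
  \<open>l\<close> can be shuffled next to \<open>l\<close>, so that no two letters can be
  merged.\<close>

fun reduced :: "('v \<times> 'a) list \<Rightarrow> bool" where
  "reduced [] \<longleftrightarrow> True"
| "reduced (l # w) \<longleftrightarrow> nontrivial_letter l \<and> fst l \<notin> heads w \<and> reduced w"

lemma shuffle_reduced: "shuffle u v \<Longrightarrow> reduced u \<longleftrightarrow> reduced v"
proof (induction rule: shuffle.induct)
  case (swap l k w)
  then have "fst l \<noteq> fst k" by auto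
  with swap show ?case by (auto simp: adj_sym)
qed (auto simp: shuffle_head_letters)

text \<open>The two parts interact only at the junction, where a letter movable to the end of
  \<open>u\<close>, that is a head of \<open>rev u\<close>, may meet a head of \<open>w\<close> over
  the same vertex.\<close>

lemma reduced_append:
  "reduced (u @ w) \<longleftrightarrow> reduced u \<and> reduced w \<and> heads (rev u) \<inter> heads w = {}"
proof (induction u)
  case (Cons l u)
  have A: "heads (rev (l # u)) = heads (rev u) \<union> {v. v = fst l \<and> (\<forall>x\<in>fst ` set u. adj x v)}"
    by (auto simp: heads_append)
  have B: "fst l \<notin> heads (u @ w) \<longleftrightarrow> fst l \<notin> heads u \<and> \<not> (fst l \<in> heads w \<and>
    (\<forall>x\<in>fst ` set u. adj x (fst l)))"
    unfolding heads_append by auto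
  show ?case
    by (simp only: append_Cons reduced.simps A B Cons.IH) blast
qed auto

lemma reduced_words: "reduced w \<Longrightarrow> w \<in> fp_words V G"
  by (induction w) (auto simp: nontrivial_letter_def)

definition inv_letter :: "'v \<times> 'a \<Rightarrow> 'v \<times> 'a" where
  "inv_letter l = (fst l, inv\<^bsub>G (fst l)\<^esub> snd l)"

lemma fst_inv_letter [simp]: "fst (inv_letter l) = fst l"
  by (simp add: inv_letter_def)

definition inv_word :: "('v \<times> 'a) list \<Rightarrow> ('v \<times> 'a) list" where
  "inv_word w = rev (map inv_letter w)"

lemma heads_map: "(\<And>l. fst (f l) = fst l) \<Longrightarrow> heads (map f w) = heads w"
  by (induction w) (auto simp: heads_Cons simp del: head_letters.simps)

lemma nontrivial_inv_letter: "nontrivial_letter l \<Longrightarrow> nontrivial_letter (inv_letter l)"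
  by (auto simp: nontrivial_letter_def inv_letter_def grp group.inv_eq_1_iff)

lemma reduced_inv_word: "reduced w \<Longrightarrow> reduced (inv_word w)"
proof (induction w)
  case (Cons l w)
  have "rev (inv_word w) = map inv_letter w" by (simp add: inv_word_def)
  then have "heads (rev (inv_word w)) = heads w" by (simp add: heads_map)
  moreover have "inv_word (l # w) = inv_word w @ [inv_letter l]" by (simp add: inv_word_def)
  ultimately show ?case using Cons
    by (simp add: reduced_append nontrivial_inv_letter)
qed (simp add: inv_word_def)

lemma inv_word_words: "w \<in> fp_words V G \<Longrightarrow> inv_word w \<in> fp_words V G"
  by (induction w) (auto simp: inv_word_def inv_letter_def grp group.inv_closed)

subsection \<open>Left multiplication on reduced words\<close>

text \<open>Left multiplication by a non-trivial element: the letter travels to the right past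
  adjacent letters until it meets its own vertex or an obstruction. One merge is enough, since a
  reduced word has at most one head letter over \<open>v\<close>.\<close>

fun push :: "'v \<Rightarrow> 'a \<Rightarrow> ('v \<times> 'a) list \<Rightarrow> ('v \<times> 'a) list" where
  "push v g [] = [(v, g)]"
| "push v g ((u, h) # w) =
     (if u = v then (if g \<otimes>\<^bsub>G v\<^esub> h = \<one>\<^bsub>G v\<^esub> then w else (v, g \<otimes>\<^bsub>G v\<^esub> h) # w)
      else if adj u v then (u, h) # push v g w
      else (v, g) # (u, h) # w)"

definition ins :: "'v \<Rightarrow> 'a \<Rightarrow> ('v \<times> 'a) list \<Rightarrow> ('v \<times> 'a) list" where
  "ins v g w = (if g = \<one>\<^bsub>G v\<^esub> then w else push v g w)"

text \<open>\<open>push\<close> is defined on words, while the group is meant to act on shuffle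
  classes; this is well-definedness. The essential case is a swap at the very front, decided by how
  \<open>v\<close> relates to the two swapped vertices.\<close>

lemma push_shuffle: "shuffle w w' \<Longrightarrow> shuffle (push v g w) (push v g w')"
proof (induction rule: shuffle.induct)
  case (swap l k w)
  obtain u h u' h' where lk: "l = (u, h)" "k = (u', h')" by force
  have ne: "u \<noteq> u'" "adj u u'" "adj u' u" using swap lk by (auto simp: adj_sym)
  have "shuffle ((v, g) # (u, h) # (u', h') # w) ((u, h) # (v, g) # (u', h') # w)" if "adj u v"
    using that by (intro shuffle.swap) (simp add: adj_sym)
  moreover have "shuffle ((v, g) # (u', h') # (u, h) # w) ((u', h') # (v, g) # (u, h) # w)"
    if "adj u' v"
    using that by (intro shuffle.swap) (simp add: adj_sym)
  moreover have mid: "shuffle ((v, g) # (u, h) # (u', h') # w) ((v, g) # (u', h') # (u, h) # w)"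
    using ne by (intro shuffle.Cons shuffle.swap) simp
  moreover have "shuffle ((u, h) # (v, g) # (u', h') # w) ((v, g) # (u', h') # (u, h) # w)"
    if "adj u v"
    using that by (intro shuffle.trans[OF shuffle.swap mid]) simp
  moreover have "shuffle ((v, g) # (u, h) # (u', h') # w) ((u', h') # (v, g) # (u, h) # w)"
    if "adj u' v"
    using that by (intro shuffle.trans[OF mid shuffle.swap]) (simp add: adj_sym)
  moreover have "shuffle ((u, h) # (u', h') # z) ((u', h') # (u, h) # z)" for h h' z
    using ne by (intro shuffle.swap) simp
  ultimately show ?case
    unfolding lk using ne
    by (cases "u = v"; cases "u' = v"; cases "adj u v"; cases "adj u' v") simp_all
next
  case (Cons w w' l)
  then show ?case by (cases l) (auto intro: shuffle.Cons)
next
  case (trans u v w)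
  from trans.IH show ?case by (rule shuffle.trans)
qed auto

lemma ins_shuffle: "shuffle w w' \<Longrightarrow> shuffle (ins v g w) (ins v g w')"
  by (simp add: ins_def push_shuffle)

text \<open>If \<open>v\<close> is no head, the travelling letter never reaches a letter over
  \<open>v\<close>, and everything that it passes is adjacent to it.\<close>

lemma push_not_head: "v \<notin> heads w \<Longrightarrow> shuffle (push v g w) ((v, g) # w)"
proof (induction w)
  case (Cons l w)
  obtain u h where l: "l = (u, h)" by force
  show ?case
  proof (cases "adj u v")
    case True
    with Cons l have "shuffle (push v g w) ((v, g) # w)"
      by (simp add: heads_Cons del: head_letters.simps)
    then have "shuffle ((u, h) # push v g w) ((u, h) # (v, g) # w)" by (rule shuffle.Cons)
    also have "shuffle ((u, h) # (v, g) # w) ((v, g) # (u, h) # w)"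
      using True by (intro shuffle.swap) simp
    finally show ?thesis using Cons l True by (auto simp: heads_Cons)
  qed (use Cons l in auto)
qed auto

lemma heads_cases:
  assumes "reduced w"
  obtains "v \<notin> heads w"
  | h w' where "shuffle w ((v, h) # w')" "reduced ((v, h) # w')"
proof (cases "v \<in> heads w")
  case True
  then obtain h where "(v, h) \<in> head_letters w" by force
  then obtain w' where w': "shuffle w ((v, h) # w')" using head_letters_shuffle by blast
  with assms have "reduced ((v, h) # w')" using shuffle_reduced by blast
  with w' show ?thesis using that by blast
qed (use that in blast)

lemma ins_reduced:
  assumes w: "reduced w" and vg: "v \<in> V" "g \<in> carrier (G v)"
  shows "reduced (ins v g w)"
proof -
  interpret group "G v" using vg by (simp add: grp)
  show ?thesis using w
  proof (cases rule: heads_cases[of _ v])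
    case 1
    then show ?thesis using w vg shuffle_reduced[OF push_not_head[OF 1, of g]]
      by (auto simp: ins_def nontrivial_letter_def)
  next
    case (2 h w')
    then show ?thesis using vg shuffle_reduced[OF push_shuffle[OF 2(1), of v g]] w
      by (auto simp: ins_def nontrivial_letter_def split: if_splits)
  qed
qed

text \<open>The action respects multiplication in a vertex group. Once a possible head over
  \<open>v\<close> has been shuffled to the front, only the first letter is involved.\<close>

lemma ins_ins:
  assumes w: "reduced w" and v: "v \<in> V" "g \<in> carrier (G v)" "h \<in> carrier (G v)"
  shows "shuffle (ins v g (ins v h w)) (ins v (g \<otimes>\<^bsub>G v\<^esub> h) w)"
proof -
  interpret group "G v" using v by (simp add: grp)
  have A: "shuffle (ins v g (ins v h ((v, k) # w'))) (ins v (g \<otimes>\<^bsub>G v\<^esub> h) ((v, k) # w'))"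
    if red: "reduced ((v, k) # w')" for k w'
  proof -
    have k: "k \<in> carrier (G v)" "k \<noteq> \<one>\<^bsub>G v\<^esub>" "v \<notin> heads w'"
      using red by (auto simp: nontrivial_letter_def)
    have as: "g \<otimes>\<^bsub>G v\<^esub> h \<otimes>\<^bsub>G v\<^esub> k = g \<otimes>\<^bsub>G v\<^esub> (h \<otimes>\<^bsub>G v\<^esub> k)"
      using v k m_assoc by blast
    have "shuffle (push v g w') ((v, g) # w')" by (rule push_not_head) fact
    \<comment> \<open>The case of a letter that is first cancelled and then recreated:
      \<open>k\<close> and \<open>g\<close> are inverse to \<open>h\<close> from opposite
      sides.\<close>
    moreover have "k = g" if "h \<otimes>\<^bsub>G v\<^esub> k = \<one>\<^bsub>G v\<^esub>" "g \<otimes>\<^bsub>G v\<^esub> h = \<one>\<^bsub>G v\<^esub>"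
      using that as v k by simp
    ultimately show ?thesis using as v k
      by (auto simp: ins_def)
  qed
  show ?thesis using w
  proof (cases rule: heads_cases[of _ v])
    case 1
    have "shuffle (push v g (push v h w)) (push v g ((v, h) # w))"
      by (intro push_shuffle push_not_head 1)
    moreover have "shuffle ((v, g \<otimes>\<^bsub>G v\<^esub> h) # w) (push v (g \<otimes>\<^bsub>G v\<^esub> h) w)"
      by (intro shuffle_sym[OF push_not_head] 1)
    ultimately show ?thesis using v
      by (auto simp: ins_def split: if_splits intro: shuffle.trans)
  next
    case (2 k w')
    have "shuffle (ins v g (ins v h w)) (ins v g (ins v h ((v, k) # w')))"
      by (intro ins_shuffle 2)
    also have "shuffle \<dots> (ins v (g \<otimes>\<^bsub>G v\<^esub> h) ((v, k) # w'))" by (rule A) fact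
    also have "shuffle \<dots> (ins v (g \<otimes>\<^bsub>G v\<^esub> h) w)"
      by (intro ins_shuffle shuffle_sym[OF 2(1)])
    finally show ?thesis .
  qed
qed

lemma push_commute:
  assumes "adj u v"
  shows "shuffle (push u g (push v h w)) (push v h (push u g w))"
proof (induction w)
  case Nil
  have "u \<noteq> v" "adj v u" using assms by (auto simp: adj_sym)
  then show ?case using assms shuffle.swap[of "(v, h)" "(u, g)" "[]"] by auto
next
  case (Cons l w)
  obtain k x where l: "l = (k, x)" by force
  have uv: "u \<noteq> v" "adj v u" using assms by (auto simp: adj_sym)
  have "shuffle ((v, h) # (u, g) # (k, x) # w) ((u, g) # (v, h) # (k, x) # w)"
    using uv by (intro shuffle.swap) simp
  then show ?case unfolding l using assms uv Cons
    by (auto simp: intro: shuffle.Cons)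
qed

lemma ins_commute:
  "adj u v \<Longrightarrow> shuffle (ins u g (ins v h w)) (ins v h (ins u g w))"
  by (auto simp: ins_def push_commute)

definition act :: "('v \<times> 'a) list \<Rightarrow> ('v \<times> 'a) list \<Rightarrow> ('v \<times> 'a) list" where
  "act u w = foldr (\<lambda>(v, g). ins v g) u w"

lemma act_simps [simp]:
  "act [] w = w" "act ((v, g) # u) w = ins v g (act u w)" "act (u @ u') w = act u (act u' w)"
  by (simp_all add: act_def)

lemma act_shuffle: "shuffle w w' \<Longrightarrow> shuffle (act u w) (act u w')"
  by (induction u) (auto simp: ins_shuffle)

lemma act_reduced: "u \<in> fp_words V G \<Longrightarrow> reduced w \<Longrightarrow> reduced (act u w)"
  by (induction u) (auto simp: ins_reduced)

text \<open>The orbit map at the empty word: the letters of \<open>u\<close> are inserted from right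
  to left. The result depends on the element represented by \<open>u\<close> only up to
  \<open>shuffle\<close>.\<close>

definition nf :: "('v \<times> 'a) list \<Rightarrow> ('v \<times> 'a) list" where
  "nf u = act u []"

lemma nf_reduced: "u \<in> fp_words V G \<Longrightarrow> reduced (nf u)"
  by (simp add: nf_def act_reduced)

lemma shuffle_nf: "reduced w \<Longrightarrow> shuffle (nf w) w"
proof (induction w)
  case (Cons l w)
  obtain v g where l: "l = (v, g)" by force
  have "shuffle (ins v g (nf w)) (ins v g w)" using Cons by (simp add: ins_shuffle)
  also have "ins v g w = push v g w" using Cons l by (auto simp: ins_def nontrivial_letter_def)
  also have "shuffle (push v g w) ((v, g) # w)" using Cons l by (intro push_not_head) auto
  finally show ?case by (simp add: nf_def l)
qed (simp add: nf_def)

subsection \<open>Words and elements of the graph product\<close>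

abbreviation "FP \<equiv> free_product V G"
abbreviation "GP \<equiv> graph_product V E G"
abbreviation "GPker \<equiv> normal_closure (free_product V G) (gp_relators V E G)"

lemma fcls_mult:
  "u \<in> fp_words V G \<Longrightarrow> w \<in> fp_words V G \<Longrightarrow>
    fp_rel V G `` {u} \<otimes>\<^bsub>FP\<^esub> fp_rel V G `` {w} = fp_rel V G `` {u @ w}"
  by (simp add: fp_class_mult grp)

lemma fcls_carrier: "u \<in> fp_words V G \<Longrightarrow> fp_rel V G `` {u} \<in> carrier FP"
  by (simp add: fp_class_carrier grp)

lemma fcls_equiv: "equiv (fp_words V G) (fp_rel V G)"
  by (simp add: equiv_fp_rel grp)

lemma fcls_one: "\<one>\<^bsub>FP\<^esub> = fp_rel V G `` {[]}"
  by (simp add: fp_one grp)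

lemma fcls_rel_words: "(u, w) \<in> fp_rel V G \<Longrightarrow> u \<in> fp_words V G \<and> w \<in> fp_words V G"
  by (simp add: fp_rel_in_words grp)

lemma fcls_left_inverse:
  "u \<in> fp_words V G \<Longrightarrow> \<exists>w\<in>fp_words V G. (w @ u, []) \<in> fp_rel V G"
  by (simp add: fp_left_inverse grp)

definition cls :: "('v \<times> 'a) list \<Rightarrow> ('v \<times> 'a) list set set" where
  "cls w = GPker #>\<^bsub>FP\<^esub> (fp_rel V G `` {w})"

lemma gp_incl_cls: "gp_incl V E G v g = cls [(v, g)]"
  by (simp add: gp_incl_def cls_def fp_incl_def)

sublocale FP: group FP by (rule group_free_product[where I = V and G = G, OF grp])
sublocale GP: group GP by (rule group_graph_product[where V = V and G = G, OF grp])
sublocale GPker: normal GPker FP by (rule gp_kernel_normal[where V = V and G = G, OF grp])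

lemma cls_carrier: "w \<in> fp_words V G \<Longrightarrow> cls w \<in> carrier GP"
  by (auto simp: graph_product_def carrier_FactGroup cls_def intro: fcls_carrier)

lemma cls_cases:
  assumes "x \<in> carrier GP" obtains w where "w \<in> fp_words V G" "x = cls w"
proof -
  from assms obtain A where A: "A \<in> carrier FP" "x = GPker #>\<^bsub>FP\<^esub> A"
    by (auto simp: graph_product_def carrier_FactGroup)
  from A(1) obtain w where "w \<in> fp_words V G" "A = fp_rel V G `` {w}"
    by (auto simp: free_product_def elim: quotientE)
  with A(2) that show thesis by (simp add: cls_def)
qed

lemma cls_append:
  "u \<in> fp_words V G \<Longrightarrow> w \<in> fp_words V G \<Longrightarrow> cls (u @ w) = cls u \<otimes>\<^bsub>GP\<^esub> cls w"
  by (simp add: graph_product_def cls_def GPker.rcos_sum fcls_carrier fcls_mult)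

lemma cls_Nil: "cls [] = \<one>\<^bsub>GP\<^esub>"
  using GPker.rcos_const[OF FP.is_group] GPker.subset
  by (simp add: cls_def graph_product_def fcls_one[symmetric] FP.coset_mult_one)

lemma cls_eq_fp_rel: "(u, w) \<in> fp_rel V G \<Longrightarrow> cls u = cls w"
  using equiv_class_eq[OF fcls_equiv] by (simp add: cls_def)

lemma cls_mult_letter:
  assumes "v \<in> V" "g \<in> carrier (G v)" "h \<in> carrier (G v)"
  shows "cls [(v, g), (v, h)] = cls [(v, g \<otimes>\<^bsub>G v\<^esub> h)]"
  using fp_rel.mult[of "[]" V G "[]" v g h] assms by (intro cls_eq_fp_rel) simp

lemma cls_one_letter: "v \<in> V \<Longrightarrow> cls [(v, \<one>\<^bsub>G v\<^esub>)] = \<one>\<^bsub>GP\<^esub>"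
  using fp_rel.one[of "[]" V G "[]" v] cls_eq_fp_rel[of "[(v, \<one>\<^bsub>G v\<^esub>)]" "[]"]
  by (simp add: cls_Nil)

lemma cls_commute_letters:
  assumes vw: "adj v w" and g: "g \<in> carrier (G v)" and h: "h \<in> carrier (G w)"
  shows "cls [(v, g), (w, h)] = cls [(w, h), (v, g)]"
proof -
  have V: "v \<in> V" "w \<in> V" using adj_in_V[OF vw] by auto
  have c: "fp_incl V G v g \<in> carrier FP" "fp_incl V G w h \<in> carrier FP"
    using V g h by (simp_all add: fp_incl_def fcls_carrier)
  let ?x = "fp_incl V G v g" and ?y = "fp_incl V G w h"
  have "?x \<otimes>\<^bsub>FP\<^esub> ?y \<otimes>\<^bsub>FP\<^esub> inv\<^bsub>FP\<^esub> ?x \<otimes>\<^bsub>FP\<^esub> inv\<^bsub>FP\<^esub> ?y \<in> gp_relators V E G"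
    using vw V g h by (auto simp: gp_relators_def adj_def)
  then have "?x \<otimes>\<^bsub>FP\<^esub> ?y \<otimes>\<^bsub>FP\<^esub> inv\<^bsub>FP\<^esub> ?x \<otimes>\<^bsub>FP\<^esub> inv\<^bsub>FP\<^esub> ?y \<in> GPker"
    by (auto simp: normal_closure_def)
  moreover have "?x \<otimes>\<^bsub>FP\<^esub> ?y \<otimes>\<^bsub>FP\<^esub> inv\<^bsub>FP\<^esub> ?x \<otimes>\<^bsub>FP\<^esub> inv\<^bsub>FP\<^esub> ?y \<otimes>\<^bsub>FP\<^esub> (?y \<otimes>\<^bsub>FP\<^esub> ?x) = ?x \<otimes>\<^bsub>FP\<^esub> ?y"
    using c by (simp add: FP.m_assoc FP.inv_solve_left)
      (simp add: FP.m_assoc[symmetric])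
  ultimately have "GPker #>\<^bsub>FP\<^esub> (?x \<otimes>\<^bsub>FP\<^esub> ?y) = GPker #>\<^bsub>FP\<^esub> (?y \<otimes>\<^bsub>FP\<^esub> ?x)"
    using c GPker.subset FP.coset_mult_assoc[OF GPker.subset, of
      "?x \<otimes>\<^bsub>FP\<^esub> ?y \<otimes>\<^bsub>FP\<^esub> inv\<^bsub>FP\<^esub> ?x \<otimes>\<^bsub>FP\<^esub> inv\<^bsub>FP\<^esub> ?y" "?y \<otimes>\<^bsub>FP\<^esub> ?x"]
      GPker.rcos_const[OF FP.is_group] by simp
  then show ?thesis
    using V g h by (simp add: cls_def fp_incl_def fcls_mult)
qed

text \<open>Gives access to equality in the quotient without handling the normal closure: any
  congruence \<open>P\<close> on words that contains the relations of the vertex groups and the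
  commutations contains equality of classes.\<close>

lemma cls_eq_induct:
  assumes eq: "cls u = cls w" and uw: "u \<in> fp_words V G" "w \<in> fp_words V G"
    and refl: "\<And>u. u \<in> fp_words V G \<Longrightarrow> P u u"
    and sym: "\<And>u w. u \<in> fp_words V G \<Longrightarrow> w \<in> fp_words V G \<Longrightarrow> P u w \<Longrightarrow> P w u"
    and trans: "\<And>u w x. u \<in> fp_words V G \<Longrightarrow> w \<in> fp_words V G \<Longrightarrow> x \<in> fp_words V G \<Longrightarrow>
      P u w \<Longrightarrow> P w x \<Longrightarrow> P u x"
    and cong: "\<And>u w x y. u \<in> fp_words V G \<Longrightarrow> w \<in> fp_words V G \<Longrightarrow> x \<in> fp_words V G \<Longrightarrow>
      y \<in> fp_words V G \<Longrightarrow> P u w \<Longrightarrow> P (x @ u @ y) (x @ w @ y)"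
    and mult: "\<And>v g h. v \<in> V \<Longrightarrow> g \<in> carrier (G v) \<Longrightarrow> h \<in> carrier (G v) \<Longrightarrow>
      P [(v, g), (v, h)] [(v, g \<otimes>\<^bsub>G v\<^esub> h)]"
    and one: "\<And>v. v \<in> V \<Longrightarrow> P [(v, \<one>\<^bsub>G v\<^esub>)] []"
    and comm: "\<And>v w g h. adj v w \<Longrightarrow> g \<in> carrier (G v) \<Longrightarrow> h \<in> carrier (G w) \<Longrightarrow>
      P [(v, g), (w, h)] [(w, h), (v, g)]"
  shows "P u w"
proof -
  have rel: "P u w" if "(u, w) \<in> fp_rel V G" for u w
    using that
  proof (induction rule: fp_rel.induct)
    case (sym u v)
    then show ?case using assms(5)[of u v] fcls_rel_words by blast
  next
    case (trans u v w)
    then show ?case using assms(6)[of u v w] fcls_rel_words by blast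
  next
    case (mult u v i g h)
    interpret group "G i" using mult by (simp add: grp)
    show ?case using mult cong[OF _ _ _ _ assms(8)[of i g h], of u v] by simp
  next
    case (one u v i)
    interpret group "G i" using one by (simp add: grp)
    show ?case using one cong[OF _ _ _ _ assms(9)[of i], of u v] by simp
  qed (rule refl)
  \<comment> \<open>The classes of words that \<open>P\<close> relates to the empty word. As a
    normal subgroup containing the relators, \<open>M\<close> contains the whole kernel.\<close>
  define M where "M = {A. \<exists>u\<in>fp_words V G. A = fp_rel V G `` {u} \<and> P u []}"
  have inv_cls: "inv\<^bsub>FP\<^esub> (fp_rel V G `` {a}) = fp_rel V G `` {a'}"
    if "a \<in> fp_words V G" "a' \<in> fp_words V G" "(a' @ a, []) \<in> fp_rel V G" for a a'
  proof (rule FP.inv_equality)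
    show "fp_rel V G `` {a'} \<otimes>\<^bsub>FP\<^esub> fp_rel V G `` {a} = \<one>\<^bsub>FP\<^esub>"
      using that equiv_class_eq[OF fcls_equiv] by (simp add: fcls_mult fcls_one)
  qed (use that fcls_carrier in auto)
  \<comment> \<open>Membership does not depend on the representative because \<open>P\<close>
    contains the congruence of the free product.\<close>
  have M_iff: "fp_rel V G `` {u} \<in> M \<longleftrightarrow> P u []" if "u \<in> fp_words V G" for u
  proof
    assume "fp_rel V G `` {u} \<in> M"
    then obtain u' where u': "u' \<in> fp_words V G" "fp_rel V G `` {u} = fp_rel V G `` {u'}" "P u' []"
      by (auto simp: M_def)
    then have "(u, u') \<in> fp_rel V G"
      using eq_equiv_class[OF u'(2) fcls_equiv] by simp
    with u' that trans[of u u' "[]"] rel show "P u []" by auto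
  qed (use that in \<open>auto simp: M_def\<close>)
  have append_Nil: "P (a @ b) []" if "P a []" "P b []" "a \<in> fp_words V G" "b \<in> fp_words V G" for a b
    using that cong[of a "[]" "[]" b] trans[of "a @ b" b "[]"] by simp
  have "M \<lhd> FP"
  proof (rule FP.normal_invI)
    show "subgroup M FP"
    proof (rule FP.subgroupI)
      show "M \<subseteq> carrier FP" by (auto simp: M_def fcls_carrier)
      have "\<one>\<^bsub>FP\<^esub> \<in> M" using refl[of "[]"] M_iff[of "[]"] by (simp add: fcls_one)
      then show "M \<noteq> {}" by blast
    next
      fix A assume "A \<in> M"
      then obtain a where a: "a \<in> fp_words V G" "A = fp_rel V G `` {a}" "P a []"
        by (auto simp: M_def)
      obtain a' where a': "a' \<in> fp_words V G" "(a' @ a, []) \<in> fp_rel V G"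
        using fcls_left_inverse[OF a(1)] by blast
      have "P (a' @ a) a'" using cong[of a "[]" a' "[]"] a a' by simp
      moreover have "P (a' @ a) []" using rel a' by blast
      ultimately have "P a' []" using trans[of a' "a' @ a" "[]"] sym[of "a' @ a" a'] a a' by simp
      then show "inv\<^bsub>FP\<^esub> A \<in> M" using inv_cls[of a a'] a a' M_iff[of a'] by simp
    next
      fix A B assume "A \<in> M" "B \<in> M"
      then obtain a b where "a \<in> fp_words V G" "A = fp_rel V G `` {a}" "P a []"
        "b \<in> fp_words V G" "B = fp_rel V G `` {b}" "P b []"
        by (auto simp: M_def)
      then show "A \<otimes>\<^bsub>FP\<^esub> B \<in> M" using append_Nil[of a b] M_iff[of "a @ b"] by (simp add: fcls_mult)
    qed
  next
    fix B A assume "B \<in> carrier FP" "A \<in> M"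
    then obtain a x where a: "a \<in> fp_words V G" "A = fp_rel V G `` {a}" "P a []"
      and x: "x \<in> fp_words V G" "B = fp_rel V G `` {x}"
      by (auto simp: M_def free_product_def elim: quotientE)
    obtain x' where x': "x' \<in> fp_words V G" "(x' @ x, []) \<in> fp_rel V G"
      using fcls_left_inverse[OF x(1)] by blast
    have "fp_rel V G `` {x @ x'} = \<one>\<^bsub>FP\<^esub>"
      using inv_cls[of x x'] x x' FP.r_inv[of "fp_rel V G `` {x}"] fcls_carrier[of x]
      by (simp add: fcls_mult)
    then have "P (x @ x') []"
      using M_iff[of "x @ x'"] M_iff[of "[]"] refl[of "[]"] x x' by (simp add: fcls_one)
    moreover have "P (x @ a @ x') (x @ x')"
      using cong[of a "[]" x x'] a x x' by simp
    ultimately have "P (x @ a @ x') []"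
      using trans[of "x @ a @ x'" "x @ x'" "[]"] a x x' by simp
    then show "B \<otimes>\<^bsub>FP\<^esub> A \<otimes>\<^bsub>FP\<^esub> inv\<^bsub>FP\<^esub> B \<in> M"
      using M_iff[of "x @ a @ x'"] a x x' inv_cls[of x x'] by (simp add: fcls_mult)
  qed
  moreover have "gp_relators V E G \<subseteq> M"
  proof
    fix r assume "r \<in> gp_relators V E G"
    then obtain v w g h where r: "r = fp_incl V G v g \<otimes>\<^bsub>FP\<^esub> fp_incl V G w h
        \<otimes>\<^bsub>FP\<^esub> inv\<^bsub>FP\<^esub> (fp_incl V G v g) \<otimes>\<^bsub>FP\<^esub> inv\<^bsub>FP\<^esub> (fp_incl V G w h)"
      and vw: "v \<in> V" "w \<in> V" "adj v w" and gh: "g \<in> carrier (G v)" "h \<in> carrier (G w)"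
      by (auto simp: gp_relators_def adj_def)
    interpret Gv: group "G v" using vw by (simp add: grp)
    interpret Gw: group "G w" using vw by (simp add: grp)
    define g' h' where "g' = inv\<^bsub>G v\<^esub> g" and "h' = inv\<^bsub>G w\<^esub> h"
    have gh': "g' \<in> carrier (G v)" "h' \<in> carrier (G w)" "g \<otimes>\<^bsub>G v\<^esub> g' = \<one>\<^bsub>G v\<^esub>" "h \<otimes>\<^bsub>G w\<^esub> h' =
      \<one>\<^bsub>G w\<^esub>"
       "g' \<otimes>\<^bsub>G v\<^esub> g = \<one>\<^bsub>G v\<^esub>" "h' \<otimes>\<^bsub>G w\<^esub> h = \<one>\<^bsub>G w\<^esub>"
      using gh by (simp_all add: g'_def h'_def)
    have canc: "(([(x, k')] @ [(x, k)]), []) \<in> fp_rel V G"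
      if "x \<in> V" "k \<in> carrier (G x)" "k' \<in> carrier (G x)" "k' \<otimes>\<^bsub>G x\<^esub> k = \<one>\<^bsub>G x\<^esub>" for x k k'
      using fp_rel.mult[of "[]" V G "[]" x k' k] fp_rel.one[of "[]" V G "[]" x] that
      by (auto intro: fp_rel.trans)
    have invs: "inv\<^bsub>FP\<^esub> (fp_incl V G v g) = fp_rel V G `` {[(v, g')]}"
      "inv\<^bsub>FP\<^esub> (fp_incl V G w h) = fp_rel V G `` {[(w, h')]}"
      unfolding fp_incl_def
      using inv_cls[OF _ _ canc[of v g g']] inv_cls[OF _ _ canc[of w h h']] vw gh gh' by simp_all
    have W: "[(v, g)] \<in> fp_words V G" "[(w, h)] \<in> fp_words V G" "[(v, g')] \<in> fp_words V G"
      "[(w, h')] \<in> fp_words V G"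
      using vw gh gh' by simp_all
    have r': "r = fp_rel V G `` {[(v, g), (w, h), (v, g'), (w, h')]}"
      unfolding r invs unfolding fp_incl_def using vw gh gh' by (simp add: fcls_mult)
    have "P ([(v, g)] @ [(w, h), (v, g')] @ [(w, h')]) ([(v, g)] @ [(v, g'), (w, h)] @ [(w, h')])"
      using vw gh gh' comm[of w v h g'] by (intro cong) (auto simp: adj_sym)
    moreover have "P ([(v, g), (v, g')] @ [(w, h), (w, h')]) []"
      using rel[OF canc[of v g' g]] rel[OF canc[of w h' h]] vw gh gh'
      by (intro append_Nil) simp_all
    ultimately have "P [(v, g), (w, h), (v, g'), (w, h')] []"
      using trans[of "[(v, g), (w, h), (v, g'), (w, h')]" "[(v, g), (v, g'), (w, h), (w, h')]" "[]"]
        vw gh gh' by simp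
    then show "r \<in> M" using M_iff[of "[(v, g), (w, h), (v, g'), (w, h')]"] r' vw gh gh' by simp
  qed
  ultimately have ker: "GPker \<subseteq> M"
    by (auto simp: normal_closure_def)
  \<comment> \<open>With \<open>w'\<close> inverse to \<open>w\<close>, the word
    \<open>u @ w' @ w\<close> is related both to \<open>u\<close> and to \<open>w\<close>.\<close>
  obtain w' where w': "w' \<in> fp_words V G" "(w' @ w, []) \<in> fp_rel V G"
    using fcls_left_inverse[OF uw(2)] by blast
  have "fp_rel V G `` {u} \<in> GPker #>\<^bsub>FP\<^esub> fp_rel V G `` {w}"
    using eq uw FP.rcos_self[OF fcls_carrier[OF uw(1)] GPker.subgroup_axioms]
    by (simp add: cls_def)
  then have "fp_rel V G `` {u} \<otimes>\<^bsub>FP\<^esub> inv\<^bsub>FP\<^esub> (fp_rel V G `` {w}) \<in> GPker"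
    using GPker.rcos_module_imp[OF FP.is_group fcls_carrier[OF uw(2)]] by blast
  then have "fp_rel V G `` {u @ w'} \<in> M"
    using ker uw w' inv_cls[of w w'] by (auto simp: fcls_mult)
  then have "P (u @ w') []" using M_iff[of "u @ w'"] uw w' by simp
  then have "P (u @ w' @ w) w" using cong[of "u @ w'" "[]" "[]" w] uw w' by simp
  moreover have "P (u @ w' @ w) u"
    using cong[of "w' @ w" "[]" u "[]"] rel[OF w'(2)] uw w' by simp
  ultimately show ?thesis
    using trans[of u "u @ w' @ w" w] sym[of "u @ w' @ w" u] uw w' by simp
qed

text \<open>Each defining relation acts trivially up to shuffling, by \<open>ins_ins\<close>,
  \<open>ins_commute\<close> and the treatment of the identity in \<open>ins\<close>; hence the
  graph product itself acts.\<close>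

lemma act_cls_eq:
  assumes "cls u = cls w" "u \<in> fp_words V G" "w \<in> fp_words V G" "reduced x"
  shows "shuffle (act u x) (act w x)"
proof -
  have "\<forall>x. reduced x \<longrightarrow> shuffle (act u x) (act w x)"
    using assms(1-3)
  proof (rule cls_eq_induct)
    fix u w x y
    assume "y \<in> fp_words V G" "\<forall>x. reduced x \<longrightarrow> shuffle (act u x) (act w x)"
    then show "\<forall>z. reduced z \<longrightarrow> shuffle (act (x @ u @ y) z) (act (x @ w @ y) z)"
      by (auto intro!: act_shuffle simp: act_reduced)
  next
    fix v g h assume "v \<in> V" "g \<in> carrier (G v)" "h \<in> carrier (G v)"
    then show "\<forall>x. reduced x \<longrightarrow> shuffle (act [(v, g), (v, h)] x) (act [(v, g \<otimes>\<^bsub>G v\<^esub> h)] x)"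
      by (simp add: ins_ins)
  qed (auto simp: ins_def[where g = "\<one>\<^bsub>G _\<^esub>"] ins_commute intro: shuffle_sym shuffle.trans)
  with assms(4) show ?thesis by blast
qed

text \<open>Uniqueness in the normal form theorem: equal elements act equally on the empty word, and
  a reduced word applied to the empty word gives itself back up to shuffling.\<close>

lemma cls_eq_shuffle:
  assumes "cls u = cls w" "reduced u" "reduced w"
  shows "shuffle u w"
proof -
  have "shuffle u (nf u)" using assms by (simp add: shuffle_sym shuffle_nf)
  also have "shuffle (nf u) (nf w)"
    unfolding nf_def using assms by (intro act_cls_eq) (auto simp: reduced_words)
  also have "shuffle (nf w) w" using assms by (simp add: shuffle_nf)
  finally show ?thesis .
qed

lemma cls_Cons:
  "(v, g) # w \<in> fp_words V G \<Longrightarrow> cls ((v, g) # w) = cls [(v, g)] \<otimes>\<^bsub>GP\<^esub> cls w"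
  using cls_append[of "[(v, g)]" w] by simp

lemma cls_cong_append:
  "cls u = cls u' \<Longrightarrow> u \<in> fp_words V G \<Longrightarrow> u' \<in> fp_words V G \<Longrightarrow> w \<in> fp_words V G \<Longrightarrow>
    cls (u @ w) = cls (u' @ w)"
  by (simp add: cls_append)

lemma shuffle_words: "shuffle u w \<Longrightarrow> u \<in> fp_words V G \<longleftrightarrow> w \<in> fp_words V G"
  by (simp add: fp_words_def lists_eq_set shuffle_set)

lemma shuffle_cls: "shuffle u w \<Longrightarrow> u \<in> fp_words V G \<Longrightarrow> cls u = cls w"
proof (induction rule: shuffle.induct)
  case (swap l k w)
  obtain u h v g where lk: "l = (u, h)" "k = (v, g)" by force
  have w: "h \<in> carrier (G u)" "g \<in> carrier (G v)" "u \<in> V" "v \<in> V" "w \<in> fp_words V G"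
    and "adj u v"
    using swap lk by simp_all
  then have "cls ([(u, h), (v, g)] @ w) = cls ([(v, g), (u, h)] @ w)"
    by (intro cls_cong_append cls_commute_letters) simp_all
  then show ?case by (simp add: lk)
next
  case (Cons w w' l)
  obtain v g where l: "l = (v, g)" by force
  have w: "v \<in> V" "g \<in> carrier (G v)" "w \<in> fp_words V G" using Cons.prems l by simp_all
  moreover have "w' \<in> fp_words V G" using w(3) shuffle_words[OF Cons.hyps] by simp
  ultimately show ?case using Cons.IH
    by (simp add: l cls_Cons[of v g w] cls_Cons[of v g w'])
next
  case (trans u v w)
  have "v \<in> fp_words V G" using trans.prems shuffle_words[OF trans.hyps(1)] by simp
  then show ?case using trans.IH trans.prems by simp
qed simp

lemma push_cls:
  assumes "v \<in> V" "g \<in> carrier (G v)" "w \<in> fp_words V G"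
  shows "cls (push v g w) = cls ((v, g) # w) \<and> push v g w \<in> fp_words V G"
  using assms(3)
proof (induction w)
  case (Cons l w)
  obtain u h where l: "l = (u, h)" by force
  interpret group "G v" using assms by (simp add: grp)
  have uh: "u \<in> V" "h \<in> carrier (G u)" "w \<in> fp_words V G" using Cons l by auto
  consider "u = v" | "u \<noteq> v" "adj u v" | "u \<noteq> v" "\<not> adj u v" by blast
  then show ?case
  proof cases
    case 1
    have "cls ([(v, g), (v, h)] @ w) = cls ([(v, g \<otimes>\<^bsub>G v\<^esub> h)] @ w)"
      using 1 uh assms by (intro cls_cong_append cls_mult_letter) auto
    moreover have "cls ([(v, \<one>\<^bsub>G v\<^esub>)] @ w) = cls w"
      using 1 uh assms cls_one_letter[of v] cls_carrier[of w] by (subst cls_append) simp_all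
    ultimately show ?thesis using 1 uh assms l by simp
  next
    case 2
    have "cls ((u, h) # push v g w) = cls ((u, h) # (v, g) # w)"
      using Cons.IH uh assms cls_Cons[of u h "push v g w"] cls_Cons[of u h "(v, g) # w"] by simp
    moreover have "cls ([(u, h), (v, g)] @ w) = cls ([(v, g), (u, h)] @ w)"
      using 2 uh assms by (intro cls_cong_append cls_commute_letters) auto
    ultimately show ?thesis using 2 uh assms l Cons.IH by simp
  next
    case 3
    then show ?thesis using uh assms l by simp
  qed
qed (use assms in auto)

lemma ins_cls:
  assumes "v \<in> V" "g \<in> carrier (G v)" "w \<in> fp_words V G"
  shows "cls (ins v g w) = cls ((v, g) # w)"
  using assms push_cls cls_Cons[of v g w] cls_one_letter[of v] cls_carrier[of w]
  by (auto simp: ins_def)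

lemma nf_cls: "w \<in> fp_words V G \<Longrightarrow> cls (nf w) = cls w"
proof (induction w)
  case (Cons l w)
  obtain v g where l: "l = (v, g)" by force
  have w: "v \<in> V" "g \<in> carrier (G v)" "w \<in> fp_words V G" using Cons.prems l by simp_all
  have nf: "nf w \<in> fp_words V G" using w nf_reduced reduced_words by blast
  have "cls (nf (l # w)) = cls ((v, g) # nf w)"
    using ins_cls[OF w(1,2) nf] by (simp add: nf_def l)
  also have "\<dots> = cls (l # w)"
    using w nf Cons.IH by (simp add: l cls_Cons[of v g w] cls_Cons[of v g "nf w"])
  finally show ?case .
qed (simp add: nf_def)

lemma cls_inv_word:
  assumes "w \<in> fp_words V G" shows "cls (inv_word w) = inv\<^bsub>GP\<^esub> cls w"
  using assms
proof (induction w)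
  case Nil
  then show ?case by (simp add: inv_word_def cls_Nil)
next
  case (Cons l w)
  obtain v g where l: "l = (v, g)" by force
  interpret group "G v" using Cons l by (simp add: grp)
  have vg: "v \<in> V" "g \<in> carrier (G v)" "w \<in> fp_words V G" using Cons l by auto
  have "cls [(v, inv\<^bsub>G v\<^esub> g)] \<otimes>\<^bsub>GP\<^esub> cls [(v, g)] = \<one>\<^bsub>GP\<^esub>"
    using vg cls_mult_letter[of v "inv\<^bsub>G v\<^esub> g" g] cls_one_letter[of v]
      cls_append[of "[(v, inv\<^bsub>G v\<^esub> g)]" "[(v, g)]"] by simp
  then have "cls [(v, inv\<^bsub>G v\<^esub> g)] = inv\<^bsub>GP\<^esub> cls [(v, g)]"
    using vg by (intro GP.inv_equality[symmetric] cls_carrier) auto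
  moreover have "inv_word (l # w) = inv_word w @ [(v, inv\<^bsub>G v\<^esub> g)]"
    by (simp add: inv_word_def l inv_letter_def)
  ultimately show ?case
    using vg Cons.IH cls_Cons[of v g w] inv_word_words[of w]
    by (simp add: l cls_append GP.inv_mult_group cls_carrier)
qed

end

subsection \<open>Complete graphs\<close>

context graph_of_groups begin

fun component :: "'v \<Rightarrow> ('v \<times> 'a) list \<Rightarrow> 'a" where
  "component v [] = \<one>\<^bsub>G v\<^esub>"
| "component v ((u, g) # w) = (if u = v then g \<otimes>\<^bsub>G v\<^esub> component v w else component v w)"

lemma component_closed: "v \<in> V \<Longrightarrow> w \<in> fp_words V G \<Longrightarrow> component v w \<in> carrier (G v)"
proof (induction w)
  case Nil
  then show ?case by (simp add: grp group.is_monoid)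
next
  case (Cons l w)
  interpret group "G v" using Cons by (simp add: grp)
  show ?case using Cons by (cases l) auto
qed

lemma component_append:
  assumes "v \<in> V" "u \<in> fp_words V G" "w \<in> fp_words V G"
  shows "component v (u @ w) = component v u \<otimes>\<^bsub>G v\<^esub> component v w"
proof -
  interpret group "G v" using assms by (simp add: grp)
  show ?thesis using assms(2)
  proof (induction u)
    case Nil
    then show ?case using assms component_closed by simp
  next
    case (Cons l u)
    then show ?case using assms component_closed[of v] by (cases l) (auto simp: m_assoc)
  qed
qed

text \<open>The retraction onto a vertex group is well defined for every graph: the commutation
  relations hold trivially, since at least one of the two letters is killed.\<close>

lemma cls_eq_component:
  assumes "cls u = cls w" "u \<in> fp_words V G" "w \<in> fp_words V G" "v \<in> V"
  shows "component v u = component v w"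
proof -
  interpret group "G v" using assms by (simp add: grp)
  show ?thesis using assms(1-3)
  proof (rule cls_eq_induct)
    fix x y g h assume xy: "adj x y" "g \<in> carrier (G x)" "h \<in> carrier (G y)"
    then have "x \<noteq> y" by auto
    then show "component v [(x, g), (y, h)] = component v [(y, h), (x, g)]" by auto
  qed (use assms(4) component_closed in \<open>auto simp: component_append m_assoc\<close>)
qed

lemma map_letters_words:
  "(\<And>u. u \<in> set us \<Longrightarrow> u \<in> V \<and> f u \<in> carrier (G u)) \<Longrightarrow> map (\<lambda>u. (u, f u)) us \<in> fp_words V G"
  by (induction us) auto

text \<open>Over a complete graph the new letter can travel along the list until it meets the entry
  of its own vertex, where it is absorbed.\<close>

lemma cls_insert_letter:
  assumes complete: "\<And>u v. u \<in> V \<Longrightarrow> v \<in> V \<Longrightarrow> u \<noteq> v \<Longrightarrow> adj u v"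
    and "distinct vs" "set vs \<subseteq> V" "v \<in> set vs" "g \<in> carrier (G v)" "\<And>u. u \<in> V \<Longrightarrow>
      f u \<in> carrier (G u)"
  shows "cls ((v, g) # map (\<lambda>u. (u, f u)) vs) =
    cls (map (\<lambda>u. (u, if u = v then g \<otimes>\<^bsub>G v\<^esub> f v else f u)) vs)"
  using assms(2-4)
proof (induction vs)
  case (Cons u vs)
  let ?f = "\<lambda>u. (u, f u)" and ?h = "\<lambda>u. (u, if u = v then g \<otimes>\<^bsub>G v\<^esub> f v else f u)"
  have "map ?f vs \<in> fp_words V G"
    using Cons.prems assms(6) by (intro map_letters_words) auto
  moreover have "u \<in> V" "v \<in> V" using Cons.prems by auto
  ultimately have W: "map ?f vs \<in> fp_words V G" "u \<in> V" "f u \<in> carrier (G u)" "v \<in> V"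
    using assms(6) by simp_all
  interpret group "G v" using W by (simp add: grp)
  show ?case
  proof (cases "u = v")
    case True
    then have eq: "map ?h vs = map ?f vs" using Cons.prems by auto
    have "cls ([(v, g), (v, f v)] @ map ?f vs) = cls ([(v, g \<otimes>\<^bsub>G v\<^esub> f v)] @ map ?f vs)"
      using True W assms(5) by (intro cls_cong_append cls_mult_letter) auto
    then show ?thesis using True by (simp only: list.map eq) simp
  next
    case False
    have W': "map ?h vs \<in> fp_words V G"
      using Cons.prems assms(5,6) W by (intro map_letters_words) auto
    have "cls ([(v, g), (u, f u)] @ map ?f vs) = cls ([(u, f u), (v, g)] @ map ?f vs)"
      using False W assms(5) complete by (intro cls_cong_append cls_commute_letters) auto
    also have "\<dots> = cls [(u, f u)] \<otimes>\<^bsub>GP\<^esub> cls ((v, g) # map ?f vs)"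
      using W assms(5) cls_Cons[of u "f u" "(v, g) # map ?f vs"] by simp
    also have "\<dots> = cls [(u, f u)] \<otimes>\<^bsub>GP\<^esub> cls (map ?h vs)"
      using Cons False by simp
    also have "\<dots> = cls ((u, f u) # map ?h vs)"
      using W W' cls_Cons[of u "f u" "map ?h vs"] by simp
    finally show ?thesis using False by simp
  qed
qed simp

theorem complete_graph_product:
  assumes complete: "\<And>u v. u \<in> V \<Longrightarrow> v \<in> V \<Longrightarrow> u \<noteq> v \<Longrightarrow> adj u v" and fin: "finite V"
  shows "GP \<cong> product_group V G"
proof -
  obtain vs where vs: "set vs = V" "distinct vs" using finite_distinct_list[OF fin] by blast
  \<comment> \<open>The coordinates of \<open>f\<close> written as a word in a fixed order of the
    vertices. Every word equals the canonical word of its components, which gives surjectivity;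
    reading off components gives injectivity.\<close>
  define can where "can f = map (\<lambda>u. (u, f u)) vs" for f :: "'v \<Rightarrow> 'a"
  have can: "can f \<in> fp_words V G" if "\<And>v. v \<in> V \<Longrightarrow> f v \<in> carrier (G v)" for f
    unfolding can_def using that vs by (intro map_letters_words) auto
  have component_notin: "component v (map (\<lambda>u. (u, f u)) us) = \<one>\<^bsub>G v\<^esub>" if "v \<notin> set us" for v f us
    using that by (induction us) auto
  have component_map: "component v (map (\<lambda>u. (u, f u)) us) = f v"
    if "v \<in> set us" "distinct us" "v \<in> V" "f v \<in> carrier (G v)" for v f us
  proof -
    interpret group "G v" using that by (simp add: grp)
    show ?thesis using that by (induction us) (auto simp: component_notin)
  qed
  have component_can: "component v (can f) = f v" if "v \<in> V" "f v \<in> carrier (G v)" for v f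
    using component_map[of v vs f] vs that by (simp add: can_def)
  have cls_can: "cls w = cls (can (\<lambda>v. component v w))" if "w \<in> fp_words V G" for w
    using that
  proof (induction w)
    case Nil
    have "cls (map (\<lambda>u. (u, \<one>\<^bsub>G u\<^esub>)) us) = \<one>\<^bsub>GP\<^esub>" if "set us \<subseteq> V" for us
      using that
    proof (induction us)
      case (Cons u us)
      have "\<one>\<^bsub>G u\<^esub> \<in> carrier (G u)" if "u \<in> V" for u
        using grp[OF that] by (simp add: group.is_monoid)
      with Cons have "map (\<lambda>u. (u, \<one>\<^bsub>G u\<^esub>)) us \<in> fp_words V G" "\<one>\<^bsub>G u\<^esub> \<in> carrier (G u)" "u \<in> V"
        by (auto intro!: map_letters_words)
      then show ?case
        using Cons cls_one_letter[of u] cls_Cons[of u "\<one>\<^bsub>G u\<^esub>" "map (\<lambda>u. (u, \<one>\<^bsub>G u\<^esub>)) us"] by simp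
    qed (simp add: cls_Nil)
    then show ?case using vs by (simp add: can_def cls_Nil)
  next
    case (Cons l w)
    obtain v g where l: "l = (v, g)" by force
    have vg: "v \<in> V" "g \<in> carrier (G v)" "w \<in> fp_words V G" using Cons.prems l by auto
    have W: "can (\<lambda>v. component v w) \<in> fp_words V G" using component_closed vg by (intro can)
    have "cls (l # w) = cls ((v, g) # can (\<lambda>v. component v w))"
      using Cons.IH vg W cls_Cons[of v g w] cls_Cons[of v g "can (\<lambda>v. component v w)"] l by simp
    also have "\<dots> = cls (map (\<lambda>u. (u, if u = v then g \<otimes>\<^bsub>G v\<^esub> component v w else component u w)) vs)"
      unfolding can_def using vs vg complete component_closed
      by (intro cls_insert_letter) auto
    also have "map (\<lambda>u. (u, if u = v then g \<otimes>\<^bsub>G v\<^esub> component v w else component u w)) vs =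
        can (\<lambda>u. component u (l # w))"
      by (auto simp: can_def l)
    finally show ?case .
  qed
  have cls_eqI: "cls u = cls w"
    if "u \<in> fp_words V G" "w \<in> fp_words V G" "\<And>v. v \<in> V \<Longrightarrow> component v u = component v w" for u w
  proof -
    have "can (\<lambda>v. component v u) = can (\<lambda>v. component v w)"
      using that(3) vs by (auto simp: can_def)
    then show ?thesis using cls_can[OF that(1)] cls_can[OF that(2)] by simp
  qed
  let ?P = "product_group V G"
  have grpP: "group ?P" by (simp add: grp)
  have mem: "f v \<in> carrier (G v)" if "f \<in> carrier ?P" "v \<in> V" for f v
    using that by auto
  have "(\<lambda>f. cls (can f)) \<in> iso ?P GP"
  proof (rule isoI)
    show "(\<lambda>f. cls (can f)) \<in> hom ?P GP"
    proof (rule homI)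
      fix f assume "f \<in> carrier ?P"
      then show "cls (can f) \<in> carrier GP" using mem by (intro cls_carrier can)
    next
      fix f g assume fg: "f \<in> carrier ?P" "g \<in> carrier ?P"
      have W: "can f \<in> fp_words V G" "can g \<in> fp_words V G" using fg mem by (auto intro: can)
      have closed: "(f \<otimes>\<^bsub>?P\<^esub> g) v \<in> carrier (G v)" if "v \<in> V" for v
        using mem[OF _ that] fg grpP by (meson group.is_monoid monoid.m_closed)
      have "cls (can (f \<otimes>\<^bsub>?P\<^esub> g)) = cls (can f @ can g)"
      proof (rule cls_eqI)
        fix v assume v: "v \<in> V"
        then show "component v (can (f \<otimes>\<^bsub>?P\<^esub> g)) = component v (can f @ can g)"
          using component_can[of v "f \<otimes>\<^bsub>?P\<^esub> g", OF v closed[OF v]] component_can[of v f,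
            OF v mem[OF fg(1) v]]
            component_can[of v g, OF v mem[OF fg(2) v]] component_append[OF v W] by simp
      qed (use W closed in \<open>auto intro: can\<close>)
      then show "cls (can (f \<otimes>\<^bsub>?P\<^esub> g)) = cls (can f) \<otimes>\<^bsub>GP\<^esub> cls (can g)"
        using W by (simp add: cls_append)
    qed
    show "bij_betw (\<lambda>f. cls (can f)) (carrier ?P) (carrier GP)"
    proof (rule bij_betw_imageI)
      show "inj_on (\<lambda>f. cls (can f)) (carrier ?P)"
      proof (rule inj_onI)
        fix f g assume fg: "f \<in> carrier ?P" "g \<in> carrier ?P" and eq: "cls (can f) = cls (can g)"
        have "f v = g v" if v: "v \<in> V" for v
        proof -
          have "component v (can f) = component v (can g)"
            using eq fg mem v by (intro cls_eq_component) (auto intro!: can)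
          then show ?thesis
            using component_can[of v f, OF v mem[OF fg(1) v]]
              component_can[of v g, OF v mem[OF fg(2) v]] by simp
        qed
        then show "f = g" using fg by (auto intro: PiE_ext)
      qed
      show "(\<lambda>f. cls (can f)) ` carrier ?P = carrier GP"
      proof (intro equalityI subsetI)
        fix x assume "x \<in> (\<lambda>f. cls (can f)) ` carrier ?P"
        then show "x \<in> carrier GP" using mem by (auto intro!: cls_carrier can)
      next
        fix x assume "x \<in> carrier GP"
        then obtain w where w: "w \<in> fp_words V G" "x = cls w" by (rule cls_cases)
        \<comment> \<open>Elements of \<open>product_group\<close> are extensional functions, hence
          the restriction to \<open>V\<close>.\<close>
        let ?f = "restrict (\<lambda>v. component v w) V"
        have "can ?f = can (\<lambda>v. component v w)" using vs by (auto simp: can_def)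
        then have "x = cls (can ?f)" using cls_can w by simp
        moreover have "?f \<in> carrier ?P" using component_closed w by auto
        ultimately show "x \<in> (\<lambda>f. cls (can f)) ` carrier ?P" by blast
      qed
    qed
  qed
  then show ?thesis using group.iso_sym[OF grpP] by (auto simp: is_iso_def)
qed

end

context graph_of_groups begin

subsection \<open>Common prefixes and the Gromov product\<close>

lemma shuffle_move:
  "(\<And>k. k \<in> set u \<Longrightarrow> adj (fst k) (fst l)) \<Longrightarrow> shuffle (u @ l # w) (l # u @ w)"
proof (induction u)
  case (Cons k u)
  have "shuffle ((k # u) @ l # w) (k # l # u @ w)"
    using Cons by (auto intro: shuffle.Cons)
  also have "shuffle \<dots> (l # (k # u) @ w)"
    using Cons.prems[of k] by (simp add: shuffle.swap)
  finally show ?case .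
qed auto

text \<open>Common head letters are stripped greedily. Only equal letters are removed, so the
  remainders may still have different head letters over one vertex.\<close>

lemma ex_maximal_common_prefix:
  "\<exists>p x' y'. shuffle x (p @ x') \<and> shuffle y (p @ y') \<and> head_letters x' \<inter> head_letters y' = {}"
proof (induction "length x" arbitrary: x y rule: less_induct)
  case less
  show ?case
  proof (cases "head_letters x \<inter> head_letters y = {}")
    case True
    then show ?thesis by (intro exI[of _ "[]"] exI[of _ x] exI[of _ y]) simp
  next
    case False
    then obtain l where "l \<in> head_letters x" "l \<in> head_letters y" by blast
    then obtain x1 y1 where 1: "shuffle x (l # x1)" "shuffle y (l # y1)"
      using head_letters_shuffle by blast
    then have "length x1 < length x" using shuffle_length by fastforce
    from less[OF this, of y1] obtain p x' y' where 2: "shuffle x1 (p @ x')" "shuffle y1 (p @ y')"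
      "head_letters x' \<inter> head_letters y' = {}" by blast
    have "shuffle x ((l # p) @ x')" "shuffle y ((l # p) @ y')"
      using shuffle.trans[OF 1(1) shuffle.Cons[OF 2(1)]] shuffle.trans[OF 1(2) shuffle.Cons[OF
        2(2)]]
      by simp_all
    with 2(3) show ?thesis by blast
  qed
qed

text \<open>As \<open>adj\<close> is symmetric and irreflexive, \<open>sorted_wrt\<close> amounts to
  pairwise adjacency over distinct vertices.\<close>

abbreviation clique :: "('v \<times> 'a) list \<Rightarrow> bool" where
  "clique w \<equiv> sorted_wrt (\<lambda>l k. adj (fst l) (fst k)) w"

lemma clique_head_letters: "clique w \<Longrightarrow> set w \<subseteq> head_letters (w @ u)"
  by (induction w) auto

lemma clique_reduced: "clique w \<Longrightarrow> (\<And>l. l \<in> set w \<Longrightarrow> nontrivial_letter l) \<Longrightarrow> reduced w"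
proof (induction w)
  case (Cons l w)
  have "fst l \<notin> heads w"
    using Cons.prems(1) head_letters_subset[of w]
      by (auto simp: image_iff) (metis adj_irrefl fst_conv subsetD)
  with Cons show ?case by auto
qed auto

lemma clique_distinct: "clique w \<Longrightarrow> distinct (map fst w)"
proof (induction w)
  case (Cons l w)
  then have "fst l \<notin> fst ` set w" by (auto simp: image_iff)
  with Cons show ?case by simp
qed simp

lemma clique_cong:
  assumes "map fst w = map fst w'" shows "clique w \<longleftrightarrow> clique w'"
proof -
  have "clique w \<longleftrightarrow> sorted_wrt adj (map fst w)" for w
    by (simp add: sorted_wrt_map)
  with assms show ?thesis by simp
qed

text \<open>
  Two reduced words without a common head letter may still have distinct head letters over the
  same vertex; these are collected in \<open>a\<close> and \<open>b\<close>. The parameter \<open>C\<close> only serves the induction.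
\<close>

lemma ex_common_clique:
  "\<exists>a b x' y'. shuffle x (a @ x') \<and> shuffle y (b @ y') \<and> map fst a = map fst b \<and> clique a \<and>
     (\<forall>u\<in>C. \<forall>v\<in>fst ` set a. adj u v) \<and>
     (\<forall>v \<in> heads x' \<inter> heads y'. \<exists>u\<in>C \<union> fst ` set a. \<not> adj u v)"
proof (induction "length x" arbitrary: x y C rule: less_induct)
  case less
  show ?case
  proof (cases "\<forall>v \<in> heads x \<inter> heads y. \<exists>u\<in>C. \<not> adj u v")
    case True
    then show ?thesis
      by (intro exI[of _ "[]"] exI[of _ x] exI[of _ y]) simp
  next
    case False
    then obtain v where v: "v \<in> heads x" "v \<in> heads y" "\<forall>u\<in>C. adj u v" by blast
    then obtain g h where "(v, g) \<in> head_letters x" "(v, h) \<in> head_letters y" by force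
    then obtain x1 y1 where 1: "shuffle x ((v, g) # x1)" "shuffle y ((v, h) # y1)"
      using head_letters_shuffle by metis
    then have "length x1 < length x" using shuffle_length by fastforce
    \<comment> \<open>With \<open>v\<close> added to \<open>C\<close>, all vertices extracted later
      are adjacent to \<open>v\<close>, which keeps \<open>(v, g) # a\<close> a clique.\<close>
    from less[OF this, of y1 "insert v C"] obtain a b x' y' where
      2: "shuffle x1 (a @ x')" "shuffle y1 (b @ y')" and ab: "map fst a = map fst b" "clique a"
      and C: "\<forall>u\<in>insert v C. \<forall>w\<in>fst ` set a. adj u w"
        "\<forall>w \<in> heads x' \<inter> heads y'. \<exists>u\<in>insert v C \<union> fst ` set a. \<not> adj u w"
      by blast
    have "shuffle x (((v, g) # a) @ x')" "shuffle y (((v, h) # b) @ y')"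
      using shuffle.trans[OF 1(1) shuffle.Cons[OF 2(1)]] shuffle.trans[OF 1(2) shuffle.Cons[OF
        2(2)]]
      by simp_all
    moreover have "clique ((v, g) # a)" using ab C by auto
    moreover have "map fst ((v, g) # a) = map fst ((v, h) # b)" using ab by simp
    moreover have "\<forall>u\<in>C. \<forall>w\<in>fst ` set ((v, g) # a). adj u w" using C v by simp
    moreover have "\<forall>w \<in> heads x' \<inter> heads y'. \<exists>u\<in>C \<union> fst ` set ((v, g) # a). \<not> adj u w"
      using C(2) by simp
    ultimately show ?thesis by blast
  qed
qed

lemma set_inv_word: "fst ` set (inv_word w) = fst ` set w"
  by (force simp: inv_word_def)

text \<open>Letters over different vertices of a clique commute, so the product collapses vertex by
  vertex to quotients inside the vertex groups. Such a quotient is trivial only if the two letters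
  agree, which disjointness of \<open>set a\<close> and \<open>set b\<close> rules out.\<close>

lemma clique_quotient:
  assumes "map fst a = map fst b" "clique a" "a \<in> fp_words V G" "b \<in> fp_words V G"
  shows "\<exists>c. c \<in> fp_words V G \<and> map fst c = map fst a \<and> cls (inv_word a @ b) = cls c \<and>
    (set a \<inter> set b = {} \<longrightarrow> (\<forall>l\<in>set c. nontrivial_letter l))"
  using assms
proof (induction a arbitrary: b)
  case Nil
  then show ?case by (intro exI[of _ "[]"]) (simp add: inv_word_def)
next
  case (Cons l a)
  obtain v g where l: "l = (v, g)" by force
  obtain h b' where b: "b = (v, h) # b'" and ab': "map fst a = map fst b'"
    using Cons.prems(1) l by (cases b) auto
  interpret group "G v" using Cons.prems l by (simp add: grp)
  have W: "v \<in> V" "g \<in> carrier (G v)" "h \<in> carrier (G v)" "a \<in> fp_words V G" "b' \<in> fp_words V G"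
    using Cons.prems l b by auto
  from Cons.IH[OF ab' _ W(4,5)] Cons.prems obtain c where c: "c \<in> fp_words V G"
    "map fst c = map fst a" "cls (inv_word a @ b') = cls c"
    "set a \<inter> set b' = {} \<longrightarrow> (\<forall>l\<in>set c. nontrivial_letter l)" by auto
  let ?m = "(v, inv\<^bsub>G v\<^esub> g \<otimes>\<^bsub>G v\<^esub> h)"
  have inv: "inv_word a \<in> fp_words V G" using W by (simp add: inv_word_words)
  have eq: "inv_word (l # a) @ b = inv_word a @ [(v, inv\<^bsub>G v\<^esub> g), (v, h)] @ b'"
    by (simp add: inv_word_def l b inv_letter_def)
  have "cls (inv_word (l # a) @ b) = cls (inv_word a) \<otimes>\<^bsub>GP\<^esub> (cls [?m] \<otimes>\<^bsub>GP\<^esub> cls b')"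
    unfolding eq using W inv cls_mult_letter[of v "inv\<^bsub>G v\<^esub> g" h]
      cls_append[of "inv_word a" "[(v, inv\<^bsub>G v\<^esub> g), (v, h)] @ b'"]
      cls_append[of "[(v, inv\<^bsub>G v\<^esub> g), (v, h)]" b'] by simp
  also have "\<dots> = cls (inv_word a @ ?m # b')"
    using W inv cls_append[of "inv_word a" "[?m] @ b'"] cls_append[of "[?m]" b'] by simp
  also have "\<dots> = cls (?m # inv_word a @ b')"
  proof (rule shuffle_cls, rule shuffle_move)
    fix k assume "k \<in> set (inv_word a)"
    then have "fst k \<in> fst ` set a" using set_inv_word by fastforce
    then show "adj (fst k) (fst ?m)" using Cons.prems(2) l by (auto simp: adj_sym)
  qed (use W inv in auto)
  also have "\<dots> = cls (?m # c)"
    using W inv c cls_Cons[of v "inv\<^bsub>G v\<^esub> g \<otimes>\<^bsub>G v\<^esub> h" c]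
      cls_Cons[of v "inv\<^bsub>G v\<^esub> g \<otimes>\<^bsub>G v\<^esub> h" "inv_word a @ b'"] by simp
  finally have "cls (inv_word (l # a) @ b) = cls (?m # c)" .
  moreover have "nontrivial_letter ?m" if "g \<noteq> h"
  proof -
    have "g = h" if "inv\<^bsub>G v\<^esub> g \<otimes>\<^bsub>G v\<^esub> h = \<one>\<^bsub>G v\<^esub>"
      using that W by (metis inv_solve_left r_one one_closed)
    with that W show ?thesis by (auto simp: nontrivial_letter_def)
  qed
  ultimately show ?case
    using W c l b by (intro exI[of _ "?m # c"]) auto
qed

text \<open>Cancellation is taken from the group and carried back to words by uniqueness of reduced
  words.\<close>

lemma shuffle_cancel:
  assumes "shuffle (l # u) (l # w)" "reduced (l # u)"
  shows "shuffle u w"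
proof -
  obtain v g where l: "l = (v, g)" by force
  have r: "reduced (l # w)" using assms shuffle_reduced by blast
  have W: "(v, g) # u \<in> fp_words V G" "(v, g) # w \<in> fp_words V G"
    using reduced_words[OF assms(2)] reduced_words[OF r] l by auto
  have "cls (l # u) = cls (l # w)" using shuffle_cls[OF assms(1)] W l by simp
  then have "cls u = cls w"
    using W cls_Cons[OF W(1)] cls_Cons[OF W(2)] cls_carrier[of u] cls_carrier[of w]
      cls_carrier[of "[(v, g)]"] l by simp
  then show ?thesis using assms r by (intro cls_eq_shuffle) auto
qed

text \<open>Levi's lemma for partially commutative monoids. The first letter of \<open>u\<close> is
  a head letter of \<open>w @ w'\<close> but not of \<open>w\<close>; so it comes from
  \<open>w'\<close> and commutes with all of \<open>w\<close>, and it can be cancelled on both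
  sides.\<close>

lemma levi:
  assumes "shuffle (u @ u') (w @ w')" "reduced (u @ u')" "head_letters u \<inter> head_letters w = {}"
    "l \<in> set u" "k \<in> set w"
  shows "adj (fst l) (fst k)"
  using assms
proof (induction u arbitrary: l w')
  case (Cons m u)
  have "m \<in> head_letters (w @ w')"
    using shuffle_head_letters[OF Cons.prems(1)] by auto
  then have m: "m \<in> head_letters w'" "\<forall>k\<in>set w. adj (fst k) (fst m)"
    using Cons.prems(3) by (auto simp: head_letters_append)
  then obtain w1 where w1: "shuffle w' (m # w1)" using head_letters_shuffle by blast
  have "shuffle (m # u @ u') (w @ m # w1)"
    using shuffle.trans[OF Cons.prems(1) shuffle_append[OF shuffle.refl w1]] by simp
  also have "shuffle \<dots> (m # w @ w1)" using m by (intro shuffle_move) auto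
  finally have "shuffle (u @ u') (w @ w1)" using Cons.prems(2) shuffle_cancel[of m] by simp
  \<comment> \<open>Removing \<open>m\<close> may create new head letters of \<open>u\<close>; but
    one shared with \<open>w\<close> would be adjacent to \<open>m\<close>, hence a head letter
    already before the removal.\<close>
  moreover have "head_letters u \<inter> head_letters w = {}"
  proof -
    have "k \<in> head_letters (m # u)" if "k \<in> head_letters u" "k \<in> head_letters w" for k
    proof -
      have "adj (fst m) (fst k)" using that m(2) head_letters_subset[of w] adj_sym by blast
      with that show ?thesis by simp
    qed
    then show ?thesis using Cons.prems(3) by blast
  qed
  moreover have "reduced (u @ u')" using Cons.prems(2) by simp
  ultimately have "adj (fst l) (fst k)" if "l \<in> set u"
    using Cons.IH that Cons.prems(5) by blast
  moreover have "adj (fst m) (fst k)" using m(2) Cons.prems(5) adj_sym by blast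
  ultimately show ?case using Cons.prems(4) by auto
qed auto

text \<open>Inductively all vertices of the tail are heads, so a repeated vertex would contradict
  reducedness.\<close>

lemma reduced_clique_distinct:
  assumes "reduced w" "\<And>l k. l \<in> set w \<Longrightarrow> k \<in> set w \<Longrightarrow> fst l = fst k \<or> adj (fst l) (fst k)"
  shows "distinct (map fst w) \<and> heads w = fst ` set w"
  using assms
proof (induction w)
  case (Cons l w)
  then have IH: "distinct (map fst w)" "heads w = fst ` set w" by auto
  have l: "fst l \<notin> fst ` set w" using Cons.prems(1) IH by simp
  then have "adj (fst l) v" if "v \<in> fst ` set w" for v
    using Cons.prems(2)[of l] that by fastforce
  then have "heads (l # w) = fst ` set (l # w)" using IH
    by (auto simp: heads_Cons simp del: head_letters.simps)
  with IH l show ?case by (simp del: head_letters.simps)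
qed auto

lemma ex_reduced:
  assumes "x \<in> carrier GP" obtains w where "reduced w" "x = cls w"
proof -
  from assms obtain w where "w \<in> fp_words V G" "x = cls w" by (rule cls_cases)
  then show thesis using that[of "nf w"] nf_reduced nf_cls by metis
qed

end

section \<open>Weighted length of group elements and its comparison with common prefixes\<close>

locale weighted_graph_of_groups = graph_of_groups V E G
  for V :: "'v set" and E :: "'v set set" and G :: "'v \<Rightarrow> ('a, 'm) monoid_scheme" +
  fixes wt :: "'v \<times> 'a \<Rightarrow> nat"
  assumes wt_ge: "1 \<le> wt l" and wt_le: "wt l \<le> 2" and wt_inv: "fst l \<in> V \<Longrightarrow>
    snd l \<in> carrier (G (fst l)) \<Longrightarrow> wt (inv_letter l) = wt l"
begin

definition wlen :: "('v \<times> 'a) list \<Rightarrow> nat" where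
  "wlen w = sum_list (map wt w)"

lemma wlen_simps [simp]:
  "wlen [] = 0" "wlen (l # w) = wt l + wlen w" "wlen (u @ w) = wlen u + wlen w"
  by (simp_all add: wlen_def)

lemma wlen_shuffle: "shuffle u w \<Longrightarrow> wlen u = wlen w"
  by (metis shuffle_mset mset_map sum_mset_sum_list wlen_def)

lemma wlen_le: "wlen w \<le> 2 * length w"
proof (induction w)
  case (Cons l w)
  with wt_le[of l] show ?case by simp
qed simp

lemma wlen_inv_word: "w \<in> fp_words V G \<Longrightarrow> wlen (inv_word w) = wlen w"
  by (induction w) (auto simp: inv_word_def wt_inv)

text \<open>This is what confines the weights to 1 and 2: a merged letter weighs at most 2, which is
  no more than the two letters that it replaces.\<close>

lemma wlen_push: "wlen (push v g w) \<le> wt (v, g) + wlen w"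
proof (induction w)
  case (Cons l w)
  obtain u h where l: "l = (u, h)" by force
  have "wt (v, g \<otimes>\<^bsub>G v\<^esub> h) \<le> wt (v, g) + wt (v, h)"
    using wt_le[of "(v, g \<otimes>\<^bsub>G v\<^esub> h)"] wt_ge[of "(v, g)"] wt_ge[of "(v, h)"] by simp
  then show ?case using Cons l by auto
qed auto

lemma wlen_nf: "wlen (nf w) \<le> wlen w"
proof (induction w)
  case (Cons l w)
  have "wlen (nf (l # w)) \<le> wt l + wlen (nf w)"
    using wlen_push[of "fst l" "snd l" "nf w"] by (cases l) (auto simp: nf_def ins_def)
  with Cons show ?case by simp
qed (simp add: nf_def)

text \<open>The choice of a representative is harmless: normal forms of one element are shuffles of
  each other and have the same weight.\<close>

definition Len :: "('v \<times> 'a) list set set \<Rightarrow> nat" where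
  "Len x = wlen (nf (SOME w. w \<in> fp_words V G \<and> cls w = x))"

lemma Len_cls: "w \<in> fp_words V G \<Longrightarrow> Len (cls w) = wlen (nf w)"
proof -
  assume w: "w \<in> fp_words V G"
  define u where "u = (SOME u. u \<in> fp_words V G \<and> cls u = cls w)"
  have "u \<in> fp_words V G \<and> cls u = cls w"
    unfolding u_def by (rule someI[of _ w]) (use w in simp)
  then have "shuffle (nf u) (nf w)" using w by (simp add: nf_def act_cls_eq)
  then show ?thesis by (simp add: Len_def u_def wlen_shuffle)
qed

lemma Len_reduced: "reduced w \<Longrightarrow> Len (cls w) = wlen w"
  by (simp add: Len_cls reduced_words wlen_shuffle shuffle_nf)

lemma Len_cls_le: "w \<in> fp_words V G \<Longrightarrow> Len (cls w) \<le> wlen w"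
  by (simp add: Len_cls wlen_nf)

lemma Len_one: "Len \<one>\<^bsub>GP\<^esub> = 0"
  using Len_reduced[of "[]"] by (simp add: cls_Nil)

lemma Len_mult:
  assumes "x \<in> carrier GP" "y \<in> carrier GP" shows "Len (x \<otimes>\<^bsub>GP\<^esub> y) \<le> Len x + Len y"
proof -
  obtain u w where "reduced u" "x = cls u" "reduced w" "y = cls w" using assms by (metis ex_reduced)
  then show ?thesis
    using Len_cls_le[of "u @ w"] by (simp add: Len_reduced reduced_words cls_append)
qed

lemma Len_inv: assumes "x \<in> carrier GP" shows "Len (inv\<^bsub>GP\<^esub> x) = Len x"
proof -
  obtain u where "reduced u" "x = cls u" using assms by (metis ex_reduced)
  then show ?thesis
    using cls_inv_word[of u] Len_reduced[of "inv_word u"] Len_reduced[of u]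
    by (simp add: reduced_inv_word reduced_words wlen_inv_word)
qed

text \<open>Splitting off the clique words \<open>a\<close> and \<open>b\<close> turns the quotient
  of \<open>y\<close> by \<open>x\<close> into \<open>inv_word x' @ c @ y'\<close>, where
  \<open>c\<close> is the vertexwise quotient of \<open>b\<close> by \<open>a\<close>. This word is
  reduced, so nothing else cancels. The loss is the weight of \<open>a\<close> and \<open>b\<close>,
  at most \<open>2 * card V\<close> each.\<close>

lemma prefix_estimate:
  assumes fin: "finite V" and xy: "reduced x" "reduced y"
  shows "\<exists>p x' y'. shuffle x (p @ x') \<and> shuffle y (p @ y') \<and>
    wlen x' + wlen y' \<le> Len (cls (inv_word x @ y)) + 4 * card V"
proof -
  obtain p x1 y1 where p: "shuffle x (p @ x1)" "shuffle y (p @ y1)"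
    "head_letters x1 \<inter> head_letters y1 = {}"
    using ex_maximal_common_prefix by blast
  obtain a b x' y' where a: "shuffle x1 (a @ x')" and b: "shuffle y1 (b @ y')"
    and ab: "map fst a = map fst b" "clique a"
    and max: "\<forall>v \<in> heads x' \<inter> heads y'. \<exists>u\<in>fst ` set a. \<not> adj u v"
    using ex_common_clique[of x1 y1 "{}"] by auto
  have r: "reduced (p @ x1)" "reduced (p @ y1)" using xy p shuffle_reduced by blast+
  then have r1: "reduced (a @ x')" "reduced (b @ y')"
    using a b shuffle_reduced by (auto simp: reduced_append)
  have W: "x \<in> fp_words V G" "y \<in> fp_words V G" "p \<in> fp_words V G" "x1 \<in> fp_words V G"
    "y1 \<in> fp_words V G" "a \<in> fp_words V G" "b \<in> fp_words V G" "x' \<in> fp_words V G"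
      "y' \<in> fp_words V G"
    using xy[THEN reduced_words] r[THEN reduced_words] r1[THEN reduced_words] by auto
  have "clique b" using ab clique_cong by blast
  then have "set a \<inter> set b = {}"
    using p(3) clique_head_letters[OF ab(2), of x'] clique_head_letters[of b y']
      shuffle_head_letters[OF a] shuffle_head_letters[OF b] by blast
  with clique_quotient[OF ab W(6,7)] obtain c where c: "c \<in> fp_words V G"
    "map fst c = map fst a" "cls (inv_word a @ b) = cls c" "\<forall>l\<in>set c. nontrivial_letter l" by blast
  have fst_eq: "fst ` set c = fst ` set a" "fst ` set b = fst ` set a"
    using c(2) ab(1) by (metis list.set_map)+
  have "clique c" using ab c clique_cong by metis
  then have red_c: "reduced c" using c by (intro clique_reduced) auto
  have sub: "heads w \<subseteq> fst ` set w" for w using head_letters_subset[of w] by blast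
  have cl_rev: "heads (rev w) = fst ` set w" if "clique w" for w
  proof -
    have "clique (rev w)" using that by (simp add: sorted_wrt_rev adj_sym)
    then show ?thesis using clique_head_letters[of "rev w" "[]"] sub[of "rev w"] by auto
  qed
  \<comment> \<open>\<open>c\<close> has the same vertices as \<open>b\<close>, and the condition at
    the junction depends on vertices only.\<close>
  have "reduced (c @ y')"
    using red_c r1(2) cl_rev[OF \<open>clique c\<close>] cl_rev[OF \<open>clique b\<close>] fst_eq
    by (auto simp: reduced_append)
  \<comment> \<open>A head of \<open>c @ y'\<close> is either a vertex of the clique, and then no
    head of \<open>x'\<close> because \<open>a @ x'\<close> is reduced, or a head of
    \<open>y'\<close> adjacent to the whole clique, which \<open>max\<close> forbids as a head of
    \<open>x'\<close>.\<close>
  moreover have "heads x' \<inter> heads (c @ y') = {}"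
  proof -
    have "heads x' \<inter> fst ` set a = {}"
      using r1(1) cl_rev[OF ab(2)] by (auto simp: reduced_append)
    moreover have "heads (c @ y') \<subseteq> fst ` set a \<union> {v \<in> heads y'. \<forall>u\<in>fst ` set a. adj u v}"
      unfolding heads_append fst_eq(1)
      using sub[of c, unfolded fst_eq(1)] by (rule Un_mono[OF _ subset_refl])
    moreover have "H \<inter> K = {}"
      if "H \<inter> A = {}" "K \<subseteq> A \<union> {v \<in> D. \<forall>u\<in>A. Q u v}" "\<forall>v\<in>H \<inter> D. \<exists>u\<in>A. \<not> Q u v"
      for H K A D :: "'v set" and Q
      using that by blast
    from this[OF _ _ max] calculation show ?thesis by simp
  qed
  moreover have "heads (rev (inv_word x')) = heads x'"
    by (simp add: inv_word_def heads_map)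
  ultimately have "reduced (inv_word x' @ c @ y')"
    using r1(1) by (simp add: reduced_append[of "inv_word x'"] reduced_inv_word reduced_append[of
      a])
  then have "Len (cls (inv_word x' @ c @ y')) = wlen x' + wlen c + wlen y'"
    using W by (simp add: Len_reduced wlen_inv_word)
  moreover have "cls (inv_word x @ y) = cls (inv_word x' @ c @ y')"
  proof -
    have "cls x = cls p \<otimes>\<^bsub>GP\<^esub> (cls a \<otimes>\<^bsub>GP\<^esub> cls x')" "cls y = cls p \<otimes>\<^bsub>GP\<^esub> (cls b \<otimes>\<^bsub>GP\<^esub> cls y')"
      using shuffle_cls[OF p(1)] shuffle_cls[OF p(2)] shuffle_cls[OF a] shuffle_cls[OF b] W
      by (simp_all add: cls_append)
    moreover have "inv\<^bsub>GP\<^esub> cls a \<otimes>\<^bsub>GP\<^esub> cls b = cls c"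
      using c(3) W by (simp add: cls_append cls_inv_word inv_word_words)
    moreover have "inv\<^bsub>GP\<^esub> cls a \<otimes>\<^bsub>GP\<^esub> (cls b \<otimes>\<^bsub>GP\<^esub> cls y') = inv\<^bsub>GP\<^esub> cls a \<otimes>\<^bsub>GP\<^esub> cls b \<otimes>\<^bsub>GP\<^esub> cls
      y'"
      using W by (simp add: GP.m_assoc cls_carrier)
    moreover have "inv\<^bsub>GP\<^esub> (P \<otimes>\<^bsub>GP\<^esub> (A \<otimes>\<^bsub>GP\<^esub> B)) \<otimes>\<^bsub>GP\<^esub> (P \<otimes>\<^bsub>GP\<^esub> Y) = inv\<^bsub>GP\<^esub> B \<otimes>\<^bsub>GP\<^esub> (inv\<^bsub>GP\<^esub> A
      \<otimes>\<^bsub>GP\<^esub> Y)"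
      if "P \<in> carrier GP" "A \<in> carrier GP" "B \<in> carrier GP" "Y \<in> carrier GP" for P A B Y
    proof -
      have "inv\<^bsub>GP\<^esub> P \<otimes>\<^bsub>GP\<^esub> (P \<otimes>\<^bsub>GP\<^esub> Y) = Y"
        using that by (simp add: GP.m_assoc[symmetric])
      then show ?thesis using that by (simp add: GP.inv_mult_group GP.m_assoc)
    qed
    ultimately show ?thesis
      using W c(1) by (simp add: cls_append cls_inv_word inv_word_words cls_carrier)
  qed
  moreover have "length a \<le> card V" "length b \<le> card V"
  proof -
    have "set (map fst a) \<subseteq> V" using W(6) by (auto simp: fp_words_def)
    then have "card (set (map fst a)) \<le> card V" by (rule card_mono[OF fin])
    then show "length a \<le> card V" using clique_distinct[OF ab(2)] distinct_card by fastforce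
    then show "length b \<le> card V" using ab(1) by (metis length_map)
  qed
  ultimately have "wlen x1 + wlen y1 \<le> Len (cls (inv_word x @ y)) + 4 * card V"
    using wlen_le[of a] wlen_le[of b] wlen_shuffle[OF a] wlen_shuffle[OF b] by simp
  with p show ?thesis by blast
qed

lemma Len_common_prefix:
  assumes "reduced x" "reduced y" "shuffle x (p @ x')" "shuffle y (p @ y')"
  shows "Len (inv\<^bsub>GP\<^esub> cls x \<otimes>\<^bsub>GP\<^esub> cls y) \<le> wlen x' + wlen y'"
proof -
  have W: "p @ x' \<in> fp_words V G" "p @ y' \<in> fp_words V G"
    using assms reduced_words shuffle_words by blast+
  have "cls x = cls p \<otimes>\<^bsub>GP\<^esub> cls x'" "cls y = cls p \<otimes>\<^bsub>GP\<^esub> cls y'"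
    using shuffle_cls[OF assms(3)] shuffle_cls[OF assms(4)] W assms(1,2)[THEN reduced_words]
    by (simp_all add: cls_append)
  moreover have "inv\<^bsub>GP\<^esub> (P \<otimes>\<^bsub>GP\<^esub> B) \<otimes>\<^bsub>GP\<^esub> (P \<otimes>\<^bsub>GP\<^esub> Y) = inv\<^bsub>GP\<^esub> B \<otimes>\<^bsub>GP\<^esub> Y"
    if "P \<in> carrier GP" "B \<in> carrier GP" "Y \<in> carrier GP" for P B Y
  proof -
    have "inv\<^bsub>GP\<^esub> P \<otimes>\<^bsub>GP\<^esub> (P \<otimes>\<^bsub>GP\<^esub> Y) = Y"
      using that by (simp add: GP.m_assoc[symmetric])
    then show ?thesis using that by (simp add: GP.inv_mult_group GP.m_assoc)
  qed
  ultimately have "inv\<^bsub>GP\<^esub> cls x \<otimes>\<^bsub>GP\<^esub> cls y = cls (inv_word x' @ y')"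
    using W by (simp add: cls_append cls_inv_word inv_word_words cls_carrier)
  then show ?thesis using Len_cls_le[of "inv_word x' @ y'"] W
    by (simp add: inv_word_words wlen_inv_word)
qed

end

section \<open>The four-point condition in the absence of induced squares\<close>

locale square_free_graph_of_groups = weighted_graph_of_groups +
  assumes finite_V: "finite V"
    and no_square: "\<lbrakk>adj a b; adj b c; adj c d; adj d a; a \<noteq> c; b \<noteq> d\<rbrakk> \<Longrightarrow> adj a c \<or> adj b d"
begin

lemma common_prefix_of_prefixes:
  assumes "reduced (u @ u')" "shuffle (u @ u') (w @ w')"
  shows "\<exists>m u1 w1. shuffle u (m @ u1) \<and> shuffle w (m @ w1) \<and>
    (wlen u1 \<le> 2 * card V \<or> wlen w1 \<le> 2 * card V)"
proof -
  obtain m u1 w1 where m: "shuffle u (m @ u1)" "shuffle w (m @ w1)"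
    "head_letters u1 \<inter> head_letters w1 = {}"
    using ex_maximal_common_prefix by blast
  have s1: "shuffle (u @ u') (m @ u1 @ u')" "shuffle (w @ w') (m @ w1 @ w')"
    using shuffle_append[OF m(1) shuffle.refl] shuffle_append[OF m(2) shuffle.refl] by simp_all
  have r: "reduced (m @ u1 @ u')" "reduced (m @ w1 @ w')"
    using assms s1 shuffle_reduced by blast+
  have "shuffle (m @ u1 @ u') (m @ w1 @ w')"
    using shuffle.trans[OF shuffle_sym[OF s1(1)] shuffle.trans[OF assms(2) s1(2)]] .
  then have "shuffle (u1 @ u') (w1 @ w')" using r
  proof (induction m)
    case (Cons l m)
    then have "shuffle (m @ u1 @ u') (m @ w1 @ w')" using shuffle_cancel[of l] by simp
    with Cons show ?case by auto
  qed auto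
  moreover have r1: "reduced (u1 @ u')" "reduced u1" "reduced w1"
    using r by (auto simp: reduced_append)
  ultimately have adj: "adj (fst l) (fst k)" if "l \<in> set u1" "k \<in> set w1" for l k
    using levi m(3) that by blast
  \<comment> \<open>A reduced word over a clique uses each vertex at most once, with weight at most
    2.\<close>
  have bound: "wlen z \<le> 2 * card V"
    if "reduced z" "\<And>l k. l \<in> set z \<Longrightarrow> k \<in> set z \<Longrightarrow> fst l = fst k \<or> adj (fst l) (fst k)" for z
  proof -
    have "set (map fst z) \<subseteq> V" using reduced_words[OF that(1)] by (auto simp: fp_words_def)
    then have "card (set (map fst z)) \<le> card V" by (rule card_mono[OF finite_V])
    moreover have "distinct (map fst z)" using reduced_clique_distinct[OF that] by blast
    ultimately have "length z \<le> card V" using distinct_card by fastforce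
    with wlen_le[of z] show ?thesis by simp
  qed
  have "wlen u1 \<le> 2 * card V \<or> wlen w1 \<le> 2 * card V"
  proof (rule ccontr)
    assume "\<not> ?thesis"
    then obtain l k l' k' where "l \<in> set u1" "k \<in> set u1" "fst l \<noteq> fst k" "\<not> adj (fst l) (fst k)"
      "l' \<in> set w1" "k' \<in> set w1" "fst l' \<noteq> fst k'" "\<not> adj (fst l') (fst k')"
      using bound[OF r1(2)] bound[OF r1(3)] by blast
    then show False
      using no_square[of "fst l" "fst l'" "fst k" "fst k'"] adj adj_sym by blast
  qed
  with m show ?thesis by blast
qed

text \<open>\<open>P\<close> is twice the Gromov product at the identity. It exceeds twice the
  weight of the common prefix by at most \<open>4 * card V\<close>; passing from \<open>p\<close> or
  \<open>q\<close> to their common part \<open>m\<close> costs at most another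
  \<open>4 * card V\<close>.\<close>

lemma Len_four_point:
  assumes "x \<in> carrier GP" "y \<in> carrier GP" "z \<in> carrier GP"
  defines "P \<equiv> \<lambda>x y. real (Len x) + real (Len y) - real (Len (inv\<^bsub>GP\<^esub> x \<otimes>\<^bsub>GP\<^esub> y))"
  shows "P x z \<ge> min (P x y) (P y z) - 8 * card V"
proof -
  obtain a b c where abc: "reduced a" "reduced b" "reduced c" "x = cls a" "y = cls b" "z = cls c"
    using assms(1-3) by (metis ex_reduced)
  have eq: "cls (inv_word u @ w) = inv\<^bsub>GP\<^esub> cls u \<otimes>\<^bsub>GP\<^esub> cls w" if "reduced u" "reduced w" for u w
    using that by (simp add: cls_append cls_inv_word inv_word_words reduced_words)
  obtain p a1 b1 where p: "shuffle a (p @ a1)" "shuffle b (p @ b1)"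
    "wlen a1 + wlen b1 \<le> Len (inv\<^bsub>GP\<^esub> x \<otimes>\<^bsub>GP\<^esub> y) + 4 * card V"
    using prefix_estimate[OF finite_V abc(1,2)] eq abc by auto
  obtain q b2 c2 where q: "shuffle b (q @ b2)" "shuffle c (q @ c2)"
    "wlen b2 + wlen c2 \<le> Len (inv\<^bsub>GP\<^esub> y \<otimes>\<^bsub>GP\<^esub> z) + 4 * card V"
    using prefix_estimate[OF finite_V abc(2,3)] eq abc by auto
  have "shuffle (p @ b1) (q @ b2)" "reduced (p @ b1)"
    using shuffle.trans[OF shuffle_sym[OF p(2)] q(1)] abc(2) shuffle_reduced[OF p(2)] by auto
  then obtain m p' q' where m: "shuffle p (m @ p')" "shuffle q (m @ q')"
    "wlen p' \<le> 2 * card V \<or> wlen q' \<le> 2 * card V"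
    using common_prefix_of_prefixes by blast
  have "shuffle a (m @ p' @ a1)" "shuffle c (m @ q' @ c2)"
    using shuffle.trans[OF p(1) shuffle_append[OF m(1) shuffle.refl]]
      shuffle.trans[OF q(2) shuffle_append[OF m(2) shuffle.refl]] by simp_all
  from Len_common_prefix[OF abc(1,3) this] wlen_shuffle[OF this(1)] wlen_shuffle[OF this(2)]
  have "Len (inv\<^bsub>GP\<^esub> x \<otimes>\<^bsub>GP\<^esub> z) + 2 * wlen m \<le> wlen a + wlen c" using abc by simp
  moreover have "Len x = wlen a" "Len y = wlen b" "Len z = wlen c" using abc Len_reduced by auto
  ultimately show ?thesis
    using wlen_shuffle[OF p(1)] wlen_shuffle[OF p(2)] wlen_shuffle[OF q(1)] wlen_shuffle[OF q(2)]
      wlen_shuffle[OF m(1)] wlen_shuffle[OF m(2)] m(3) p(3) q(3)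
    unfolding P_def by (auto simp: min_def)
qed

end

section \<open>Coned-off graphs\<close>

lemma graph_dist_le: "(x, y) \<in> R ^^ k \<Longrightarrow> graph_dist R x y \<le> k"
  unfolding graph_dist_def by (rule Least_le)

lemma relpow_graph_dist: "(x, y) \<in> R\<^sup>* \<Longrightarrow> (x, y) \<in> R ^^ graph_dist R x y"
  unfolding graph_dist_def by (metis LeastI_ex rtrancl_power)

lemma graph_dist_self [simp]: "graph_dist R x x = 0"
  using graph_dist_le[of x x 0 R] by simp

lemma graph_dist_triangle:
  assumes "(x, y) \<in> R\<^sup>*" "(y, z) \<in> R\<^sup>*"
  shows "graph_dist R x z \<le> graph_dist R x y + graph_dist R y z"
  using relpow_graph_dist[OF assms(1)] relpow_graph_dist[OF assms(2)]
  by (intro graph_dist_le) (auto simp: relpow_add)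

lemma relpow_sym: "sym R \<Longrightarrow> (x, y) \<in> R ^^ k \<Longrightarrow> (y, x) \<in> R ^^ k"
proof (induction k arbitrary: y)
  case (Suc k)
  then obtain z where "(x, z) \<in> R ^^ k" "(z, y) \<in> R" by auto
  with Suc have "(y, z) \<in> R" "(z, x) \<in> R ^^ k" by (auto dest: symD)
  then show ?case by (rule relpow_Suc_I2)
qed simp

lemma graph_dist_sym: "sym R \<Longrightarrow> graph_dist R x y = graph_dist R y x"
  unfolding graph_dist_def using relpow_sym by metis

lemma relpow_map:
  "(\<And>x y. (x, y) \<in> R \<Longrightarrow> (f x, f y) \<in> R) \<Longrightarrow> (x, y) \<in> R ^^ k \<Longrightarrow> (f x, f y) \<in> R ^^ k"
  by (induction k arbitrary: y) auto

text \<open>Serves to ignore the cone points. Moving every point by at most 1 changes distances by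
  at most 2 and Gromov products by at most 3, and the inequality has a product on either
  side.\<close>

lemma gromov_hyperbolic_dense:
  fixes d :: "'v \<Rightarrow> 'v \<Rightarrow> real"
  assumes sym: "\<And>x y. x \<in> V \<Longrightarrow> y \<in> V \<Longrightarrow> d x y = d y x"
    and tri: "\<And>x y z. x \<in> V \<Longrightarrow> y \<in> V \<Longrightarrow> z \<in> V \<Longrightarrow> d x z \<le> d x y + d y z"
    and dense: "\<And>x. x \<in> V \<Longrightarrow> \<exists>u\<in>U. d x u \<le> 1" and U: "U \<subseteq> V"
    and hyp: "gromov_hyperbolic U d"
  shows "gromov_hyperbolic V d"
proof -
  obtain c where c: "\<And>w x y z. w \<in> U \<Longrightarrow> x \<in> U \<Longrightarrow> y \<in> U \<Longrightarrow> z \<in> U \<Longrightarrow>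
    gromov_product d w x z \<ge> min (gromov_product d w x y) (gromov_product d w y z) - c"
    using hyp unfolding gromov_hyperbolic_def by blast
  obtain f where f: "\<And>x. x \<in> V \<Longrightarrow> f x \<in> U \<and> d x (f x) \<le> 1" using dense by metis
  have near: "\<bar>d x y - d (f x) (f y)\<bar> \<le> 2" if "x \<in> V" "y \<in> V" for x y
  proof -
    have fV: "f x \<in> V" "f y \<in> V" using f that U by auto
    have "d x y \<le> d x (f x) + (d (f x) (f y) + d (f y) y)"
      using tri[of x "f x" y] tri[of "f x" "f y" y] that fV by simp
    moreover have "d (f x) (f y) \<le> d (f x) x + (d x y + d y (f y))"
      using tri[of "f x" x "f y"] tri[of x y "f y"] that fV by simp
    moreover have "d (f y) y = d y (f y)" "d (f x) x = d x (f x)" using sym that fV by auto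
    moreover have "d x (f x) \<le> 1" "d y (f y) \<le> 1" using f that by auto
    ultimately show ?thesis by linarith
  qed
  have prod: "\<bar>gromov_product d w x y - gromov_product d (f w) (f x) (f y)\<bar> \<le> 3"
    if "w \<in> V" "x \<in> V" "y \<in> V" for w x y
    using near[of x w] near[of y w] near[of x y] that unfolding gromov_product_def
      by (simp add: abs_le_iff field_simps)
  have "gromov_product d w x z \<ge> min (gromov_product d w x y) (gromov_product d w y z) - (c + 6)"
    if "w \<in> V" "x \<in> V" "y \<in> V" "z \<in> V" for w x y z
    using c[of "f w" "f x" "f y" "f z"] f that prod[of w x z] prod[of w x y] prod[of w y z]
    by (auto simp: min_def abs_le_iff split: if_splits)
  then show ?thesis unfolding gromov_hyperbolic_def by blast
qed

locale coned_off = group K for K :: "('a, 'm) monoid_scheme" (structure) +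
  fixes S :: "'a set" and \<H> :: "'a set set"
  assumes S: "S \<subseteq> carrier K" and subgroups: "\<And>H. H \<in> \<H> \<Longrightarrow> subgroup H K"
begin

abbreviation "R \<equiv> coned_off_adj K S \<H>"
abbreviation "Vs \<equiv> coned_off_verts K \<H>"

lemma adj_simps:
  "(Inl g, Inl h) \<in> R \<longleftrightarrow> g \<in> carrier K \<and> h \<in> carrier K \<and> (\<exists>s\<in>S. h = g \<otimes> s \<or> h = g \<otimes> inv s)"
  "(Inl g, Inr C) \<in> R \<longleftrightarrow> C \<in> left_cosets K \<H> \<and> g \<in> C"
  "(Inr C, Inl g) \<in> R \<longleftrightarrow> C \<in> left_cosets K \<H> \<and> g \<in> C"
  "(Inr C, Inr D) \<notin> R"
proof -
  have canc: "g = h \<otimes> s \<longleftrightarrow> h = g \<otimes> inv s" if "g \<in> carrier K" "h \<in> carrier K" "s \<in> S" for s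
    using that S inv_solve_right[of h g s] by auto
  have "(Inl g, Inl h) \<in> R \<longleftrightarrow>
      (\<exists>s\<in>S. g \<in> carrier K \<and> h = g \<otimes> s) \<or> (\<exists>s\<in>S. h \<in> carrier K \<and> g = h \<otimes> s)"
    by (auto simp: coned_off_adj_def cayley_adj_def Let_def)
  also have "\<dots> \<longleftrightarrow> (\<exists>s\<in>S. g \<in> carrier K \<and> h \<in> carrier K \<and> (h = g \<otimes> s \<or> g = h \<otimes> s))"
    using S m_closed by blast
  also have "\<dots> \<longleftrightarrow> (\<exists>s\<in>S. g \<in> carrier K \<and> h \<in> carrier K \<and> (h = g \<otimes> s \<or> h = g \<otimes> inv s))"
    by (intro bex_cong conj_cong disj_cong HOL.refl canc)
  finally show "(Inl g, Inl h) \<in> R \<longleftrightarrow> g \<in> carrier K \<and> h \<in> carrier K \<and> (\<exists>s\<in>S. h = g \<otimes> s \<or> h =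
    g \<otimes> inv s)"
    by blast
qed (auto simp: coned_off_adj_def Let_def)

lemma sym_R: "sym R"
  unfolding coned_off_adj_def cayley_adj_def Let_def by (auto intro!: symI)

lemma coset_subset: "C \<in> left_cosets K \<H> \<Longrightarrow> C \<subseteq> carrier K"
  using subgroups l_coset_subset_G[OF subgroup.subset] unfolding left_cosets_def by blast

lemma coset_nonempty: "C \<in> left_cosets K \<H> \<Longrightarrow> \<exists>x. x \<in> C"
  using subgroups unfolding left_cosets_def l_coset_def by (auto dest!: subgroup.one_closed)

lemma coset_quotient:
  assumes "C \<in> left_cosets K \<H>" "x \<in> C" "y \<in> C"
  shows "\<exists>H\<in>\<H>. \<exists>h\<in>H. y = x \<otimes> h"
proof -
  obtain g H where gH: "g \<in> carrier K" "H \<in> \<H>" "C = g <# H"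
    using assms(1) by (auto simp: left_cosets_def)
  interpret subgroup H K using gH subgroups by blast
  obtain a b where ab: "a \<in> H" "x = g \<otimes> a" "b \<in> H" "y = g \<otimes> b"
    using assms gH by (auto simp: l_coset_def)
  then have "y = x \<otimes> (inv a \<otimes> b)"
    using gH by (simp add: m_assoc[symmetric] mem_carrier) (simp add: m_assoc mem_carrier)
  moreover have "inv a \<otimes> b \<in> H" using ab by simp
  ultimately show ?thesis using gH by blast
qed

fun translate :: "'a \<Rightarrow> 'a + 'a set \<Rightarrow> 'a + 'a set" where
  "translate g (Inl x) = Inl (g \<otimes> x)"
| "translate g (Inr C) = Inr (g <# C)"

lemma left_coset_translate:
  assumes "g \<in> carrier K" "C \<in> left_cosets K \<H>" shows "g <# C \<in> left_cosets K \<H>"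
proof -
  obtain h H where hH: "h \<in> carrier K" "H \<in> \<H>" "C = h <# H"
    using assms by (auto simp: left_cosets_def)
  then have "g <# C = (g \<otimes> h) <# H"
    using assms subgroups by (simp add: lcos_m_assoc subgroup.subset)
  then show ?thesis using hH assms by (auto simp: left_cosets_def)
qed

lemma translate_adj:
  assumes g: "g \<in> carrier K" and "(p, q) \<in> R" shows "(translate g p, translate g q) \<in> R"
proof (cases p; cases q)
  fix x y assume pq: "p = Inl x" "q = Inl y"
  then obtain s where s: "s \<in> S" "y = x \<otimes> s \<or> y = x \<otimes> inv s" "x \<in> carrier K" "y \<in> carrier K"
    using assms by (auto simp: adj_simps)
  have "s \<in> carrier K" using s S by blast
  then have "g \<otimes> y = g \<otimes> x \<otimes> s \<or> g \<otimes> y = g \<otimes> x \<otimes> inv s"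
    using s g by (auto simp: m_assoc)
  then show ?thesis using s g pq by (auto simp: adj_simps)
next
  fix x C assume "p = Inl x" "q = Inr C"
  then show ?thesis using assms left_coset_translate by (auto simp: adj_simps l_coset_def)
next
  fix x C assume "p = Inr C" "q = Inl x"
  then show ?thesis using assms left_coset_translate by (auto simp: adj_simps l_coset_def)
next
  fix C D assume "p = Inr C" "q = Inr D"
  then show ?thesis using assms by (auto simp: adj_simps)
qed

lemma translate_relpow:
  "g \<in> carrier K \<Longrightarrow> (p, q) \<in> R ^^ k \<Longrightarrow> (translate g p, translate g q) \<in> R ^^ k"
  using relpow_map[of R "translate g"] translate_adj by blast

abbreviation dist_R :: "'a \<Rightarrow> 'a \<Rightarrow> nat" where
  "dist_R x y \<equiv> graph_dist R (Inl x) (Inl y)"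

lemma dist_translate:
  assumes "g \<in> carrier K" "x \<in> carrier K" "y \<in> carrier K"
  shows "dist_R (g \<otimes> x) (g \<otimes> y) = dist_R x y"
proof -
  have "(Inl x, Inl y) \<in> R ^^ k \<longleftrightarrow> (Inl (g \<otimes> x), Inl (g \<otimes> y)) \<in> R ^^ k" for k
    using translate_relpow[of g "Inl x" "Inl y" k] assms
      translate_relpow[of "inv g" "Inl (g \<otimes> x)" "Inl (g \<otimes> y)" k]
    by (auto simp: m_assoc[symmetric])
  then show ?thesis by (simp add: graph_dist_def)
qed

text \<open>Bounds distances from below by a function \<open>L\<close>. Crossing a coset takes two
  edges, so an increase of 2 is affordable. At a cone point the invariant keeps the value of the
  element from which it was entered, one step earlier, hence \<open>k - 1\<close>.\<close>

lemma length_le_path: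
  fixes L :: "'a \<Rightarrow> real"
  assumes one: "L \<one> \<le> 0"
    and gen: "\<And>g s. g \<in> carrier K \<Longrightarrow> s \<in> S \<Longrightarrow> L (g \<otimes> s) \<le> L g + 1 \<and> L (g \<otimes> inv s) \<le> L g + 1"
    and sub: "\<And>g H h. g \<in> carrier K \<Longrightarrow> H \<in> \<H> \<Longrightarrow> h \<in> H \<Longrightarrow> L (g \<otimes> h) \<le> L g + 2"
    and path: "(Inl \<one>, p) \<in> R ^^ k"
  shows "case p of Inl g \<Rightarrow> g \<in> carrier K \<and> L g \<le> k
    | Inr C \<Rightarrow> C \<in> left_cosets K \<H> \<and> (\<exists>g\<in>C. L g \<le> real k - 1)"
  using path
proof (induction k arbitrary: p)
  case 0
  then show ?case using one by auto
next
  case (Suc k)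
  then obtain q where q: "(Inl \<one>, q) \<in> R ^^ k" "(q, p) \<in> R" by auto
  show ?case
  proof (cases q)
    case (Inl g)
    then have g: "g \<in> carrier K" "L g \<le> k" using Suc.IH[OF q(1)] by auto
    show ?thesis
    proof (cases p)
      case (Inl h)
      then show ?thesis using g q(2) gen[OF g(1)] \<open>q = Inl g\<close> by (fastforce simp: adj_simps)
    next
      case (Inr C)
      then show ?thesis using g q(2) \<open>q = Inl g\<close> by (auto simp: adj_simps)
    qed
  next
    case (Inr C)
    then obtain g where g: "C \<in> left_cosets K \<H>" "g \<in> C" "L g \<le> real k - 1"
      using Suc.IH[OF q(1)] by auto
    then obtain h where h: "p = Inl h" "h \<in> C" using q(2) Inr by (cases p) (auto simp: adj_simps)
    then obtain H a where "H \<in> \<H>" "a \<in> H" "h = g \<otimes> a" using coset_quotient[OF g(1,2)] by blast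
    then show ?thesis using sub[of g H a] g h coset_subset by fastforce
  qed
qed

lemma Inr_near: "Inr C \<in> Vs \<Longrightarrow> \<exists>x\<in>carrier K. (Inr C, Inl x) \<in> R"
  using coset_nonempty coset_subset by (fastforce simp: coned_off_verts_def adj_simps)

end

section \<open>A flat is not hyperbolic\<close>

text \<open>\<open>four\<close> bounds the sum of the diagonals of a parallelogram by twice its
  longer side. For a stable norm this is exact; applied to two axis vectors of nearly equal length,
  and again to the diagonals so obtained, it forces one diagonal to be short, against linear
  growth.\<close>

lemma hyperbolic_no_flat:
  fixes \<phi> :: "int \<Rightarrow> int \<Rightarrow> real"
  assumes \<epsilon>: "\<epsilon> > 0"
    and sub: "\<And>i j i' j'. \<phi> (i + i') (j + j') \<le> \<phi> i j + \<phi> i' j'"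
    and ge: "\<And>i j. \<epsilon> * real_of_int \<bar>i\<bar> \<le> \<phi> i j" "\<And>i j. \<epsilon> * real_of_int \<bar>j\<bar> \<le> \<phi> i j"
    and four: "\<And>i j i' j'. \<phi> (i + i') (j + j') + \<phi> (i' - i) (j' - j) \<le> max (2 * \<phi> i j) (2 * \<phi> i'
      j') + c"
  shows False
proof -
  \<comment> \<open>Passing to the stable norm \<open>N\<close> removes the additive error of the four-point condition.\<close>
  define a where "a k i j = \<phi> (2^k * i) (2^k * j) / 2^k" for k i j
  define N where "N i j = lim (\<lambda>k. a k i j)" for i j
  have nonneg: "0 \<le> \<phi> i j" for i j using ge(1)[of i j] \<epsilon>
    by (smt (verit) mult_nonneg_nonneg of_int_0_le_iff abs_ge_zero)
  have lim: "(\<lambda>k. a k i j) \<longlonglongrightarrow> N i j" for i j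
  proof -
    \<comment> \<open>Subadditivity applied to a vector and itself: along powers of two the
      normalised values decrease, so convergence follows from monotonicity.\<close>
    have "a (Suc k) i j \<le> a k i j" for k
      using sub[of "2^k * i" "2^k * i" "2^k * j" "2^k * j"] by (simp add: a_def field_simps)
    then have "decseq (\<lambda>k. a k i j)" by (rule decseq_SucI)
    then show ?thesis unfolding N_def
      using nonneg decseq_convergent[of "\<lambda>k. a k i j" 0]
      by (metis a_def divide_nonneg_nonneg limI zero_le_numeral zero_le_power)
  qed
  have N_ge: "\<epsilon> * real_of_int \<bar>i\<bar> \<le> N i j" "\<epsilon> * real_of_int \<bar>j\<bar> \<le> N i j" for i j
  proof -
    have "\<epsilon> * real_of_int \<bar>i\<bar> \<le> a k i j" "\<epsilon> * real_of_int \<bar>j\<bar> \<le> a k i j" for k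
      using ge(1)[where i = "2^k * i" and j = "2^k * j"] ge(2)[where i = "2^k * i"
        and j = "2^k * j"]
      by (simp_all add: a_def abs_mult field_simps)
    then show "\<epsilon> * real_of_int \<bar>i\<bar> \<le> N i j" "\<epsilon> * real_of_int \<bar>j\<bar> \<le> N i j"
      by (auto intro!: LIMSEQ_le_const[OF lim])
  qed
  have N_sub: "N (i + i') (j + j') \<le> N i j + N i' j'" for i j i' j'
  proof (rule LIMSEQ_le[OF lim tendsto_add[OF lim lim]])
    have "a k (i + i') (j + j') \<le> a k i j + a k i' j'" for k
      using sub[of "2^k * i" "2^k * i'" "2^k * j" "2^k * j'"]
      by (simp add: a_def field_simps)
    then show "\<exists>n0. \<forall>k\<ge>n0. a k (i + i') (j + j') \<le> a k i j + a k i' j'" by blast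
  qed
  have N_double: "N (2 * i) (2 * j) = 2 * N i j" for i j
  proof (rule LIMSEQ_unique)
    show "(\<lambda>k. a k (2 * i) (2 * j)) \<longlonglongrightarrow> N (2 * i) (2 * j)" by (rule lim)
    have "a k (2 * i) (2 * j) = 2 * a (Suc k) i j" for k by (simp add: a_def field_simps)
    then show "(\<lambda>k. a k (2 * i) (2 * j)) \<longlonglongrightarrow> 2 * N i j"
      using tendsto_mult[OF tendsto_const[of 2] LIMSEQ_Suc[OF lim[of i j]]] by simp
  qed
  have N_four: "N (i + i') (j + j') + N (i' - i) (j' - j) \<le> max (2 * N i j) (2 * N i' j')"
    for i j i' j'
  proof (rule LIMSEQ_le)
    show "(\<lambda>k. a k (i + i') (j + j') + a k (i' - i) (j' - j)) \<longlonglongrightarrow> N (i + i') (j + j') +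
      N (i' - i) (j' - j)"
      by (intro tendsto_add lim)
    have "(\<lambda>k. c / 2 ^ k) \<longlonglongrightarrow> 0" by (rule LIMSEQ_divide_realpow_zero) simp
    then have "(\<lambda>k. max (2 * a k i j) (2 * a k i' j') + c / 2^k) \<longlonglongrightarrow> max (2 * N i j) (2 * N i' j') +
      0"
      by (intro tendsto_add tendsto_max tendsto_mult tendsto_const lim)
    then show "(\<lambda>k. max (2 * a k i j) (2 * a k i' j') + c / 2^k) \<longlonglongrightarrow> max (2 * N i j) (2 * N i' j')"
      by simp
    have "a k (i + i') (j + j') + a k (i' - i) (j' - j) \<le> max (2 * a k i j) (2 * a k i' j') +
      c / 2^k" for k
    proof -
      have "(\<phi> (2^k * (i + i')) (2^k * (j + j')) + \<phi> (2^k * (i' - i)) (2^k * (j' - j))) / 2^k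
        \<le> (max (2 * \<phi> (2^k * i) (2^k * j)) (2 * \<phi> (2^k * i') (2^k * j')) + c) / 2^k"
        using four[of "2^k * i" "2^k * i'" "2^k * j" "2^k * j'"]
        by (intro divide_right_mono) (simp_all add: algebra_simps)
      also have "\<dots> = max (2 * a k i j) (2 * a k i' j') + c / 2^k"
        by (simp add: a_def add_divide_distrib max_divide_distrib_right)
      finally show ?thesis by (simp add: a_def add_divide_distrib)
    qed
    then show "\<exists>n0. \<forall>k\<ge>n0. a k (i + i') (j + j') + a k (i' - i) (j' - j) \<le>
      max (2 * a k i j) (2 * a k i' j') + c / 2^k"
      by blast
  qed
  \<comment> \<open>\<open>i\<close> is so large that one unit step along the second axis, the
    precision of the comparison below, is smaller than \<open>\<epsilon> * i\<close>.\<close>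
  obtain i :: nat where i: "N 0 1 < \<epsilon> * real i" "i > 0"
  proof -
    obtain i :: nat where "max 1 (N 0 1 / \<epsilon>) < real i" using reals_Archimedean2 by blast
    then show thesis using that[of i] \<epsilon> by (auto simp: field_simps)
  qed
  obtain m :: nat where "N (int i) 0 / \<epsilon> < real m" using reals_Archimedean2 by blast
  then have ex: "N (int i) 0 \<le> N 0 (int m)"
    using N_ge(2)[where i = 0 and j = "int m"] \<epsilon> by (simp add: field_simps)
  \<comment> \<open>The least multiple of the second axis vector that is at least as long as
    \<open>(i, 0)\<close>; by minimality the two lengths differ by less than
    \<open>N 0 1\<close>.\<close>
  define j where "j = (LEAST m. N (int i) 0 \<le> N 0 (int m))"
  have j: "N (int i) 0 \<le> N 0 (int j)" unfolding j_def by (rule LeastI) (rule ex)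
  have N0: "N 0 0 = 0" using N_double[of 0 0] by simp
  have "0 < N (int i) 0" using N_ge(1)[where i = "int i" and j = 0] i \<epsilon> 
    by (smt (verit) mult_pos_pos of_int_of_nat_eq of_nat_0_less_iff of_int_abs abs_of_nat)
  then have "j \<noteq> 0" using j N0 by (metis less_le_not_le of_nat_0)
  then obtain j' where j': "j = Suc j'" using not0_implies_Suc by blast
  have "N 0 (int j') < N (int i) 0"
    using not_less_Least[of j' "\<lambda>m. N (int i) 0 \<le> N 0 (int m)"] j' by (simp add: j_def)
  then have close: "N 0 (int j) < N (int i) 0 + N 0 1"
    using N_sub[of 0 0 "int j'" 1] j' by (simp add: add.commute)
  have 1: "N (int i) (int j) + N (- int i) (int j) \<le> 2 * N 0 (int j)"
    using N_four[of "int i" 0 0 "int j"] j by simp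
  have 2: "N 0 (int j) + N (int i) 0 \<le> max (N (int i) (int j)) (N (- int i) (int j))"
    using N_four[of "- int i" "int i" "int j" "int j"] N_double[of 0 "int j"] N_double[of "int i" 0]
    by (simp add: max_mult_distrib_left[symmetric])
  have "\<epsilon> * real i \<le> N (int i) (int j)" "\<epsilon> * real i \<le> N (- int i) (int j)"
    using N_ge(1)[where i = "int i" and j = "int j"] N_ge(1)[where i = "- int i" and j = "int j"]
      by simp_all
  \<comment> \<open>By \<open>1\<close> and \<open>2\<close> the smaller diagonal is at most
    \<open>N 0 j - N i 0\<close>, hence below \<open>N 0 1\<close>; but both diagonals are at least
    \<open>\<epsilon> * i\<close>.\<close>
  with 1 2 close i show False by (auto simp: max_def split: if_splits)
qed

section \<open>Weak hyperbolicity of graph products\<close>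

context graph_of_groups begin

lemma letter_carrier: "v \<in> V \<Longrightarrow> g \<in> carrier (G v) \<Longrightarrow> cls [(v, g)] \<in> carrier GP"
  by (intro cls_carrier) simp

lemma vertex_subgroup_cls: "vertex_subgroup V E G v = (\<lambda>g. cls [(v, g)]) ` carrier (G v)"
  by (simp add: vertex_subgroup_def gp_incl_cls)

lemma subgroup_vertex: "v \<in> V \<Longrightarrow> subgroup (vertex_subgroup V E G v) GP"
  by (simp add: vertex_subgroup_subgroup grp)

lemma cls_inv_letter:
  "v \<in> V \<Longrightarrow> g \<in> carrier (G v) \<Longrightarrow> cls [(v, inv\<^bsub>G v\<^esub> g)] = inv\<^bsub>GP\<^esub> cls [(v, g)]"
  using cls_inv_word[of "[(v, g)]"] by (simp add: inv_word_def inv_letter_def)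

lemma cls_letter_mult:
  "v \<in> V \<Longrightarrow> g \<in> carrier (G v) \<Longrightarrow> h \<in> carrier (G v) \<Longrightarrow>
    cls [(v, g \<otimes>\<^bsub>G v\<^esub> h)] = cls [(v, g)] \<otimes>\<^bsub>GP\<^esub> cls [(v, h)]"
  using cls_mult_letter[of v g h] cls_append[of "[(v, g)]" "[(v, h)]"] by simp

lemma generate_letters:
  assumes T: "\<And>v. v \<in> V \<Longrightarrow> generate (G v) (T v) = carrier (G v) \<and> T v \<subseteq> carrier (G v)"
  defines "S \<equiv> \<Union>v\<in>V. (\<lambda>s. cls [(v, s)]) ` T v"
  shows "generate GP S = carrier GP"
proof
  have S: "S \<subseteq> carrier GP" unfolding S_def using T letter_carrier by blast
  then show "generate GP S \<subseteq> carrier GP" by (rule GP.generate_incl)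
  have letter: "cls [(v, g)] \<in> generate GP S" if v: "v \<in> V" and g: "g \<in> generate (G v) (T v)"
    for v g
    using g
  proof (induction rule: generate.induct)
    case one
    show ?case using cls_one_letter[OF v] by (simp add: generate.one)
  next
    case (incl h)
    then show ?case unfolding S_def using v by (intro generate.incl) blast
  next
    case (inv h)
    then have "cls [(v, h)] \<in> S" "h \<in> carrier (G v)" unfolding S_def using v T by blast+
    then show ?case using cls_inv_letter[OF v] generate.inv by metis
  next
    case (eng g h)
    then have "g \<in> carrier (G v)" "h \<in> carrier (G v)" using T[OF v] by auto
    then show ?case using cls_letter_mult[OF v] eng generate.eng by metis
  qed
  show "carrier GP \<subseteq> generate GP S"
  proof
    fix x assume "x \<in> carrier GP"
    then obtain w where w: "w \<in> fp_words V G" "x = cls w" by (rule cls_cases)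
    have "cls w \<in> generate GP S" using w(1)
    proof (induction w)
      case Nil
      show ?case by (simp add: cls_Nil generate.one)
    next
      case (Cons l w)
      obtain v g where l: "l = (v, g)" by force
      then have "v \<in> V" "g \<in> generate (G v) (T v)" "w \<in> fp_words V G" using Cons.prems T by auto
      then show ?case
        using Cons letter l cls_Cons[of v g w] generate.eng by fastforce
    qed
    then show "x \<in> generate GP S" using w by simp
  qed
qed

theorem square_free_weakly_hyperbolic:
  assumes fin: "finite V" and fg: "\<And>v. v \<in> V \<Longrightarrow> finitely_generated_group (G v)"
    and no_square: "\<And>a b c d. \<lbrakk>adj a b; adj b c; adj c d; adj d a; a \<noteq> c; b \<noteq> d\<rbrakk> \<Longrightarrow>
      adj a c \<or> adj b d"
  shows "weakly_hyperbolic GP (vertex_subgroup V E G ` V)"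
proof -
  obtain T where T: "\<And>v. v \<in> V \<Longrightarrow> finite_generating_set (G v) (T v)"
    using fg unfolding finitely_generated_group_def by metis
  \<comment> \<open>A generator is an edge of the coned-off graph, any other element of a vertex group
    costs a detour through a cone point; so distances between group elements are exactly weighted lengths.\<close>
  define wt where "wt l = (if snd l \<in> T (fst l) \<or> inv\<^bsub>G (fst l)\<^esub> snd l \<in> T (fst l) then 1 else 2
    :: nat)" for l
  have "wt (inv_letter l) = wt l" if "fst l \<in> V" "snd l \<in> carrier (G (fst l))" for l
    using that by (auto simp: wt_def inv_letter_def grp group.inv_inv)
  then interpret W: square_free_graph_of_groups V E G wt
    by unfold_locales (use fin no_square in \<open>auto simp: wt_def\<close>)
  define S where "S = (\<Union>v\<in>V. (\<lambda>s. cls [(v, s)]) ` T v)"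
  have TC: "T v \<subseteq> carrier (G v)" "finite (T v)" "generate (G v) (T v) = carrier (G v)" if "v \<in> V"
    for v
    using T[OF that] by (simp_all add: finite_generating_set_def)
  have S: "S \<subseteq> carrier GP" unfolding S_def using TC letter_carrier by blast
  have "finite S" unfolding S_def using fin TC by blast
  moreover have "generate GP S = carrier GP" unfolding S_def
    by (rule generate_letters) (use TC in blast)
  ultimately have fgs: "finite_generating_set GP S" using S by (simp add: finite_generating_set_def)
  let ?H = "vertex_subgroup V E G ` V"
  interpret C: coned_off GP S ?H
    by (intro coned_off.intro coned_off_axioms.intro GP.is_group S) (use subgroup_vertex in blast)
  have path: "(Inl x, Inl (x \<otimes>\<^bsub>GP\<^esub> cls w)) \<in> C.R ^^ W.wlen w"
    if "w \<in> fp_words V G" "x \<in> carrier GP" for w x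
    using that
  proof (induction w arbitrary: x)
    case Nil
    then show ?case by (simp add: cls_Nil)
  next
    case (Cons l w)
    obtain v g where l: "l = (v, g)" by force
    have vg: "v \<in> V" "g \<in> carrier (G v)" "w \<in> fp_words V G" using Cons.prems l by auto
    let ?y = "x \<otimes>\<^bsub>GP\<^esub> cls [(v, g)]"
    have y: "?y \<in> carrier GP" using Cons.prems letter_carrier vg by simp
    have "(Inl x, Inl ?y) \<in> C.R ^^ wt l"
    proof (cases "g \<in> T v \<or> inv\<^bsub>G v\<^esub> g \<in> T v")
      case True
      then have "wt l = 1" by (simp add: wt_def l)
      have inv: "inv\<^bsub>GP\<^esub> cls [(v, inv\<^bsub>G v\<^esub> g)] = cls [(v, g)]"
        using vg cls_inv_letter[of v "inv\<^bsub>G v\<^esub> g"] grp[OF vg(1)]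
          by (simp add: group.inv_closed group.inv_inv)
      from True have "cls [(v, g)] \<in> S \<or> cls [(v, inv\<^bsub>G v\<^esub> g)] \<in> S"
        unfolding S_def using vg by blast
      then have "\<exists>s\<in>S. ?y = x \<otimes>\<^bsub>GP\<^esub> s \<or> ?y = x \<otimes>\<^bsub>GP\<^esub> inv\<^bsub>GP\<^esub> s"
        using inv by metis
      then have "(Inl x, Inl ?y) \<in> C.R" using Cons.prems y by (simp add: C.adj_simps)
      then show ?thesis using \<open>wt l = 1\<close> by simp
    next
      case False
      let ?C = "x <#\<^bsub>GP\<^esub> vertex_subgroup V E G v"
      have "?C \<in> left_cosets GP ?H" using Cons.prems vg by (auto simp: left_cosets_def)
      moreover have "cls [(v, \<one>\<^bsub>G v\<^esub>)] \<in> vertex_subgroup V E G v"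
        "cls [(v, g)] \<in> vertex_subgroup V E G v"
        using vg grp[OF vg(1)] by (auto simp: vertex_subgroup_cls group.is_monoid)
      then have "x \<otimes>\<^bsub>GP\<^esub> cls [(v, \<one>\<^bsub>G v\<^esub>)] \<in> ?C" "?y \<in> ?C"
        by (auto simp: l_coset_def)
      then have "x \<in> ?C" "?y \<in> ?C" using cls_one_letter vg Cons.prems by simp_all
      ultimately have "(Inl x, Inr ?C) \<in> C.R" "(Inr ?C, Inl ?y) \<in> C.R"
        by (simp_all add: C.adj_simps)
      then have "(Inl x, Inl ?y) \<in> C.R ^^ 2" by (auto simp: numeral_2_eq_2)
      then show ?thesis using False by (simp add: wt_def l)
    qed
    moreover have "(Inl ?y, Inl (?y \<otimes>\<^bsub>GP\<^esub> cls w)) \<in> C.R ^^ W.wlen w"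
      using Cons.IH[OF vg(3) y] .
    moreover have "?y \<otimes>\<^bsub>GP\<^esub> cls w = x \<otimes>\<^bsub>GP\<^esub> cls (l # w)"
      using vg Cons.prems l cls_Cons[of v g w] letter_carrier cls_carrier by (simp add: GP.m_assoc)
    ultimately show ?case by (auto simp: relpow_add)
  qed
  have ex_path: "(Inl x, Inl y) \<in> C.R ^^ W.Len (inv\<^bsub>GP\<^esub> x \<otimes>\<^bsub>GP\<^esub> y)"
    if "x \<in> carrier GP" "y \<in> carrier GP" for x y
  proof -
    have "inv\<^bsub>GP\<^esub> x \<otimes>\<^bsub>GP\<^esub> y \<in> carrier GP" using that by simp
    then obtain w where w: "reduced w" "inv\<^bsub>GP\<^esub> x \<otimes>\<^bsub>GP\<^esub> y = cls w"
      by (rule ex_reduced)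
    have "x \<otimes>\<^bsub>GP\<^esub> cls w = y" using that by (simp add: w(2)[symmetric] GP.m_assoc[symmetric])
    then show ?thesis using path[of w x] that w W.Len_reduced[OF w(1)] reduced_words by auto
  qed
  have dist: "C.dist_R x y = W.Len (inv\<^bsub>GP\<^esub> x \<otimes>\<^bsub>GP\<^esub> y)"
    if xy: "x \<in> carrier GP" "y \<in> carrier GP" for x y
  proof (rule antisym)
    show "C.dist_R x y \<le> W.Len (inv\<^bsub>GP\<^esub> x \<otimes>\<^bsub>GP\<^esub> y)"
      by (intro graph_dist_le ex_path xy)
    have "(Inl x, Inl y) \<in> C.R\<^sup>*" using ex_path[OF xy] by (rule relpow_imp_rtrancl)
    then have "(Inl x, Inl y) \<in> C.R ^^ C.dist_R x y" by (rule relpow_graph_dist)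
    from C.translate_relpow[OF GP.inv_closed[OF xy(1)] this]
    have p: "(Inl \<one>\<^bsub>GP\<^esub>, Inl (inv\<^bsub>GP\<^esub> x \<otimes>\<^bsub>GP\<^esub> y)) \<in> C.R ^^ C.dist_R x y" using xy by simp
    \<comment> \<open>Lower bound on the distance: \<open>Len\<close> grows by at most 1 along a
      generator, whose letter has weight 1, and by at most 2 across a coset, which takes two
      edges.\<close>
    have "real (W.Len (g \<otimes>\<^bsub>GP\<^esub> s)) \<le> real (W.Len g) + 1 \<and>
        real (W.Len (g \<otimes>\<^bsub>GP\<^esub> inv\<^bsub>GP\<^esub> s)) \<le> real (W.Len g) + 1"
      if "g \<in> carrier GP" "s \<in> S" for g s
    proof -
      obtain v t where t: "v \<in> V" "t \<in> T v" "s = cls [(v, t)]" using \<open>s \<in> S\<close> unfolding S_def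
        by blast
      then have "W.Len s \<le> 1"
        using W.Len_cls_le[of "[(v, t)]"] TC by (auto simp: wt_def)
      moreover have "s \<in> carrier GP" using S that by blast
      ultimately show ?thesis
        using W.Len_mult[of g s] W.Len_mult[of g "inv\<^bsub>GP\<^esub> s"] W.Len_inv[of s] that by simp
    qed
    moreover have "real (W.Len (g \<otimes>\<^bsub>GP\<^esub> h)) \<le> real (W.Len g) + 2"
      if "g \<in> carrier GP" "H \<in> ?H" "h \<in> H" for g H h
    proof -
      obtain v t where t: "v \<in> V" "t \<in> carrier (G v)" "h = cls [(v, t)]"
        using \<open>H \<in> ?H\<close> \<open>h \<in> H\<close> by (auto simp: vertex_subgroup_cls)
      then have "W.Len h \<le> 2"
        using W.Len_cls_le[of "[(v, t)]"] W.wt_le[of "(v, t)"] by simp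
      then show ?thesis
        using W.Len_mult[of g h] letter_carrier t \<open>g \<in> carrier GP\<close> by simp
    qed
    ultimately show "W.Len (inv\<^bsub>GP\<^esub> x \<otimes>\<^bsub>GP\<^esub> y) \<le> C.dist_R x y"
      using C.length_le_path[of W.Len, OF _ _ _ p] by (simp add: W.Len_one)
  qed
  let ?d = "\<lambda>p q. real (graph_dist C.R p q)"
  have near: "\<exists>x\<in>carrier GP. (p, Inl x) \<in> C.R\<^sup>* \<and> ?d p (Inl x) \<le> 1" if "p \<in> C.Vs" for p
  proof (cases p)
    case (Inl x)
    then show ?thesis using that by (intro bexI[of _ x]) (auto simp: coned_off_verts_def)
  next
    case (Inr D)
    then obtain x where x: "x \<in> carrier GP" "(p, Inl x) \<in> C.R" using C.Inr_near \<open>p \<in> C.Vs\<close> by blast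
    then have "graph_dist C.R p (Inl x) \<le> 1" by (intro graph_dist_le) simp
    then show ?thesis using x by (intro bexI[of _ x]) auto
  qed
  have conn: "(p, q) \<in> C.R\<^sup>*" if "p \<in> C.Vs" "q \<in> C.Vs" for p q
  proof -
    obtain x y where xy: "x \<in> carrier GP" "(p, Inl x) \<in> C.R\<^sup>*" "y \<in> carrier GP" "(q, Inl y) \<in> C.R\<^sup>*"
      using near[OF \<open>p \<in> C.Vs\<close>] near[OF \<open>q \<in> C.Vs\<close>] by blast
    have "(Inl y, q) \<in> C.R\<^sup>*" using xy(4) C.sym_R by (meson sym_rtrancl symD)
    moreover have "(Inl x, Inl y) \<in> C.R\<^sup>*" using ex_path[OF xy(1,3)] by (rule relpow_imp_rtrancl)
    ultimately show ?thesis using xy(2) by (meson rtrancl_trans)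
  qed
  have "gromov_hyperbolic (Inl ` carrier GP) ?d"
    unfolding gromov_hyperbolic_def
  \<comment> \<open>Half of the constant in \<open>Len_four_point\<close>, which is stated for twice
    the Gromov product.\<close>
  proof (rule exI[of _ "4 * real (card V)"], intro ballI)
    fix p q r s :: "('v \<times> 'a) list set set + ('v \<times> 'a) list set set set"
    assume "p \<in> Inl ` carrier GP" "q \<in> Inl ` carrier GP" "r \<in> Inl ` carrier GP"
      "s \<in> Inl ` carrier GP"
    then obtain w x y z where c: "w \<in> carrier GP" "x \<in> carrier GP" "y \<in> carrier GP" "z \<in> carrier GP"
      and p: "p = Inl w" "q = Inl x" "r = Inl y" "s = Inl z" by blast
    \<comment> \<open>Translation by the inverse of the base point \<open>w\<close> reduces
      everything to Gromov products at the identity.\<close>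
    define u where "u x = inv\<^bsub>GP\<^esub> w \<otimes>\<^bsub>GP\<^esub> x" for x
    have u: "u x \<in> carrier GP" if "x \<in> carrier GP" for x using that c by (simp add: u_def)
    have gp: "gromov_product ?d (Inl w) (Inl x) (Inl y) =
        (real (W.Len (u x)) + real (W.Len (u y)) - real (W.Len (inv\<^bsub>GP\<^esub> u x \<otimes>\<^bsub>GP\<^esub> u y))) / 2"
      if "x \<in> carrier GP" "y \<in> carrier GP" for x y
    proof -
      have 1: "C.dist_R x w = W.Len (u x)" if "x \<in> carrier GP" for x
        using dist[OF c(1) that] graph_dist_sym[OF C.sym_R] u_def by metis
      have "inv\<^bsub>GP\<^esub> u x \<otimes>\<^bsub>GP\<^esub> u y = inv\<^bsub>GP\<^esub> x \<otimes>\<^bsub>GP\<^esub> (w \<otimes>\<^bsub>GP\<^esub> (inv\<^bsub>GP\<^esub> w \<otimes>\<^bsub>GP\<^esub> y))"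
        using that c by (simp add: u_def GP.inv_mult_group GP.m_assoc)
      also have "w \<otimes>\<^bsub>GP\<^esub> (inv\<^bsub>GP\<^esub> w \<otimes>\<^bsub>GP\<^esub> y) = y"
        using that c by (simp add: GP.m_assoc[symmetric])
      finally show ?thesis using that by (simp add: gromov_product_def dist 1)
    qed
    have half: "min (p / 2) (q / 2) - 4 * n \<le> r / 2" if "min p q - 8 * n \<le> r" for p q r n :: real
      using that by (auto simp: min_def split: if_splits)
    show "gromov_product ?d p q s \<ge> min (gromov_product ?d p q r) (gromov_product ?d p r s) - 4 *
      real (card V)"
      unfolding p gp[OF c(2,3)] gp[OF c(3,4)] gp[OF c(2,4)]
      by (rule half) (use W.Len_four_point[OF u[OF c(2)] u[OF c(3)] u[OF c(4)]] in simp)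
  qed
  moreover have "?d p q = ?d q p" for p q using graph_dist_sym[OF C.sym_R] by metis
  moreover have "?d p r \<le> ?d p q + ?d q r" if "p \<in> C.Vs" "q \<in> C.Vs" "r \<in> C.Vs" for p q r
    using graph_dist_triangle[OF conn[OF that(1,2)] conn[OF that(2,3)]] by linarith
  moreover have "\<exists>u\<in>Inl ` carrier GP. ?d p u \<le> 1" if "p \<in> C.Vs" for p using near[OF that] by blast
  moreover have "Inl ` carrier GP \<subseteq> C.Vs" by (auto simp: coned_off_verts_def)
  ultimately have "gromov_hyperbolic C.Vs ?d"
    using gromov_hyperbolic_dense[of C.Vs ?d "Inl ` carrier GP"] by simp
  with conn fgs show ?thesis
    unfolding weakly_hyperbolic_def hyperbolic_graph_def by blast
qed

section \<open>Flats from induced squares\<close>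

definition alternating :: "nat \<Rightarrow> 'v \<times> 'a \<Rightarrow> 'v \<times> 'a \<Rightarrow> ('v \<times> 'a) list" where
  "alternating n l k = concat (replicate n [l, k])"

text \<open>Over two non-adjacent vertices no swap is possible, so only the first letter is a head.
  The bound on the heads carries the induction.\<close>

lemma alternating_reduced:
  assumes "nontrivial_letter l" "nontrivial_letter k" "fst l \<noteq> fst k" "\<not> adj (fst l) (fst k)"
  shows "reduced (alternating n l k) \<and> heads (alternating n l k) \<subseteq> {fst l}"
proof (induction n)
  case (Suc n)
  have nadj: "\<not> adj (fst k) (fst l)" using assms(4) adj_sym by blast
  have k: "heads (k # alternating n l k) = {fst k}"
    using Suc nadj by (auto simp: heads_Cons simp del: head_letters.simps)
  have "alternating (Suc n) l k = l # k # alternating n l k" by (simp add: alternating_def)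
  moreover have "heads (l # k # alternating n l k) = {fst l}"
    using k assms(4) by (subst heads_Cons) auto
  moreover have "reduced (k # alternating n l k)" using Suc assms by auto
  ultimately show ?case using k assms by (simp del: head_letters.simps)
qed (simp add: alternating_def)

lemma set_alternating: "set (alternating n l k) \<subseteq> {l, k}"
  by (auto simp: alternating_def)

lemma length_alternating: "length (alternating n l k) = 2 * n"
  by (induction n) (auto simp: alternating_def)

lemma cls_alternating:
  assumes "nontrivial_letter l" "nontrivial_letter k"
  shows "cls (alternating n l k) = cls [l, k] [^]\<^bsub>GP\<^esub> n"
proof (induction n)
  case (Suc n)
  have lk: "[l, k] \<in> fp_words V G" using assms
    by (cases l; cases k) (auto simp: nontrivial_letter_def)
  then have "alternating n l k \<in> fp_words V G"
    by (induction n) (cases l; cases k; auto simp: alternating_def)+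
  with lk have W: "[l, k] \<in> fp_words V G" "alternating n l k \<in> fp_words V G" by auto
  have "cls (alternating (Suc n) l k) = cls [l, k] \<otimes>\<^bsub>GP\<^esub> cls (alternating n l k)"
    using W cls_append[OF W] by (simp add: alternating_def)
  also have "\<dots> = cls [l, k] [^]\<^bsub>GP\<^esub> Suc n"
    using Suc W GP.nat_pow_Suc2[of "cls [l, k]" n] by (simp add: cls_carrier)
  finally show ?case .
qed (simp add: alternating_def cls_Nil)

lemma int_pow_alternating:
  assumes "nontrivial_letter l" "nontrivial_letter k" "fst l \<noteq> fst k" "\<not> adj (fst l) (fst k)"
  shows "\<exists>w. reduced w \<and> fst ` set w \<subseteq> {fst l, fst k} \<and> length w = 2 * nat \<bar>i\<bar> \<and>
    cls w = cls [l, k] [^]\<^bsub>GP\<^esub> (i :: int)"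
proof (cases "i \<ge> 0")
  case True
  have "cls (alternating (nat i) l k) = cls [l, k] [^]\<^bsub>GP\<^esub> i"
    using True by (simp add: cls_alternating[OF assms(1,2)] int_pow_int[symmetric])
  then show ?thesis
    using alternating_reduced[OF assms, of "nat i"] set_alternating[of "nat i" l k] True
    by (intro exI[of _ "alternating (nat i) l k"]) (auto simp: length_alternating)
next
  case False
  \<comment> \<open>A negative power alternates the inverse letters in the opposite order.\<close>
  let ?w = "alternating (nat (- i)) (inv_letter k) (inv_letter l)"
  have nt: "nontrivial_letter (inv_letter k)" "nontrivial_letter (inv_letter l)"
    using assms nontrivial_inv_letter by auto
  have W: "[l, k] \<in> fp_words V G" using assms
    by (cases l; cases k) (auto simp: nontrivial_letter_def)
  have "cls ?w = cls (inv_word [l, k]) [^]\<^bsub>GP\<^esub> nat (- i)"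
    using cls_alternating[OF nt] by (simp add: inv_word_def)
  also have "\<dots> = inv\<^bsub>GP\<^esub> (cls [l, k] [^]\<^bsub>GP\<^esub> nat (- i))"
    using W by (simp add: cls_inv_word GP.nat_pow_inv cls_carrier)
  also have "\<dots> = cls [l, k] [^]\<^bsub>GP\<^esub> i"
    using False GP.int_pow_neg_int[OF cls_carrier[OF W], of "nat (- i)"] by simp
  finally have "cls ?w = cls [l, k] [^]\<^bsub>GP\<^esub> i" .
  moreover have "\<not> adj (fst k) (fst l)" using assms(4) adj_sym by blast
  then have "reduced ?w" using alternating_reduced[OF nt, of "nat (- i)"] assms(3) by simp
  moreover have "fst ` set ?w \<subseteq> {fst l, fst k}"
    using set_alternating[of "nat (- i)" "inv_letter k" "inv_letter l"] by auto
  ultimately show ?thesis using False by (intro exI[of _ ?w]) (auto simp: length_alternating)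
qed

text \<open>The generating set is now given instead of chosen, so the distance is only bounded
  below, by a multiple of the number of letters; therefore the constant weight 1 is used.\<close>

theorem induced_square_not_weakly_hyperbolic:
  assumes sq: "adj a b" "adj b c" "adj c d" "adj d a" "a \<noteq> c" "b \<noteq> d" "\<not> adj a c" "\<not> adj b d"
    and nontriv: "\<And>v. v \<in> V \<Longrightarrow> carrier (G v) \<noteq> {\<one>\<^bsub>G v\<^esub>}"
  shows "\<not> weakly_hyperbolic GP (vertex_subgroup V E G ` V)"
proof
  let ?H = "vertex_subgroup V E G ` V"
  assume "weakly_hyperbolic GP ?H"
  then obtain S where fgs: "finite_generating_set GP S"
    and conn: "\<And>p q. p \<in> coned_off_verts GP ?H \<Longrightarrow> q \<in> coned_off_verts GP ?H \<Longrightarrow>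
      (p, q) \<in> (coned_off_adj GP S ?H)\<^sup>*"
    and hyp: "gromov_hyperbolic (coned_off_verts GP ?H) (\<lambda>p q. real (graph_dist (coned_off_adj GP
      S ?H) p q))"
    by (auto simp: weakly_hyperbolic_def hyperbolic_graph_def)
  have S: "S \<subseteq> carrier GP" "finite S" using fgs by (simp_all add: finite_generating_set_def)
  interpret C: coned_off GP S ?H
    by (intro coned_off.intro coned_off_axioms.intro GP.is_group S) (use subgroup_vertex in blast)
  interpret W: weighted_graph_of_groups V E G "\<lambda>_. Suc 0"
    by unfold_locales auto
  have wlen: "W.wlen w = length w" for w by (induction w) auto
  \<comment> \<open>The factor by which one edge can increase the length. Inserting 1 keeps the
    maximum positive and accounts for single letters from vertex groups.\<close>
  define M where "M = Max (insert 1 (W.Len ` S))"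
  have M: "1 \<le> M" "\<And>s. s \<in> S \<Longrightarrow> W.Len s \<le> M"
    using S(2) by (auto simp: M_def)
  define f where "f g = real (C.dist_R \<one>\<^bsub>GP\<^esub> g)" for g
  have conn': "(Inl x, Inl y) \<in> C.R\<^sup>*" if "x \<in> carrier GP" "y \<in> carrier GP" for x y
    using conn that by (simp add: coned_off_verts_def)
  have Len_le: "real (W.Len g) / M \<le> f g" if g: "g \<in> carrier GP" for g
  proof -
    define L where "L g = real (W.Len g) / M" for g
    have p: "(Inl \<one>\<^bsub>GP\<^esub>, Inl g) \<in> C.R ^^ C.dist_R \<one>\<^bsub>GP\<^esub> g"
      using conn' g by (intro relpow_graph_dist) auto
    have step: "L (x \<otimes>\<^bsub>GP\<^esub> y) \<le> L x + 1" if "x \<in> carrier GP" "y \<in> carrier GP" "W.Len y \<le> M" for x y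
    proof -
      have "real (W.Len (x \<otimes>\<^bsub>GP\<^esub> y)) \<le> real (W.Len x) + M" using W.Len_mult[OF that(1,2)] that(3)
        by simp
      then have "real (W.Len (x \<otimes>\<^bsub>GP\<^esub> y)) / M \<le> (real (W.Len x) + M) / M"
        by (intro divide_right_mono) auto
      then show ?thesis using M(1) by (simp add: L_def add_divide_distrib)
    qed
    have "L (x \<otimes>\<^bsub>GP\<^esub> s) \<le> L x + 1 \<and> L (x \<otimes>\<^bsub>GP\<^esub> inv\<^bsub>GP\<^esub> s) \<le> L x + 1"
      if "x \<in> carrier GP" "s \<in> S" for x s
    proof -
      have s: "s \<in> carrier GP" "W.Len s \<le> M" using that S M by auto
      then show ?thesis using step[OF that(1) s] step[OF that(1) GP.inv_closed[OF s(1)]]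
        W.Len_inv[OF s(1)] by simp
    qed
    moreover have "L (x \<otimes>\<^bsub>GP\<^esub> h) \<le> L x + 2"
      if "x \<in> carrier GP" "H \<in> ?H" "h \<in> H" for x H h
    proof -
      obtain v t where t: "v \<in> V" "t \<in> carrier (G v)" "h = cls [(v, t)]"
        using \<open>H \<in> ?H\<close> \<open>h \<in> H\<close> by (auto simp: vertex_subgroup_cls)
      then have "W.Len h \<le> M"
        using W.Len_cls_le[of "[(v, t)]"] M(1) by simp
      then show ?thesis using step[of x h] letter_carrier t \<open>x \<in> carrier GP\<close> by force
    qed
    moreover have "L \<one>\<^bsub>GP\<^esub> \<le> 0" by (simp add: L_def W.Len_one)
    ultimately show ?thesis
      using C.length_le_path[of L, OF _ _ _ p] by (simp add: f_def L_def)
  qed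
  have dist: "real (C.dist_R x y) = f (inv\<^bsub>GP\<^esub> x \<otimes>\<^bsub>GP\<^esub> y)" if "x \<in> carrier GP" "y \<in> carrier GP"
    for x y
    using C.dist_translate[of "inv\<^bsub>GP\<^esub> x" x y] that by (simp add: f_def)
  have f_inv: "f (inv\<^bsub>GP\<^esub> x) = f x" if "x \<in> carrier GP" for x
    using dist[of x "\<one>\<^bsub>GP\<^esub>"] graph_dist_sym[OF C.sym_R, of "Inl x" "Inl \<one>\<^bsub>GP\<^esub>"] that
      by (simp add: f_def)
  have f_mult: "f (x \<otimes>\<^bsub>GP\<^esub> y) \<le> f x + f y" if "x \<in> carrier GP" "y \<in> carrier GP" for x y
  proof -
    have "real (C.dist_R \<one>\<^bsub>GP\<^esub> (x \<otimes>\<^bsub>GP\<^esub> y)) \<le> real (C.dist_R \<one>\<^bsub>GP\<^esub> x) + real (C.dist_R x (x \<otimes>\<^bsub>GP\<^esub>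
      y))"
      using graph_dist_triangle[OF conn'[of "\<one>\<^bsub>GP\<^esub>" x] conn'[of x "x \<otimes>\<^bsub>GP\<^esub> y"]] that
      by (simp flip: of_nat_add)
    also have "real (C.dist_R x (x \<otimes>\<^bsub>GP\<^esub> y)) = f y"
      using dist[of x "x \<otimes>\<^bsub>GP\<^esub> y"] that by (simp add: GP.m_assoc[symmetric])
    finally show ?thesis by (simp add: f_def)
  qed
  obtain e where e: "\<And>w x y z. w \<in> C.Vs \<Longrightarrow> x \<in> C.Vs \<Longrightarrow> y \<in> C.Vs \<Longrightarrow> z \<in> C.Vs \<Longrightarrow>
    gromov_product (\<lambda>p q. real (graph_dist C.R p q)) w x z \<ge>
    min (gromov_product (\<lambda>p q. real (graph_dist C.R p q)) w x y)
      (gromov_product (\<lambda>p q. real (graph_dist C.R p q)) w y z) - e"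
    using hyp unfolding gromov_hyperbolic_def by blast
  \<comment> \<open>The four-point condition for the parallelogram with corners at the identity,
    \<open>x\<close>, \<open>x y\<close> and \<open>y\<close>. Commutation makes opposite sides
    equally long; adding the difference of the two side lengths to their sum yields twice the
    maximum.\<close>
  have four: "f (x \<otimes>\<^bsub>GP\<^esub> y) + f (inv\<^bsub>GP\<^esub> x \<otimes>\<^bsub>GP\<^esub> y) \<le> max (2 * f x) (2 * f y) + 2 * e"
    if xy: "x \<in> carrier GP" "y \<in> carrier GP" and comm: "x \<otimes>\<^bsub>GP\<^esub> y = y \<otimes>\<^bsub>GP\<^esub> x" for x y
  proof -
    have V: "Inl g \<in> C.Vs" if "g \<in> carrier GP" for g using that by (simp add: coned_off_verts_def)
    have d: "real (C.dist_R x \<one>\<^bsub>GP\<^esub>) = f x" "real (C.dist_R y \<one>\<^bsub>GP\<^esub>) = f y"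
      "real (C.dist_R (x \<otimes>\<^bsub>GP\<^esub> y) \<one>\<^bsub>GP\<^esub>) = f (x \<otimes>\<^bsub>GP\<^esub> y)"
      using graph_dist_sym[OF C.sym_R] by (metis f_def)+
    have d': "real (C.dist_R x (x \<otimes>\<^bsub>GP\<^esub> y)) = f y"
      using dist[of x "x \<otimes>\<^bsub>GP\<^esub> y"] xy by (simp add: GP.m_assoc[symmetric])
    have "real (C.dist_R y (y \<otimes>\<^bsub>GP\<^esub> x)) = f x"
      using dist[of y "y \<otimes>\<^bsub>GP\<^esub> x"] xy by (simp add: GP.m_assoc[symmetric])
    then have d'': "real (C.dist_R (x \<otimes>\<^bsub>GP\<^esub> y) y) = f x"
      using comm graph_dist_sym[OF C.sym_R] by metis
    show ?thesis
      using e[OF V V V V, of "\<one>\<^bsub>GP\<^esub>" x "x \<otimes>\<^bsub>GP\<^esub> y" y] xy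
      unfolding gromov_product_def by (auto simp: d d' d'' dist[OF xy] min_def max_def field_simps
        split: if_splits)
  qed
  have "\<exists>g. nontrivial_letter (v, g)" if "v \<in> V" for v
  proof -
    have "\<one>\<^bsub>G v\<^esub> \<in> carrier (G v)" using grp[OF that] by (simp add: group.is_monoid)
    then obtain g where "g \<in> carrier (G v)" "g \<noteq> \<one>\<^bsub>G v\<^esub>" using nontriv[OF \<open>v \<in> V\<close>] by blast
    with that show ?thesis by (auto simp: nontrivial_letter_def)
  qed
  moreover have "a \<in> V" "b \<in> V" "c \<in> V" "d \<in> V" using sq adj_in_V by blast+
  ultimately obtain ga gb gc gd where nt: "nontrivial_letter (a, ga)" "nontrivial_letter (b, gb)"
    "nontrivial_letter (c, gc)" "nontrivial_letter (d, gd)" by metis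
  define x y where "x = cls [(a, ga), (c, gc)]" and "y = cls [(b, gb), (d, gd)]"
  have W: "[(a, ga), (c, gc)] \<in> fp_words V G" "[(b, gb), (d, gd)] \<in> fp_words V G"
    using nt by (auto simp: nontrivial_letter_def)
  have xy: "x \<in> carrier GP" "y \<in> carrier GP" using W cls_carrier by (auto simp: x_def y_def)
  have "shuffle ([(a, ga), (c, gc)] @ [(b, gb), (d, gd)]) ([(b, gb), (d, gd)] @ [(a, ga), (c, gc)])"
  proof -
    have sq': "adj a b" "adj c b" "adj a d" "adj c d" using sq adj_sym by blast+
    have "shuffle ([(a, ga), (c, gc)] @ (b, gb) # [(d, gd)]) ((b, gb) # [(a, ga), (c, gc)] @ [(d,
      gd)])"
      using sq' by (intro shuffle_move) auto
    also have "shuffle \<dots> ((b, gb) # (d, gd) # [(a, ga), (c, gc)] @ [])"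
      using sq' by (intro shuffle.Cons shuffle_move) auto
    finally show ?thesis by simp
  qed
  then have comm: "x \<otimes>\<^bsub>GP\<^esub> y = y \<otimes>\<^bsub>GP\<^esub> x"
    unfolding x_def y_def using shuffle_cls W by (metis cls_append fp_words_append)
  have comm_pow: "x [^]\<^bsub>GP\<^esub> i \<otimes>\<^bsub>GP\<^esub> y [^]\<^bsub>GP\<^esub> j = y [^]\<^bsub>GP\<^esub> j \<otimes>\<^bsub>GP\<^esub> x [^]\<^bsub>GP\<^esub> i" for i j :: int
  proof -
    have "x \<otimes>\<^bsub>GP\<^esub> z [^]\<^bsub>GP\<^esub> j = z [^]\<^bsub>GP\<^esub> j \<otimes>\<^bsub>GP\<^esub> x"
      if "x \<in> carrier GP" "z \<in> carrier GP" "x \<otimes>\<^bsub>GP\<^esub> z = z \<otimes>\<^bsub>GP\<^esub> x" for x z and j :: int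
    proof -
      have nat: "x \<otimes>\<^bsub>GP\<^esub> z [^]\<^bsub>GP\<^esub> n = z [^]\<^bsub>GP\<^esub> n \<otimes>\<^bsub>GP\<^esub> x" for n :: nat
        using GP.group_commutes_pow[of z x n] that by simp
      have inv: "x \<otimes>\<^bsub>GP\<^esub> inv\<^bsub>GP\<^esub> q = inv\<^bsub>GP\<^esub> q \<otimes>\<^bsub>GP\<^esub> x"
        if q: "q \<in> carrier GP" "x \<otimes>\<^bsub>GP\<^esub> q = q \<otimes>\<^bsub>GP\<^esub> x" for q
      proof -
        have "q \<otimes>\<^bsub>GP\<^esub> (x \<otimes>\<^bsub>GP\<^esub> inv\<^bsub>GP\<^esub> q) = x"
          using q \<open>x \<in> carrier GP\<close> by (simp add: GP.m_assoc[symmetric]) (metis GP.m_assoc GP.r_inv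
            GP.r_one GP.inv_closed)
        then show ?thesis using q \<open>x \<in> carrier GP\<close> GP.inv_solve_left[of "x \<otimes>\<^bsub>GP\<^esub> inv\<^bsub>GP\<^esub> q" q x]
          by simp
      qed
      have neg: "x \<otimes>\<^bsub>GP\<^esub> inv\<^bsub>GP\<^esub> (z [^]\<^bsub>GP\<^esub> n) = inv\<^bsub>GP\<^esub> (z [^]\<^bsub>GP\<^esub> n) \<otimes>\<^bsub>GP\<^esub> x" for n :: nat
        by (rule inv[OF GP.nat_pow_closed[OF \<open>z \<in> carrier GP\<close>] nat])
      show ?thesis unfolding int_pow_def2[of GP z j] using nat[of "nat j"] neg[of "nat (- j)"]
        by (cases "j < 0") simp_all
    qed
    then show ?thesis using xy comm GP.int_pow_closed by metis
  qed
  define p where "p i j = x [^]\<^bsub>GP\<^esub> i \<otimes>\<^bsub>GP\<^esub> y [^]\<^bsub>GP\<^esub> j" for i j :: int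
  have p: "p i j \<in> carrier GP" for i j using xy by (simp add: p_def)
  have p_add: "p (i + i') (j + j') = p i j \<otimes>\<^bsub>GP\<^esub> p i' j'" for i j i' j'
  proof -
    have "p i j \<otimes>\<^bsub>GP\<^esub> p i' j' = x [^]\<^bsub>GP\<^esub> i \<otimes>\<^bsub>GP\<^esub> (y [^]\<^bsub>GP\<^esub> j \<otimes>\<^bsub>GP\<^esub> x [^]\<^bsub>GP\<^esub> i') \<otimes>\<^bsub>GP\<^esub> y [^]\<^bsub>GP\<^esub>
      j'"
      using xy by (simp add: p_def GP.m_assoc)
    also have "\<dots> = x [^]\<^bsub>GP\<^esub> i \<otimes>\<^bsub>GP\<^esub> x [^]\<^bsub>GP\<^esub> i' \<otimes>\<^bsub>GP\<^esub> (y [^]\<^bsub>GP\<^esub> j \<otimes>\<^bsub>GP\<^esub> y [^]\<^bsub>GP\<^esub> j')"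
      using xy by (simp add: comm_pow[symmetric] GP.m_assoc)
    finally show ?thesis using xy by (simp add: p_def GP.int_pow_mult)
  qed
  have p_0: "p 0 0 = \<one>\<^bsub>GP\<^esub>" by (simp add: p_def)
  have p_diff: "p (i' - i) (j' - j) = inv\<^bsub>GP\<^esub> p i j \<otimes>\<^bsub>GP\<^esub> p i' j'" for i j i' j'
  proof -
    have "p i j \<otimes>\<^bsub>GP\<^esub> p (i' - i) (j' - j) = p i' j'" using p_add[of i "i' - i" j "j' - j"] by simp
    then show ?thesis using p by (metis GP.inv_solve_left)
  qed
  have len: "W.Len (p i j) = 2 * nat \<bar>i\<bar> + 2 * nat \<bar>j\<bar>" for i j
  proof -
    obtain u where u: "reduced u" "fst ` set u \<subseteq> {a, c}" "length u = 2 * nat \<bar>i\<bar>"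
      "cls u = x [^]\<^bsub>GP\<^esub> i"
      using int_pow_alternating[of "(a, ga)" "(c, gc)" i] nt sq by (auto simp: x_def)
    obtain w where w: "reduced w" "fst ` set w \<subseteq> {b, d}" "length w = 2 * nat \<bar>j\<bar>"
      "cls w = y [^]\<^bsub>GP\<^esub> j"
      using int_pow_alternating[of "(b, gb)" "(d, gd)" j] nt sq by (auto simp: y_def)
    have "heads (rev u) \<subseteq> {a, c}" "heads w \<subseteq> {b, d}"
      using order.trans[OF image_mono[OF head_letters_subset[of "rev u"]]]
        order.trans[OF image_mono[OF head_letters_subset[of w]]] u(2) w(2) by simp_all
    \<comment> \<open>By irreflexivity of \<open>adj\<close> along the sides the two diagonals are
      disjoint, so no letter of \<open>u\<close> can meet one of \<open>w\<close> over its own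
      vertex.\<close>
    moreover have "{a, c} \<inter> {b, d} = {}" using sq by auto
    ultimately have "heads (rev u) \<inter> heads w = {}" by (metis Int_mono subset_empty)
    then have "reduced (u @ w)" using u w by (simp add: reduced_append)
    then have "W.Len (cls (u @ w)) = length (u @ w)" using W.Len_reduced wlen by simp
    then show ?thesis using u w by (simp add: p_def cls_append reduced_words)
  qed
  show False
  proof (rule hyperbolic_no_flat[of "1 / M" "\<lambda>i j. f (p i j)" "2 * e"])
    show "1 / real M > 0" using M by simp
    show "f (p (i + i') (j + j')) \<le> f (p i j) + f (p i' j')" for i j i' j'
      unfolding p_add using p by (intro f_mult)
    have "real_of_int \<bar>i\<bar> / M \<le> f (p i j)" "real_of_int \<bar>j\<bar> / M \<le> f (p i j)" for i j
    proof -
      have "real_of_int \<bar>i\<bar> \<le> W.Len (p i j)" "real_of_int \<bar>j\<bar> \<le> W.Len (p i j)"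
        by (simp_all add: len)
      then have "real_of_int \<bar>i\<bar> / M \<le> W.Len (p i j) / M" "real_of_int \<bar>j\<bar> / M \<le> W.Len (p i j) / M"
        by (simp_all add: divide_right_mono)
      then show "real_of_int \<bar>i\<bar> / M \<le> f (p i j)" "real_of_int \<bar>j\<bar> / M \<le> f (p i j)"
        using Len_le[OF p[of i j]] by linarith+
    qed
    then show "1 / real M * real_of_int \<bar>i\<bar> \<le> f (p i j)" "1 / real M * real_of_int \<bar>j\<bar> \<le>
      f (p i j)" for i j by simp_all
    show "f (p (i + i') (j + j')) + f (p (i' - i) (j' - j)) \<le> max (2 * f (p i j)) (2 * f (p i'
      j')) + 2 * e" for i j i' j'
      using four[OF p[of i j] p[of i' j']] p_add p_diff by (metis add.commute)
  qed
qed

end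

section \<open>Random graphs\<close>

lemma set_pmf_random_graph: "set_pmf (random_graph n p) \<subseteq> Pow (all_edges {1..n})"
  by (auto simp: random_graph_def)

lemma finite_set_pmf_random_graph: "finite (set_pmf (random_graph n p))"
  by (rule finite_subset[OF set_pmf_random_graph]) (simp add: finite_all_edges)

lemma prob_random_graph:
  assumes XY: "Z \<subseteq> all_edges {1..n}" "Y \<subseteq> all_edges {1..n}" "Z \<inter> Y = {}" and p: "0 \<le> p" "p \<le> 1"
  shows "measure_pmf.prob (random_graph n p) {E. Z \<subseteq> E \<and> Y \<inter> E = {}} = p ^ card Z * (1 - p) ^ card
    Y"
proof -
  let ?A = "all_edges {1..n}"
  \<comment> \<open>The event is a box in the product space: present on \<open>Z\<close>, absent on
    \<open>Y\<close>, free elsewhere.\<close>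
  let ?B = "\<lambda>e. if e \<in> Z then {True} else if e \<in> Y then {False} else UNIV"
  have fin: "finite ?A" by (simp add: finite_all_edges)
  have "f \<in> Pi ?A ?B \<longleftrightarrow> (\<forall>e\<in>?A. (e \<in> Z \<longrightarrow> f e) \<and> (e \<in> Y \<longrightarrow> \<not> f e))" for f
    using XY(3) by (auto simp: Pi_iff split: if_splits)
  moreover have "f \<in> (\<lambda>f. {e \<in> ?A. f e}) -` {E. Z \<subseteq> E \<and> Y \<inter> E = {}} \<longleftrightarrow>
      (\<forall>e\<in>?A. (e \<in> Z \<longrightarrow> f e) \<and> (e \<in> Y \<longrightarrow> \<not> f e))" for f
    using subsetD[OF XY(1)] subsetD[OF XY(2)] by auto
  ultimately have "(\<lambda>f. {e \<in> ?A. f e}) -` {E. Z \<subseteq> E \<and> Y \<inter> E = {}} = Pi ?A ?B"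
    by (intro Set.set_eqI) simp
  then have "measure_pmf.prob (random_graph n p) {E. Z \<subseteq> E \<and> Y \<inter> E = {}} =
      measure_pmf.prob (Pi_pmf ?A False (\<lambda>_. bernoulli_pmf p)) (Pi ?A ?B)"
    by (simp add: random_graph_def)
  also have "\<dots> = (\<Prod>e\<in>?A. measure_pmf.prob (bernoulli_pmf p) (?B e))"
    by (rule measure_Pi_pmf_Pi[OF fin])
  also have "\<dots> = (\<Prod>e\<in>?A. if e \<in> Z then p else if e \<in> Y then 1 - p else 1)"
    using p by (intro prod.cong) (auto simp: measure_pmf_single)
  also have "\<dots> = (\<Prod>e\<in>Z \<union> Y. if e \<in> Z then p else if e \<in> Y then 1 - p else 1)"
    using XY by (intro prod.mono_neutral_right fin) auto
  also have "\<dots> = (\<Prod>e\<in>Z. if e \<in> Z then p else if e \<in> Y then 1 - p else 1) *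
      (\<Prod>e\<in>Y. if e \<in> Z then p else if e \<in> Y then 1 - p else 1)"
    using XY finite_subset[OF _ fin] by (intro prod.union_disjoint) auto
  also have "(\<Prod>e\<in>Z. if e \<in> Z then p else if e \<in> Y then 1 - p else 1) = (\<Prod>e\<in>Z. p)"
    by (intro prod.cong) auto
  also have "(\<Prod>e\<in>Y. if e \<in> Z then p else if e \<in> Y then 1 - p else 1) = (\<Prod>e\<in>Y. 1 - p)"
    using XY by (intro prod.cong) auto
  finally show ?thesis by simp
qed

text \<open>Separates the probability estimate for a combinatorial property \<open>P\<close> from
  the deterministic implication to \<open>Q\<close>. The implication is required only on the support
  of the random graph and for large \<open>n\<close>.\<close>

lemma asymptotically_almost_surelyI:
  assumes bad: "eventually (\<lambda>n. measure_pmf.prob (random_graph n (p n)) {E. \<not> P n E} \<le>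
    \<delta> n) sequentially"
    and \<delta>: "\<delta> \<longlonglongrightarrow> 0"
    and good: "eventually (\<lambda>n. \<forall>E. E \<subseteq> all_edges {1..n} \<longrightarrow> P n E \<longrightarrow> Q n E) sequentially"
  shows "asymptotically_almost_surely p Q"
  unfolding asymptotically_almost_surely_def
proof (rule tendsto_sandwich)
  show "(\<lambda>n. 1 - \<delta> n) \<longlonglongrightarrow> 1" using tendsto_diff[OF tendsto_const \<delta>, of 1] by simp
  show "(\<lambda>n. 1) \<longlonglongrightarrow> (1 :: real)" by simp
  show "eventually (\<lambda>n. measure_pmf.prob (random_graph n (p n)) {E. Q n E} \<le> 1) sequentially"
    by simp
  show "eventually (\<lambda>n. 1 - \<delta> n \<le> measure_pmf.prob (random_graph n (p n)) {E. Q n E}) sequentially"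
    using bad good
  proof eventually_elim
    case (elim n)
    let ?M = "random_graph n (p n)"
    have "measure_pmf.prob ?M {E. P n E} = 1 - measure_pmf.prob ?M {E. \<not> P n E}"
      using measure_pmf.prob_compl[of "{E. \<not> P n E}" ?M]
        by (simp add: Compl_eq_Diff_UNIV[symmetric] Collect_neg_eq[symmetric])
    moreover have "measure_pmf.prob ?M {E. P n E} \<le> measure_pmf.prob ?M {E. Q n E}"
      using elim(2) set_pmf_random_graph[of n "p n"]
      by (intro measure_pmf.finite_measure_mono_AE) (auto simp: AE_measure_pmf_iff)
    ultimately show ?case using elim(1) by linarith
  qed
qed

section \<open>The dense and the sparse regime\<close>

lemma complete_graph_aas:
  fixes p :: "nat \<Rightarrow> real"
  assumes p: "\<And>n. n \<ge> 1 \<Longrightarrow> 0 < p n \<and> p n < 1" and lim: "(\<lambda>n. (1 - p n) * (real n)\<^sup>2) \<longlonglongrightarrow> 0"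
    and Q: "\<And>n. Q n (all_edges {1..n})"
  shows "asymptotically_almost_surely p Q"
proof (rule asymptotically_almost_surelyI[where P = "\<lambda>n E. E = all_edges {1..n}", OF _ lim])
  show "eventually (\<lambda>n. measure_pmf.prob (random_graph n (p n)) {E. E \<noteq> all_edges {1..n}} \<le>
    (1 - p n) * (real n)\<^sup>2) sequentially"
    using eventually_ge_at_top[of 1]
  proof eventually_elim
    case (elim n)
    let ?M = "random_graph n (p n)" and ?A = "all_edges {1..n}"
    have p': "0 \<le> p n" "p n \<le> 1" using p[OF elim] by auto
    have card: "card ?A = n choose 2"
      using n_subsets[of "{1..n}" 2] by (simp add: all_edges_def)
    have "measure_pmf.prob ?M {?A} = p n ^ (n choose 2)"
      using pmf_random_graph[OF subset_refl p'] card by (simp add: measure_pmf_single)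
    \<comment> \<open>Bernoulli's inequality, which here expresses the union bound over the
      \<open>n choose 2\<close> possibly missing edges.\<close>
    moreover have "1 - real (n choose 2) * (1 - p n) \<le> p n ^ (n choose 2)"
      using Bernoulli_inequality[of "p n - 1" "n choose 2"] p' by (simp add: algebra_simps)
    moreover have "n choose 2 \<le> n ^ 2"
      using le_trans[OF div_le_dividend mult_le_mono2[of "n - 1" n n]]
      by (simp add: choose_two power2_eq_square)
    then have "real (n choose 2) * (1 - p n) \<le> (real n)\<^sup>2 * (1 - p n)"
      using p' by (intro mult_right_mono) (simp_all flip: of_nat_power)
    moreover have "measure_pmf.prob ?M {E. E \<noteq> ?A} = 1 - measure_pmf.prob ?M {?A}"
      using measure_pmf.prob_compl[of "{?A}" ?M]
        by (simp add: Compl_eq_Diff_UNIV[symmetric] Collect_neg_eq)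
    ultimately show ?case by (simp add: mult.commute)
  qed
qed (use Q in auto)

text \<open>Chords are allowed: the expected number of all 4-cycles is already at most
  \<open>(p n)^4\<close>, so absent edges need not be considered.\<close>

definition four_cycle_free :: "nat set set \<Rightarrow> bool" where
  "four_cycle_free E \<longleftrightarrow> (\<forall>a b c d. {a, b} \<in> E \<longrightarrow> {b, c} \<in> E \<longrightarrow> {c, d} \<in> E \<longrightarrow> {d, a} \<in> E \<longrightarrow> a = c \<or> b =
    d)"

lemma four_cycle_free_aas:
  fixes p :: "nat \<Rightarrow> real"
  assumes p: "\<And>n. n \<ge> 1 \<Longrightarrow> 0 < p n \<and> p n < 1" and lim: "(\<lambda>n. p n * real n) \<longlonglongrightarrow> 0"
    and Q: "\<And>n E. E \<subseteq> all_edges {1..n} \<Longrightarrow> four_cycle_free E \<Longrightarrow> Q n E"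
  shows "asymptotically_almost_surely p Q"
\<comment> \<open>Edge sets outside \<open>all_edges\<close> count as good, so that a bad one has
  its four corners in \<open>{1..n}\<close> and the union bound is finite.\<close>
proof (rule asymptotically_almost_surelyI[where P = "\<lambda>n E. E \<subseteq> all_edges {1..n} \<longrightarrow> four_cycle_free
  E" and \<delta> = "\<lambda>n. (p n * real n) ^ 4"])
  show "(\<lambda>n. (p n * real n) ^ 4) \<longlonglongrightarrow> 0"
    using tendsto_power[OF lim, of 4] by simp
  show "eventually (\<lambda>n. measure_pmf.prob (random_graph n (p n)) {E. \<not> (E \<subseteq> all_edges {1..n} \<longrightarrow>
    four_cycle_free E)} \<le> (p n * real n) ^ 4) sequentially"
    using eventually_ge_at_top[of 1]
  proof eventually_elim
    case (elim n)
    let ?M = "random_graph n (p n)" and ?A = "all_edges {1..n}"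
    have p': "0 \<le> p n" "p n \<le> 1" using p[OF elim] by auto
    define Z :: "nat \<times> nat \<times> nat \<times> nat \<Rightarrow> nat set set"
      where "Z = (\<lambda>(a, b, c, d). {{a, b}, {b, c}, {c, d}, {d, a}})"
    define T where "T = {(a, b, c, d). Z (a, b, c, d) \<subseteq> ?A \<and> a \<noteq> c \<and> b \<noteq> d}"
    have T: "T \<subseteq> {1..n} \<times> {1..n} \<times> {1..n} \<times> {1..n}"
      by (auto simp: T_def Z_def all_edges_def)
    have finT: "finite T" by (rule finite_subset[OF T]) simp
    have "card T \<le> card ({1..n} \<times> {1..n} \<times> {1..n} \<times> {1..n})" by (rule card_mono[OF _ T]) simp
    then have cardT: "card T \<le> n ^ 4" by (simp add: power4_eq_xxxx mult.assoc)
    have "measure_pmf.prob ?M {E. \<not> (E \<subseteq> ?A \<longrightarrow> four_cycle_free E)} \<le> measure_pmf.prob ?M (\<Union>t\<in>T. {E.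
      Z t \<subseteq> E})"
    proof (rule measure_pmf.finite_measure_mono)
      show "{E. \<not> (E \<subseteq> ?A \<longrightarrow> four_cycle_free E)} \<subseteq> (\<Union>t\<in>T. {E. Z t \<subseteq> E})"
      proof
        fix E assume "E \<in> {E. \<not> (E \<subseteq> ?A \<longrightarrow> four_cycle_free E)}"
        then obtain a b c d where "E \<subseteq> ?A" "{a, b} \<in> E" "{b, c} \<in> E" "{c, d} \<in> E" "{d, a} \<in> E"
          "a \<noteq> c" "b \<noteq> d"
          unfolding four_cycle_free_def by blast
        then have "(a, b, c, d) \<in> T" "E \<in> {E. Z (a, b, c, d) \<subseteq> E}" by (auto simp: T_def Z_def)
        then show "E \<in> (\<Union>t\<in>T. {E. Z t \<subseteq> E})" by blast
      qed
    qed simp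
    also have "\<dots> \<le> (\<Sum>t\<in>T. measure_pmf.prob ?M {E. Z t \<subseteq> E})"
      by (rule measure_pmf.finite_measure_subadditive_finite[OF finT]) simp
    also have "\<dots> = (\<Sum>t\<in>T. p n ^ 4)"
    proof (rule sum.cong)
      fix t assume t: "t \<in> T"
      obtain a b c d where abcd: "t = (a, b, c, d)" by (cases t)
      have "a \<noteq> b" "b \<noteq> c" "c \<noteq> d" "d \<noteq> a" "a \<noteq> c" "b \<noteq> d"
        using t by (auto simp: abcd T_def Z_def all_edges_def)
      then have "card (Z t) = 4" by (auto simp: abcd Z_def doubleton_eq_iff card_insert_if)
      moreover have "Z t \<subseteq> ?A" using t by (auto simp: T_def abcd)
      ultimately show "measure_pmf.prob ?M {E. Z t \<subseteq> E} = p n ^ 4"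
        using prob_random_graph[of "Z t" n "{}" "p n"] p' by simp
    qed simp
    also have "\<dots> = real (card T) * p n ^ 4" by simp
    also have "\<dots> \<le> real (n ^ 4) * p n ^ 4"
      using cardT p' by (intro mult_right_mono) (simp_all only: of_nat_le_iff zero_le_power)
    finally show ?case by (simp add: power_mult_distrib mult.commute)
  qed
qed (use Q in auto)

subsection \<open>Second moments\<close>

text \<open>Chebyshev's argument: if \<open>Z\<close> counts the events that occur and has mean
  \<open>\<mu>\<close>, then the probability of \<open>Z = 0\<close> times \<open>\<mu>^2\<close> is
  at most the variance of \<open>Z\<close>, hence at most \<open>\<delta> * \<mu>^2\<close>.\<close>

lemma second_moment_bound:
  fixes M :: "'x pmf" and A :: "'t \<Rightarrow> 'x set"
  assumes fin: "finite (set_pmf M)" "finite T" and pos: "card T > 0" "\<pi> > 0"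
    and single: "\<And>t. t \<in> T \<Longrightarrow> measure_pmf.prob M (A t) = \<pi>"
    and pairs: "\<And>t. t \<in> T \<Longrightarrow> (\<Sum>t'\<in>T. measure_pmf.prob M (A t \<inter> A t')) \<le> real (card T) * \<pi>\<^sup>2 * (1 +
      \<delta>)"
  shows "measure_pmf.prob M {x. \<forall>t\<in>T. x \<notin> A t} \<le> \<delta>"
proof -
  define Z where "Z x = (\<Sum>t\<in>T. indicator (A t) x :: real)" for x
  define \<mu> where "\<mu> = real (card T) * \<pi>"
  have int: "integrable (measure_pmf M) f" for f :: "'x \<Rightarrow> real"
    by (rule integrable_measure_pmf_finite[OF fin(1)])
  have EX: "measure_pmf.expectation M Z = \<mu>"
    unfolding Z_def by (subst Bochner_Integration.integral_sum) (auto simp: int single \<mu>_def)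
  have "measure_pmf.expectation M (\<lambda>x. (Z x)\<^sup>2) =
      measure_pmf.expectation M (\<lambda>x. \<Sum>t\<in>T. \<Sum>t'\<in>T. indicator (A t \<inter> A t') x)"
    by (simp add: Z_def power2_eq_square sum_product indicator_inter_arith)
  also have "\<dots> = (\<Sum>t\<in>T. \<Sum>t'\<in>T. measure_pmf.prob M (A t \<inter> A t'))"
    by (subst Bochner_Integration.integral_sum, simp add: int, intro sum.cong HOL.refl,
        subst Bochner_Integration.integral_sum) (auto simp: int)
  also have "\<dots> \<le> (\<Sum>t\<in>T. real (card T) * \<pi>\<^sup>2 * (1 + \<delta>))" by (intro sum_mono pairs)
  also have "\<dots> = \<mu>\<^sup>2 * (1 + \<delta>)" by (simp add: \<mu>_def power2_eq_square algebra_simps)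
  finally have EX2: "measure_pmf.expectation M (\<lambda>x. (Z x)\<^sup>2) \<le> \<mu>\<^sup>2 * (1 + \<delta>)" .
  have "measure_pmf.prob M {x. \<forall>t\<in>T. x \<notin> A t} * \<mu>\<^sup>2 =
      measure_pmf.expectation M (\<lambda>x. indicator {x. \<forall>t\<in>T. x \<notin> A t} x * \<mu>\<^sup>2)"
    by simp
  also have "\<dots> \<le> measure_pmf.expectation M (\<lambda>x. (Z x)\<^sup>2 - 2 * \<mu> * Z x + \<mu>\<^sup>2)"
  proof (rule integral_mono[OF int int])
    fix x
    show "indicator {x. \<forall>t\<in>T. x \<notin> A t} x * \<mu>\<^sup>2 \<le> (Z x)\<^sup>2 - 2 * \<mu> * Z x + \<mu>\<^sup>2"
    proof (cases "\<forall>t\<in>T. x \<notin> A t")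
      case True
      then have "Z x = 0" by (simp add: Z_def)
      then show ?thesis using True by simp
    next
      case False
      have "0 \<le> (Z x - \<mu>)\<^sup>2" by simp
      then show ?thesis using False by (simp add: power2_diff algebra_simps)
    qed
  qed
  also have "\<dots> = measure_pmf.expectation M (\<lambda>x. (Z x)\<^sup>2) - 2 * \<mu> * \<mu> + \<mu>\<^sup>2"
    using EX by (simp add: int)
  also have "\<dots> \<le> \<mu>\<^sup>2 * \<delta>" using EX2 by (simp add: power2_eq_square algebra_simps)
  finally show ?thesis using pos by (simp add: \<mu>_def mult.commute)
qed

subsection \<open>Induced squares\<close>

text \<open>
  We look only for squares whose four corners lie in four prescribed disjoint blocks of \<open>m\<close>
  vertices: corner \<open>x\<close> of block \<open>i\<close> is the vertex \<open>i * m + x\<close>. The role of a pair of vertices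
  (side or diagonal) then depends only on the blocks, so any two such squares are compatible.
\<close>

definition block_pair :: "nat \<Rightarrow> nat \<times> nat \<times> nat \<times> nat \<Rightarrow> nat set" where
  "block_pair m = (\<lambda>(i, j, x, y). {i * m + x, j * m + y})"

text \<open>Every pair lists the smaller block index first, also for the closing side
  \<open>(0, 3, a, d)\<close>; this gives each pair of vertices a unique description and makes
  \<open>block_pair\<close> injective.\<close>

definition sides :: "nat \<times> nat \<times> nat \<times> nat \<Rightarrow> (nat \<times> nat \<times> nat \<times> nat) set" where
  "sides = (\<lambda>(a, b, c, d). {(0, 1, a, b), (1, 2, b, c), (2, 3, c, d), (0, 3, a, d)})"

definition diagonals :: "nat \<times> nat \<times> nat \<times> nat \<Rightarrow> (nat \<times> nat \<times> nat \<times> nat) set" where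
  "diagonals = (\<lambda>(a, b, c, d). {(0, 2, a, c), (1, 3, b, d)})"

abbreviation quads :: "nat \<Rightarrow> (nat \<times> nat \<times> nat \<times> nat) set" where
  "quads m \<equiv> {1..m} \<times> {1..m} \<times> {1..m} \<times> {1..m}"

abbreviation block_pairs :: "nat \<Rightarrow> (nat \<times> nat \<times> nat \<times> nat) set" where
  "block_pairs m \<equiv> {(i, j, x, y). i < j \<and> j < 4 \<and> x \<in> {1..m} \<and> y \<in> {1..m}}"

text \<open>Coordinates start at 1, so block \<open>i\<close> is the interval from
  \<open>i * m + 1\<close> to \<open>(i + 1) * m\<close>, and blocks are ordered by their
  index.\<close>

lemma block_less: "i < j \<Longrightarrow> x \<le> m \<Longrightarrow> 1 \<le> y \<Longrightarrow> i * m + x < j * m + (y :: nat)"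
  using mult_le_mono1[of "Suc i" j m] by simp

lemma block_inject:
  assumes "i * m + x = i' * m + x'" "x \<in> {1..m}" "x' \<in> {1..m}" shows "i = i' \<and> x = (x' :: nat)"
  using assms block_less[of i i' x m x'] block_less[of i' i x' m x]
  by (cases i i' rule: linorder_cases) auto

lemma inj_on_block_pair: "inj_on (block_pair m) (block_pairs m)"
proof (rule inj_onI)
  fix s t assume "s \<in> block_pairs m" "t \<in> block_pairs m" and eq: "block_pair m s = block_pair m t"
  then obtain i j x y i' j' x' y' where st: "s = (i, j, x, y)" "t = (i', j', x', y')"
    and lt: "i < j" "i' < j'" and mem: "x \<in> {1..m}" "y \<in> {1..m}" "x' \<in> {1..m}" "y' \<in> {1..m}"
    by blast
  have "i * m + x < j * m + y" "i' * m + x' < j' * m + y'"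
    using lt mem by (auto intro!: block_less)
  then have "i * m + x = i' * m + x'" "j * m + y = j' * m + y'"
    using eq unfolding st block_pair_def by (auto simp: doubleton_eq_iff)
  then show "s = t"
    using block_inject mem unfolding st by blast
qed

lemma block_pair_edges:
  assumes "s \<in> block_pairs m" "4 * m \<le> n" shows "block_pair m s \<in> all_edges {1..n}"
proof -
  obtain i j x y where s: "s = (i, j, x, y)" "i < j" "j < 4" "x \<in> {1..m}" "y \<in> {1..m}"
    using assms(1) by blast
  have "i * m + x < j * m + y" using s by (auto intro!: block_less)
  moreover have "j * m + y \<le> n"
  proof -
    have "j * m + y \<le> Suc j * m" using s by simp
    also have "\<dots> \<le> 4 * m" using s by (intro mult_le_mono1) simp
    finally show ?thesis using assms(2) by simp
  qed
  ultimately show ?thesis using s by (auto simp: block_pair_def all_edges_def)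
qed

lemma sides_subset: "t \<in> quads m \<Longrightarrow> sides t \<subseteq> block_pairs m"
  and diagonals_subset: "t \<in> quads m \<Longrightarrow> diagonals t \<subseteq> block_pairs m"
  by (auto simp: sides_def diagonals_def)

lemma sides_diagonals_disjoint: "sides t \<inter> diagonals t' = {}"
  by (cases t; cases t') (simp add: sides_def diagonals_def)

definition square_event :: "nat \<Rightarrow> nat \<times> nat \<times> nat \<times> nat \<Rightarrow> nat set set set" where
  "square_event m t = {E. block_pair m ` sides t \<subseteq> E \<and> block_pair m ` diagonals t \<inter> E = {}}"

text \<open>Sides and diagonals use different pairs of blocks, so two squares never make
  contradictory demands and every shared pair is counted once.\<close>

lemma prob_square_events:
  assumes t: "t \<in> quads m" "t' \<in> quads m" and n: "4 * m \<le> n" and p: "0 \<le> p" "p \<le> 1"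
  shows "measure_pmf.prob (random_graph n p) (square_event m t \<inter> square_event m t') =
    p ^ card (sides t \<union> sides t') * (1 - p) ^ card (diagonals t \<union> diagonals t')"
proof -
  let ?S = "sides t \<union> sides t'" and ?D = "diagonals t \<union> diagonals t'"
  have sub: "?S \<subseteq> block_pairs m" "?D \<subseteq> block_pairs m"
    using Un_least[OF sides_subset[OF t(1)] sides_subset[OF t(2)]]
      Un_least[OF diagonals_subset[OF t(1)] diagonals_subset[OF t(2)]] .
  have "square_event m t \<inter> square_event m t' = {E. block_pair m ` ?S \<subseteq> E \<and> block_pair m ` ?D \<inter> E =
    {}}"
    unfolding square_event_def image_Un Int_Un_distrib2 by auto
  moreover have "block_pair m ` ?S \<subseteq> all_edges {1..n}"
    by (intro image_subsetI block_pair_edges[OF _ n]) (rule subsetD[OF sub(1)])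
  moreover have "block_pair m ` ?D \<subseteq> all_edges {1..n}"
    by (intro image_subsetI block_pair_edges[OF _ n]) (rule subsetD[OF sub(2)])
  moreover have "?S \<inter> ?D = {}"
    by (simp add: Int_Un_distrib Int_Un_distrib2 sides_diagonals_disjoint)
  then have "block_pair m ` ?S \<inter> block_pair m ` ?D = {}"
    using inj_on_image_Int[OF inj_on_block_pair sub] by simp
  moreover have "card (block_pair m ` ?S) = card ?S" "card (block_pair m ` ?D) = card ?D"
    by (intro card_image inj_on_subset[OF inj_on_block_pair] sub)+
  ultimately show ?thesis using prob_random_graph[of "block_pair m ` ?S" n
    "block_pair m ` ?D" p] p by simp
qed

text \<open>Because of the block indices a side can only be shared in the same position, and it is
  shared when both of its ends are; each shared side lowers \<open>4 + 4\<close> by one.\<close>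

lemma card_sides_Un:
  "card (sides (a, b, c, d) \<union> sides (a', b', c', d')) +
    (of_bool (a' = a \<and> b' = b) + of_bool (b' = b \<and> c' = c) + of_bool (c' = c \<and> d' =
      d) + of_bool (a' = a \<and> d' = d)) = 8"
  unfolding sides_def
  by (cases "a' = a"; cases "b' = b"; cases "c' = c"; cases
    "d' = d") (simp_all add: insert_commute card_insert_if)

lemma card_diagonals_Un:
  "card (diagonals (a, b, c, d) \<union> diagonals (a', b', c', d')) +
    (of_bool (a' = a \<and> c' = c) + of_bool (b' = b \<and> d' = d)) = 4"
  unfolding diagonals_def
  by (cases "a' = a"; cases "b' = b"; cases "c' = c"; cases "d' = d") (simp_all add: card_insert_if)

text \<open>\<open>A\<close> to \<open>D\<close> say which corners two squares share. Relative to
  independence, a shared side gains \<open>1 / p\<close> and a shared diagonal \<open>1 / q\<close>;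
  three common corners give two sides and one diagonal, four give everything. The sum over all
  patterns dominates the pattern that occurs.\<close>

lemma square_pair_bound:
  fixes p q :: real
  assumes p: "0 < p" and q: "0 < q"
    and k: "k + (of_bool (A \<and> B) + of_bool (B \<and> C) + of_bool (C \<and> D) + of_bool (A \<and> D)) =
      (8 :: nat)"
    and l: "l + (of_bool (A \<and> C) + of_bool (B \<and> D)) = (4 :: nat)"
  shows "p ^ k * q ^ l \<le> (p ^ 4 * q\<^sup>2)\<^sup>2 *
    (1 + (of_bool (A \<and> B) + of_bool (B \<and> C) + of_bool (C \<and> D) + of_bool (A \<and> D)) / p
       + (of_bool (A \<and> C) + of_bool (B \<and> D)) / q
       + (of_bool (A \<and> B \<and> C) + of_bool (B \<and> C \<and> D) + of_bool (A \<and> C \<and> D) + of_bool (A \<and> B \<and>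
         D)) / (p\<^sup>2 * q)
       + of_bool (A \<and> B \<and> C \<and> D) / (p ^ 4 * q\<^sup>2))"
proof -
  have expand: "(p ^ 4 * q\<^sup>2)\<^sup>2 * (1 + x / p + y / q + z / (p\<^sup>2 * q) + w / (p ^ 4 * q\<^sup>2)) =
      p^8 * q^4 + x * (p^7 * q^4) + y * (p^8 * q^3) + z * (p^6 * q^3) + w * (p^4 * q^2)" for x y z w
    using p q by (simp add: field_simps eval_nat_numeral)
  have "0 \<le> p^8 * q^4" "0 \<le> p^7 * q^4" "0 \<le> p^8 * q^3" "0 \<le> p^6 * q^3" "0 \<le> p^4 * q^2"
    using p q by simp_all
  moreover have "k = 8 - (of_bool (A \<and> B) + of_bool (B \<and> C) + of_bool (C \<and> D) + of_bool (A \<and> D))"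
    "l = 4 - (of_bool (A \<and> C) + of_bool (B \<and> D))" using k l by simp_all
  ultimately show ?thesis
    unfolding expand by (cases A; cases B; cases C; cases D) simp_all
qed

lemma square_pairs_sum:
  fixes p :: real
  assumes t: "t \<in> quads m" and n: "4 * m \<le> n" and p: "0 < p" "p < 1"
  defines "q \<equiv> 1 - p"
  shows "(\<Sum>t'\<in>quads m. measure_pmf.prob (random_graph n p) (square_event m t \<inter> square_event m t')) \<le>
    real (card (quads m)) * (p ^ 4 * q\<^sup>2)\<^sup>2 *
    (1 + (4 / (real m ^ 2 * p) + 2 / (real m ^ 2 * q) + 4 / (real m ^ 3 * p\<^sup>2 * q) +
      1 / (real m ^ 4 * p ^ 4 * q\<^sup>2)))"
proof -
  obtain a b c d where abcd: "t = (a, b, c, d)" by (cases t)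
  have I: "a \<in> {1..m}" "b \<in> {1..m}" "c \<in> {1..m}" "d \<in> {1..m}" and m: "m > 0" using t abcd by auto
  have q: "q > 0" using p by (simp add: q_def)
  have card: "real (card (quads m)) = real m ^ 4" by (simp add: power4_eq_xxxx)
  have count: "(\<Sum>t'\<in>quads m. of_bool (t' \<in> S)) = real (card S)" if "S \<subseteq> quads m" for S
    using that by (simp add: sum_of_bool_eq Int_absorb1)
  let ?I = "{1..m}"
  \<comment> \<open>Each pattern of shared corners becomes membership in a box of
    \<open>quads m\<close>; a box with \<open>r\<close> prescribed corners has
    \<open>m ^ (4 - r)\<close> elements.\<close>
  define f where "f = (\<lambda>t'. 1 + (of_bool (t' \<in> {a} \<times> {b} \<times> ?I \<times> ?I) + of_bool (t' \<in> ?I \<times> {b} \<times> {c}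
    \<times> ?I)
        + of_bool (t' \<in> ?I \<times> ?I \<times> {c} \<times> {d}) + of_bool (t' \<in> {a} \<times> ?I \<times> ?I \<times> {d})) / p
      + (of_bool (t' \<in> {a} \<times> ?I \<times> {c} \<times> ?I) + of_bool (t' \<in> ?I \<times> {b} \<times> ?I \<times> {d})) / q
      + (of_bool (t' \<in> {a} \<times> {b} \<times> {c} \<times> ?I) + of_bool (t' \<in> ?I \<times> {b} \<times> {c} \<times> {d})
        + of_bool (t' \<in> {a} \<times> ?I \<times> {c} \<times> {d}) + of_bool (t' \<in> {a} \<times> {b} \<times> ?I \<times> {d})) / (p\<^sup>2 * q)
      + of_bool (t' \<in> {a} \<times> {b} \<times> {c} \<times> {d}) / (p ^ 4 * q\<^sup>2))"
  have "(\<Sum>t'\<in>quads m. measure_pmf.prob (random_graph n p) (square_event m t \<inter> square_event m t')) \<le>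
      (\<Sum>t'\<in>quads m. (p ^ 4 * q\<^sup>2)\<^sup>2 * f t')"
  proof (rule sum_mono)
    fix t' assume t': "t' \<in> quads m"
    then obtain a' b' c' d' where t'_eq: "t' = (a', b', c', d')"
      and I': "a' \<in> ?I" "b' \<in> ?I" "c' \<in> ?I" "d' \<in> ?I" by blast
    have "measure_pmf.prob (random_graph n p) (square_event m t \<inter> square_event m t') =
        p ^ card (sides t \<union> sides t') * q ^ card (diagonals t \<union> diagonals t')"
      using prob_square_events[OF t t' n] p by (simp add: q_def)
    also have "\<dots> \<le> (p ^ 4 * q\<^sup>2)\<^sup>2 * f t'"
      using square_pair_bound[OF p(1) q card_sides_Un[of a b c d a' b' c' d'] card_diagonals_Un[of
        a b c d a' b' c' d']] I'
      by (simp add: f_def abcd t'_eq)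
    finally show "measure_pmf.prob (random_graph n p) (square_event m t \<inter> square_event m t') \<le>
      (p ^ 4 * q\<^sup>2)\<^sup>2 * f t'" .
  qed
  also have "\<dots> = (p ^ 4 * q\<^sup>2)\<^sup>2 * (\<Sum>t'\<in>quads m. f t')" by (simp add: sum_distrib_left)
  also have "(\<Sum>t'\<in>quads m. f t') = real m ^ 4 + 4 * real m ^ 2 / p + 2 * real m ^ 2 / q +
    4 * real m / (p\<^sup>2 * q) + 1 / (p ^ 4 * q\<^sup>2)"
    unfolding f_def sum.distrib sum_divide_distrib[symmetric]
    using I by (subst count, force)+ (simp add: power2_eq_square power4_eq_xxxx mult.assoc)
  also have "\<dots> = real m ^ 4 * (1 + (4 / (real m ^ 2 * p) + 2 / (real m ^ 2 * q) + 4 / (real m ^ 3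
    * p\<^sup>2 * q) + 1 / (real m ^ 4 * p ^ 4 * q\<^sup>2)))"
    using m p q by (simp add: field_simps eval_nat_numeral)
  finally show ?thesis by (simp only: card mult_ac)
qed

text \<open>Each denominator is bounded below by a multiple of \<open>C\<close>. The factors 64,
  2048 and 65536 are \<open>8^2\<close>, \<open>4 * 8^3\<close> and \<open>16 * 8^4\<close>: powers
  of 8 from \<open>n / 8 \<le> m\<close>, the rest from halves in the case distinctions. With the
  numerators they add up to less than 100000.\<close>

lemma second_moment_terms:
  fixes n m p q C :: real
  assumes pq: "0 < p" "0 < q" "p + q = 1" and n: "1 \<le> n" "n / 8 \<le> m" and C: "1 \<le> C" "C \<le> p * n"
    "C \<le> q * n\<^sup>2"
  shows "4 / (m ^ 2 * p) + 2 / (m ^ 2 * q) + 4 / (m ^ 3 * p\<^sup>2 * q) + 1 / (m ^ 4 * p ^ 4 * q\<^sup>2) \<le>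
    100000 / C"
proof -
  have m: "n ^ k / 8 ^ k \<le> m ^ k" for k using power_mono[of "n / 8" m k] n
    by (simp add: power_divide)
  have inv: "k / x \<le> k * l / C" if "C \<le> l * x" "0 \<le> k" "0 < x" for k l x :: real
  proof -
    have "k / x = k * C / (x * C)" using C by simp
    also have "\<dots> \<le> k * (l * x) / (x * C)" using that C
      by (intro divide_right_mono mult_left_mono) auto
    finally show ?thesis using that by simp
  qed
  have m0: "m > 0" using n by simp
  have 1: "C \<le> 64 * (m ^ 2 * p)"
  proof -
    have "p * n \<le> p * n\<^sup>2" using pq n by (intro mult_left_mono) (auto simp: power2_eq_square)
    also have "\<dots> \<le> p * (64 * m ^ 2)" using pq m[of 2] by (intro mult_left_mono) auto
    finally show ?thesis using C by (simp add: mult_ac)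
  qed
  have 2: "C \<le> 64 * (m ^ 2 * q)"
  proof -
    have "q * n\<^sup>2 \<le> q * (64 * m ^ 2)" using pq m[of 2] by (intro mult_left_mono) auto
    then show ?thesis using C by (simp add: mult_ac)
  qed
  have C_power: "C \<le> C ^ k" if "k > 0" for k using power_increasing[of 1 k C] that C by simp
  have 3: "C \<le> 2048 * (m ^ 3 * p\<^sup>2 * q)"
  proof -
    have "C \<le> 4 * (n ^ 3 * p\<^sup>2 * q)"
    \<comment> \<open>One of \<open>p\<close> and \<open>q\<close> is at least one half and is
      traded for a constant; the other one supplies the powers of \<open>C\<close>.\<close>
    proof (cases "p \<ge> 1/2")
      case True
      then have "1 \<le> 4 * p\<^sup>2" using power_mono[of "1/2" p 2] by (simp add: power_divide)
      then have "C * 1 * 1 \<le> (q * n\<^sup>2) * n * (4 * p\<^sup>2)" using C n by (intro mult_mono) auto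
      then show ?thesis by (simp add: power2_eq_square power3_eq_cube mult_ac)
    next
      case False
      then have "1 \<le> 4 * q" using pq by simp
      then have "C ^ 2 * 1 * 1 \<le> (p * n)\<^sup>2 * n * (4 * q)" using C n
        by (intro mult_mono power_mono) auto
      then show ?thesis using C_power[of 2] by (simp add: power2_eq_square power3_eq_cube mult_ac)
    qed
    also have "\<dots> \<le> 4 * ((512 * m ^ 3) * p\<^sup>2 * q)"
      using pq m[of 3] by (intro mult_left_mono mult_right_mono) auto
    finally show ?thesis by simp
  qed
  have 4: "C \<le> 65536 * (m ^ 4 * p ^ 4 * q\<^sup>2)"
  proof -
    have "C \<le> 16 * (n ^ 4 * p ^ 4 * q\<^sup>2)"
    proof (cases "p \<ge> 1/2")
      case True
      then have "1 \<le> 16 * p ^ 4" using power_mono[of "1/2" p 4] by (simp add: power_divide)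
      then have "C ^ 2 * 1 \<le> (q * n\<^sup>2)\<^sup>2 * (16 * p ^ 4)" using C n
        by (intro mult_mono power_mono) auto
      then show ?thesis using C_power[of 2] by (simp add: power_mult_distrib mult_ac)
    next
      case False
      then have "1 \<le> 16 * q\<^sup>2" using power_mono[of "1/2" q 2] pq by (simp add: power_divide)
      then have "C ^ 4 * 1 \<le> (p * n) ^ 4 * (16 * q\<^sup>2)" using C n
        by (intro mult_mono power_mono) auto
      then show ?thesis using C_power[of 4] by (simp add: power_mult_distrib mult_ac)
    qed
    also have "\<dots> \<le> 16 * ((4096 * m ^ 4) * p ^ 4 * q\<^sup>2)"
      using pq m[of 4] by (intro mult_left_mono mult_right_mono) auto
    finally show ?thesis by simp
  qed
  have "4 / (m ^ 2 * p) + 2 / (m ^ 2 * q) + 4 / (m ^ 3 * p\<^sup>2 * q) + 1 / (m ^ 4 * p ^ 4 * q\<^sup>2) \<le>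
      4 * 64 / C + 2 * 64 / C + 4 * 2048 / C + 1 * 65536 / C"
    using pq m0 by (intro add_mono inv 1 2 3 4) auto
  also have "\<dots> \<le> 100000 / C" using C by (simp add: field_simps)
  finally show ?thesis .
qed

lemma induced_square_aas:
  fixes p :: "nat \<Rightarrow> real"
  assumes p: "\<And>n. n \<ge> 1 \<Longrightarrow> 0 < p n \<and> p n < 1"
    and lim1: "filterlim (\<lambda>n. p n * real n) at_top sequentially"
    and lim2: "filterlim (\<lambda>n. (1 - p n) * (real n)\<^sup>2) at_top sequentially"
    and Q: "\<And>n E a b c d. \<lbrakk>E \<subseteq> all_edges {1..n}; {a, b} \<in> E; {b, c} \<in> E; {c, d} \<in> E; {d, a} \<in> E;
      {a, c} \<notin> E; {b, d} \<notin> E; a \<noteq> c; b \<noteq> d\<rbrakk> \<Longrightarrow> Q n E"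
  shows "asymptotically_almost_surely p Q"
proof -
  \<comment> \<open>The minimum tends to infinity whatever \<open>p\<close> does, so the two
    hypotheses can be used without knowing whether \<open>p\<close> is small or close to 1.\<close>
  define C where "C n = min (p n * real n) ((1 - p n) * (real n)\<^sup>2)" for n
  have C: "filterlim C at_top sequentially"
    unfolding C_def filterlim_at_top min_le_iff_disj min.bounded_iff
  proof
    fix z
    show "eventually (\<lambda>n. z \<le> p n * real n \<and> z \<le> (1 - p n) * (real n)\<^sup>2) sequentially"
      using lim1 lim2 by (auto simp: filterlim_at_top intro: eventually_conj)
  qed
  define m where "m n = n div 4" for n :: nat
  show ?thesis
  proof (rule asymptotically_almost_surelyI[where P = "\<lambda>n E. \<exists>t\<in>quads (m n). E \<in> square_event (m
    n) t" and \<delta> = "\<lambda>n. 100000 / C n"])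
    show "(\<lambda>n. 100000 / C n) \<longlonglongrightarrow> 0"
      by (rule real_tendsto_divide_at_top[OF tendsto_const C])
    have "eventually (\<lambda>n. 1 \<le> C n) sequentially" using C by (simp add: filterlim_at_top)
    then show "eventually (\<lambda>n. measure_pmf.prob (random_graph n (p n)) {E. \<not> (\<exists>t\<in>quads (m n). E \<in>
      square_event (m n) t)} \<le> 100000 / C n) sequentially"
      \<comment> \<open>From \<open>8 \<le> n\<close> one gets \<open>n / 8 \<le> n div 4\<close>,
        so the blocks have linear size.\<close>
      using eventually_ge_at_top[of 8]
    proof eventually_elim
      case (elim n)
      have p': "0 < p n" "p n < 1" using p[of n] elim by auto
      have m4: "4 * m n \<le> n" by (simp add: m_def)
      have "n \<le> 4 * m n + 3" by (simp add: m_def)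
      then have m8: "real n / 8 \<le> real (m n)" using elim(2) by linarith
      let ?\<pi> = "p n ^ 4 * (1 - p n)\<^sup>2"
      let ?\<delta> = "4 / (real (m n) ^ 2 * p n) + 2 / (real (m n) ^ 2 * (1 - p n)) + 4 / (real (m n) ^
        3 * (p n)\<^sup>2 * (1 - p n))
        + 1 / (real (m n) ^ 4 * p n ^ 4 * (1 - p n)\<^sup>2)"
      have "measure_pmf.prob (random_graph n (p n)) {E. \<forall>t\<in>quads (m n). E \<notin> square_event (m n) t}
        \<le> ?\<delta>"
      proof (rule second_moment_bound[where \<pi> = ?\<pi>])
        show "0 < card (quads (m n))" using m8 elim(2) by (simp add: card_gt_0_iff)
        show "measure_pmf.prob (random_graph n (p n)) (square_event (m n) t) = ?\<pi>"
          if "t \<in> quads (m n)" for t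
        proof -
          obtain a b c d where "t = (a, b, c, d)" by (cases t)
          \<comment> \<open>The counting lemmas with both squares equal: a single event is treated
            as the pair of \<open>t\<close> with itself.\<close>
          then have "card (sides t) = 4" "card (diagonals t) = 2"
            using card_sides_Un[of a b c d a b c d] card_diagonals_Un[of a b c d a b c d]
              by simp_all
          then show ?thesis using prob_square_events[OF that that m4] p' by simp
        qed
        show "(\<Sum>t'\<in>quads (m n). measure_pmf.prob (random_graph n (p n)) (square_event (m n) t \<inter>
          square_event (m n) t'))
          \<le> real (card (quads (m n))) * ?\<pi>\<^sup>2 * (1 + ?\<delta>)" if "t \<in> quads (m n)" for t
          by (rule square_pairs_sum[OF that m4 p'])
      qed (use p' in \<open>auto simp: finite_set_pmf_random_graph\<close>)
      also have "?\<delta> \<le> 100000 / C n"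
        using p' elim m8 by (intro second_moment_terms[where n = "real n"]) (auto simp: C_def)
      finally show ?case by simp
    qed
    show "eventually (\<lambda>n. \<forall>E. E \<subseteq> all_edges {1..n} \<longrightarrow> (\<exists>t\<in>quads (m n). E \<in> square_event (m n) t) \<longrightarrow>
      Q n E) sequentially"
    proof (intro always_eventually allI impI)
      fix n E assume E: "E \<subseteq> all_edges {1..n}" and "\<exists>t\<in>quads (m n). E \<in> square_event (m n) t"
      then obtain a b c d where abcd: "(a, b, c, d) \<in> quads (m n)" "E \<in> square_event (m n) (a, b,
        c, d)" by auto
      let ?m = "m n"
      have "{a, ?m + b} \<in> E" "{?m + b, 2 * ?m + c} \<in> E" "{2 * ?m + c, 3 * ?m + d} \<in> E"
        "{3 * ?m + d, a} \<in> E"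
        "{a, 2 * ?m + c} \<notin> E" "{?m + b, 3 * ?m + d} \<notin> E"
        using abcd(2) by (auto simp: square_event_def sides_def diagonals_def block_pair_def
          insert_commute)
      moreover have "a \<noteq> 2 * ?m + c" "?m + b \<noteq> 3 * ?m + d" using abcd(1) by auto
      ultimately show "Q n E" using E by (intro Q)
    qed
  qed
qed

section \<open>Graph products over random graphs\<close>

theorem theorem3:
  fixes G :: "nat \<Rightarrow> ('a, 'm) monoid_scheme" and p :: "nat \<Rightarrow> real"
  assumes "\<And>i. i \<ge> 1 \<Longrightarrow> finitely_generated_group (G i)"
    and "\<And>i. i \<ge> 1 \<Longrightarrow> carrier (G i) \<noteq> {\<one>\<^bsub>G i\<^esub>}"
    and "\<And>n. n \<ge> 1 \<Longrightarrow> 0 < p n \<and> p n < 1"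
  shows
    "((\<lambda>n. (1 - p n) * (real n)\<^sup>2) \<longlonglongrightarrow> 0 \<longrightarrow>
        asymptotically_almost_surely p
          (\<lambda>n E. graph_product {1..n} E G \<cong> product_group {1..n} G))
   \<and> ((\<lambda>n. p n * real n) \<longlonglongrightarrow> 0 \<longrightarrow>
        asymptotically_almost_surely p
          (\<lambda>n E. weakly_hyperbolic (graph_product {1..n} E G)
                   (vertex_subgroup {1..n} E G ` {1..n})))
   \<and> (filterlim (\<lambda>n. p n * real n) at_top sequentially
        \<and> filterlim (\<lambda>n. (1 - p n) * (real n)\<^sup>2) at_top sequentially \<longrightarrow>
        asymptotically_almost_surely p
          (\<lambda>n E. \<not> weakly_hyperbolic (graph_product {1..n} E G)
                   (vertex_subgroup {1..n} E G ` {1..n})))"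
proof (intro conjI impI)
  have gog: "graph_of_groups {1..n} E G" if "E \<subseteq> all_edges {1..n}" for n E
    using assms(1) that by (intro graph_of_groups.intro) (auto simp: finitely_generated_group_def)
  {
    assume "(\<lambda>n. (1 - p n) * (real n)\<^sup>2) \<longlonglongrightarrow> 0"
    with assms(3) show "asymptotically_almost_surely p
        (\<lambda>n E. graph_product {1..n} E G \<cong> product_group {1..n} G)"
    proof (rule complete_graph_aas)
      fix n
      interpret graph_of_groups "{1..n}" "all_edges {1..n}" G by (rule gog) simp
      show "graph_product {1..n} (all_edges {1..n}) G \<cong> product_group {1..n} G"
      proof (rule complete_graph_product)
        fix u v assume "u \<in> {1..n}" "v \<in> {1..n}" "u \<noteq> v"
        then have "{u, v} \<in> all_edges {1..n}" by (auto simp: all_edges_def)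
        then show "adj u v" unfolding adj_def .
      qed simp
    qed
  next
    assume "(\<lambda>n. p n * real n) \<longlonglongrightarrow> 0"
    with assms(3) show "asymptotically_almost_surely p
        (\<lambda>n E. weakly_hyperbolic (graph_product {1..n} E G) (vertex_subgroup {1..n} E G ` {1..n}))"
    proof (rule four_cycle_free_aas)
      fix n E assume E: "E \<subseteq> all_edges {1..n}" "four_cycle_free E"
      interpret graph_of_groups "{1..n}" E G by (rule gog) fact
      show "weakly_hyperbolic (graph_product {1..n} E G) (vertex_subgroup {1..n} E G ` {1..n})"
      proof (rule square_free_weakly_hyperbolic)
        fix a b c d assume "adj a b" "adj b c" "adj c d" "adj d a" "a \<noteq> c" "b \<noteq> d"
        then show "adj a c \<or> adj b d" using E(2) unfolding four_cycle_free_def adj_def by blast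
      qed (use assms(1) in auto)
    qed
  next
    assume lim: "filterlim (\<lambda>n. p n * real n) at_top sequentially
      \<and> filterlim (\<lambda>n. (1 - p n) * (real n)\<^sup>2) at_top sequentially"
    show "asymptotically_almost_surely p
        (\<lambda>n E. \<not> weakly_hyperbolic (graph_product {1..n} E G) (vertex_subgroup {1..n} E G `
          {1..n}))"
    proof (rule induced_square_aas[OF assms(3) conjunct1[OF lim] conjunct2[OF lim]])
      fix n E and a b c d :: nat
      assume E: "E \<subseteq> all_edges {1..n}" and sq: "{a, b} \<in> E" "{b, c} \<in> E" "{c, d} \<in> E" "{d, a} \<in> E"
        "{a, c} \<notin> E" "{b, d} \<notin> E" "a \<noteq> c" "b \<noteq> d"
      interpret graph_of_groups "{1..n}" E G by (rule gog) fact
      show "\<not> weakly_hyperbolic (graph_product {1..n} E G) (vertex_subgroup {1..n} E G ` {1..n})"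
        by (rule induced_square_not_weakly_hyperbolic[of a b c d])
          (use sq assms(2) in \<open>auto simp: adj_def\<close>)
    qed
  }
qed

end
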